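(* The functional equation $$R(t,u,w)=ut\,(B(t,u)+t)+\frac{ut\,(R(t,w,w)-R(t,u,w))}{w-u}+\frac{ut^2\,(R(t,u,w)-R(t,u,ut))}{w-ut}+R(t,u,ut)\,ut\,(B(t,u)+t)$$ has a unique formal power series solution $R(t,u,w)$, and it is satisfied by the generating function $R(t,u,w)$ of generic three-sided prudent polygons ending at $(1,0)$. For this generating function, counting by half-perimeter and width, one has the identity of formal power series in $t$ $$R(t,w,w)=\sum_{k\ge0}L\big((tq^2)^k w\big)\prod_{j=0}^{k-1}K\big((tq^2)^j w\big).$$
   Context: Prudent walks: a nearest-neighbour self-avoiding walk on $\mathbb{Z}^2$ starting at $(0,0)$ is prudent if whenever a step goes from $v$ to $v+d$ ($d$ a unit vector), no vertex $v+kd$, $k\ge1$, was visited before. The box of a walk is the smallest axis-parallel (possibly degenerate) rectangle containing its vertices. A prudent walk is three-sided if every step ends on the left, top or right side of the current box, and every left or right step ending on the bottom side of the current box enlarges the box. A three-sided prudent polygon is such a walk with at least two steps whose last vertex is adjacent to $(0,0)$, identified with the closed polygon obtained by adding the closing edge and with the set of unit cells it encloses; its half-perimeter $\mathrm{hp}$ is $(n+1)/2$ with $n$ the number of steps. It is generic (ending at $(1,0)$) if its last vertex is $(1,0)$ and its penultimate vertex is $(1,1)$. The top row is the set of enclosed cells in the topmost row of the box. $R(t,u,w)=\sum t^{\mathrm{hp}}u^{a}w^{b}$ over generic three-sided prudent polygons ending at $(1,0)$, where $a$ is the number of cells in the top row and $b$ is the horizontal distance between the top left corner of the top row and the top left corner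 of the box (so $a+b$ is the width). Notation: $B(t,u)=\frac{1-t-u(1+t)t-\sqrt{t^2(1-t)^2u^2-2t(1-t^2)u+(1-t)^2}}{2tu}$; $q=\frac{t^2+1-\sqrt{1-4t+2t^2+t^4}}{2t}$; $$K(w)=\frac{(1-t)q-1-\big((1-t+t^2)q-1\big)(B(t,qw)+t)\,w}{1-t(1+t)q-\big(t(1-t-t^3)q+t^2\big)(B(t,qw)+t)\,w},$$ $$L(w)=\frac{\big(1+t^2-(1-2t+2t^2+t^4)q\big)(B(t,qw)+t)\,w}{1-t(1+t)q-\big(t(1-t-t^3)q+t^2\big)(B(t,qw)+t)\,w}.$$ *)

theory Defs
  imports
    "HOL-Analysis.Analysis"
    "HOL-Computational_Algebra.Formal_Power_Series"
    "HOL-Computational_Algebra.Fraction_Field"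
begin

section \<open>Three-sided prudent polygons\<close>

type_synonym point = "int \<times> int"

definition unit_vectors :: "point set" where
  "unit_vectors = {(1, 0), (-1, 0), (0, 1), (0, -1)}"

text \<open>A walk with \<open>n\<close> steps is the list of its \<open>n + 1\<close> vertices.\<close>

definition saw :: "point list \<Rightarrow> bool" where
  "saw p \<longleftrightarrow> p \<noteq> [] \<and> hd p = (0, 0) \<and> distinct p \<and>
     (\<forall>i. Suc i < length p \<longrightarrow> p ! Suc i - p ! i \<in> unit_vectors)"

definition steps :: "point list \<Rightarrow> nat" where
  "steps p = length p - 1"

definition prudent :: "point list \<Rightarrow> bool" where
  "prudent p \<longleftrightarrow> saw p \<and>
     (\<forall>i. Suc i < length p \<longrightarrow>
        (let v = p ! i; d = p ! Suc i - v in
         \<forall>k::int. k \<ge> 1 \<longrightarrow> (fst v + k * fst d, snd v + k * snd d) \<notin> set (take (Suc i) p)))"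

definition xmin :: "point list \<Rightarrow> int" where "xmin p = Min (fst ` set p)"
definition xmax :: "point list \<Rightarrow> int" where "xmax p = Max (fst ` set p)"
definition ymin :: "point list \<Rightarrow> int" where "ymin p = Min (snd ` set p)"
definition ymax :: "point list \<Rightarrow> int" where "ymax p = Max (snd ` set p)"

definition bbox :: "point list \<Rightarrow> point set" where
  "bbox p = {xmin p..xmax p} \<times> {ymin p..ymax p}"

text \<open>The current box of a step is the box of the walk up to and including that step.\<close>

definition three_sided :: "point list \<Rightarrow> bool" where
  "three_sided p \<longleftrightarrow> prudent p \<and>
     (\<forall>i. Suc i < length p \<longrightarrow>
        (let old = take (Suc i) p; new = take (Suc (Suc i)) p; v = p ! Suc i in
         (fst v = xmin new \<or> snd v = ymax new \<or> fst v = xmax new) \<and>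
         (v - p ! i \<in> {(1, 0), (-1, 0)} \<and> snd v = ymin new \<longrightarrow> bbox old \<subset> bbox new)))"

definition three_sided_polygon :: "point list \<Rightarrow> bool" where
  "three_sided_polygon p \<longleftrightarrow> three_sided p \<and> steps p \<ge> 2 \<and> last p - (0, 0) \<in> unit_vectors"

definition generic_polygon :: "point list \<Rightarrow> bool" where
  "generic_polygon p \<longleftrightarrow>
     three_sided_polygon p \<and> last p = (1, 0) \<and> p ! (length p - 2) = (1, 1)"

text \<open>The number of steps of a polygon is odd, so the division is exact.\<close>

definition half_perimeter :: "point list \<Rightarrow> nat" where
  "half_perimeter p = (steps p + 1) div 2"

definition embed :: "point \<Rightarrow> complex" where
  "embed v = Complex (of_int (fst v)) (of_int (snd v))"

definition closed_polygon :: "point list \<Rightarrow> complex set" where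
  "closed_polygon p =
     (\<Union>i<length p. closed_segment (embed (p ! i)) (embed (p ! (Suc i mod length p))))"

text \<open>A unit cell is represented by its lower left corner.\<close>

definition enclosed_cells :: "point list \<Rightarrow> point set" where
  "enclosed_cells p = {c. box (embed c) (embed (c + (1, 1))) \<subseteq> inside (closed_polygon p)}"

definition top_row :: "point list \<Rightarrow> point set" where
  "top_row p = {c \<in> enclosed_cells p. snd c = ymax p - 1}"

definition top_offset :: "point list \<Rightarrow> nat" where
  "top_offset p = nat (Min (fst ` top_row p) - xmin p)"

section \<open>Power series\<close>

text \<open>
  Series in \<open>t\<close> are of type \<open>rat fps\<close>; the series ring in \<open>t\<close> and one further variable
  (\<open>u\<close> or \<open>w\<close>) is \<open>rat fps fps\<close>, and the one in \<open>t\<close>, \<open>u\<close>, \<open>w\<close> is \<open>rat fps fps fps\<close>.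
  The variable \<open>t\<close> is always innermost; \<open>w\<close> is the outermost variable of the trivariate ring.
\<close>

definition R_gf :: "rat fps fps fps" where
  "R_gf = Abs_fps (\<lambda>b. Abs_fps (\<lambda>a. Abs_fps (\<lambda>n.
     of_nat (card {p. generic_polygon p \<and> half_perimeter p = n \<and>
                      card (top_row p) = a \<and> top_offset p = b}))))"

text \<open>
  \<open>subst_w F s\<close> is \<open>F(t,u,s)\<close> for a series \<open>s\<close> in \<open>t\<close> and \<open>u\<close> divisible by \<open>u\<close>; the terms
  with \<open>i > m\<close> do not contribute to the coefficient of \<open>u^m\<close>.  (In contrast to
  \<open>fps_compose\<close>, the coefficients of \<open>F\<close> involve \<open>u\<close> as well.)
\<close>

definition subst_w :: "rat fps fps fps \<Rightarrow> rat fps fps \<Rightarrow> rat fps fps" where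
  "subst_w F s = Abs_fps (\<lambda>m. \<Sum>i\<le>m. fps_nth (fps_nth F i * s ^ i) m)"

text \<open>\<open>F(t,w,w)\<close>, as a series in \<open>t\<close> and \<open>w\<close>:\<close>

definition diag :: "rat fps fps fps \<Rightarrow> rat fps fps" where
  "diag F = subst_w F fps_X"

text \<open>Embedding of the series in \<open>t\<close> and \<open>w\<close> into the trivariate ring:\<close>

definition lift_w :: "rat fps fps \<Rightarrow> rat fps fps fps" where
  "lift_w G = Abs_fps (\<lambda>n. fps_const (fps_nth G n))"

text \<open>
  The square root in \<open>B\<close> is the one with constant term \<open>1\<close>.  The quotient by \<open>2tu\<close> is a
  power series, but \<open>2tu\<close> is not a unit up to a power of the outermost variable, so the
  library division on \<open>rat fps fps\<close> does not yield it.
\<close>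

definition B_sqrt :: "rat fps fps" where
  "B_sqrt = (let t = fps_const fps_X; u = fps_X in
     THE s. s ^ 2 = t ^ 2 * (1 - t) ^ 2 * u ^ 2 - 2 * t * (1 - t ^ 2) * u + (1 - t) ^ 2 \<and>
            fps_nth (fps_nth s 0) 0 = 1)"

definition B_ser :: "rat fps fps" where
  "B_ser = (let t = fps_const fps_X; u = fps_X in
     THE b. 2 * t * u * b = 1 - t - u * (1 + t) * t - B_sqrt)"

definition q_ser :: "rat fps" where
  "q_ser = (let t = fps_X in
     (t ^ 2 + 1 - fps_radical (\<lambda>_ _. 1) 2 (1 - 4 * t + 2 * t ^ 2 + t ^ 4)) / (2 * t))"

text \<open>\<open>scale_w c F\<close> is \<open>F(t, c w)\<close> for a series \<open>c\<close> in \<open>t\<close>.\<close>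

definition scale_w :: "rat fps \<Rightarrow> rat fps fps \<Rightarrow> rat fps fps" where
  "scale_w c F = fps_compose F (fps_const c * fps_X)"

definition K_ser :: "rat fps fps" where
  "K_ser = (let t = fps_const fps_X; w = fps_X; q = fps_const q_ser; Bq = scale_w q_ser B_ser in
     ((1 - t) * q - 1 - ((1 - t + t ^ 2) * q - 1) * (Bq + t) * w) /
     (1 - t * (1 + t) * q - (t * (1 - t - t ^ 3) * q + t ^ 2) * (Bq + t) * w))"

definition L_ser :: "rat fps fps" where
  "L_ser = (let t = fps_const fps_X; w = fps_X; q = fps_const q_ser; Bq = scale_w q_ser B_ser in
     ((1 + t ^ 2 - (1 - 2 * t + 2 * t ^ 2 + t ^ 4) * q) * (Bq + t) * w) /
     (1 - t * (1 + t) * q - (t * (1 - t - t ^ 3) * q + t ^ 2) * (Bq + t) * w))"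

text \<open>
  The functional equation, read in the field of fractions of the trivariate power series ring,
  since \<open>w - u\<close> and \<open>w - ut\<close> are not units.
\<close>

definition functional_equation :: "rat fps fps fps \<Rightarrow> bool" where
  "functional_equation F \<longleftrightarrow>
    (let t = fps_const (fps_const fps_X); u = fps_const fps_X; w = fps_X;
         B = fps_const B_ser;
         Fww = lift_w (diag F);
         Fut = fps_const (subst_w F (fps_X * fps_const fps_X));
         quot = Fraction_Field.Fract
     in quot F 1 =
          quot (u * t * (B + t)) 1
        + quot (u * t * (Fww - F)) (w - u)
        + quot (u * t ^ 2 * (F - Fut)) (w - u * t)
        + quot (Fut * u * t * (B + t)) 1)"

text \<open>
  Reordering a series in \<open>t\<close> and \<open>w\<close> by powers of \<open>t\<close>, so that the metric on the result is
  the \<open>t\<close>-adic one (with coefficients that are series in \<open>w\<close>).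
\<close>

definition by_t :: "rat fps fps \<Rightarrow> rat fps fps" where
  "by_t F = Abs_fps (\<lambda>n. Abs_fps (\<lambda>m. fps_nth (fps_nth F m) n))"

end

(*
  The polygon is cut into its rows. A generic three-sided prudent polygon is built from the virtual
  vertex (1,0) by adding one row at a time on top: the new row is right-aligned with the old one and
  either ends above it, or overhangs it but stays inside the box, or leaves the box on the left and
  then possibly continues as a path along the left side of the box down to any depth and back
  up, which is a bargraph. Its length and its distance to the left side of the box are all that
  matters for what can be added next. With the constant term 1 for the virtual vertex, the three
  possibilities are the three terms of the functional equation for 1 + R.

  For the product formula, the kernel (w - u)(w - ut) + ut(w - ut) - ut^2(w - u) vanishes
  both at (u,w) = (qw, w) and at (u,w) = (qw, tq^2 w). The two resulting equations contain the same
  unknown R(t, qw, tqw), and eliminating it gives R(t,w,w) = L(w) + K(w) R(t, tq^2 w, tq^2 w). Since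
  K is divisible by t, iteration converges.
*)
theory Submission
  imports Defs
begin

unbundle no vec_syntax and fps_syntax

section \<open>The functional equation as a fixed point equation\<close>

text \<open>As a quadratic in w the kernel is w^2 - (1 + t^2) u w + t u^2. Its roots are u/q and
  tqu, because q is a root of t q^2 - (1 + t^2) q + 1; for u = qw they become w and tq^2 w. Both
  points have the same u, which is why the same value of R(t, u, ut) occurs in both equations. Rows
  are right-aligned because the last step, from (1,1) to (1,0), has to end on the right side of the
  box: x = 1 is never exceeded, and a walk entering that line above the axis can only descend along
  it. The obstacle is to exclude the other continuations, up along x = 1 or onto x = 1 below the
  axis. They may go on legally but can never finish. Half-perimeters are obtained by counting left
  and up letters. In the closed polygon these are balanced by right and down letters, so the weight
  of a row does not depend on how the polygon is finished. Writing both difference quotients as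
  explicit power series turns the equation into F = c + (a linear map that gains a factor t), which
  yields uniqueness.\<close>

definition quot_wu :: "rat fps fps fps \<Rightarrow> rat fps fps fps" where
  "quot_wu F = Abs_fps (\<lambda>j. Abs_fps (\<lambda>i. \<Sum>b\<le>j. F $ b $ (i + 1 + j - b)))"

definition quot_wut :: "rat fps fps fps \<Rightarrow> rat fps fps fps" where
  "quot_wut F = Abs_fps (\<lambda>j. Abs_fps (\<lambda>i. \<Sum>k\<le>i. fps_X ^ k * F $ (j + 1 + k) $ (i - k)))"

abbreviation subst_ut :: "rat fps fps fps \<Rightarrow> rat fps fps" where
  "subst_ut F \<equiv> subst_w F (fps_X * fps_const fps_X)"

lemma diag_nth: "diag F $ m = (\<Sum>b\<le>m. F $ b $ (m - b))"
  unfolding diag_def subst_w_def by (auto simp: fps_X_power_mult_right_nth intro!: sum.cong)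

lemma subst_ut_nth: "subst_ut F $ m = (\<Sum>b\<le>m. fps_X ^ b * F $ b $ (m - b))"
proof -
  have "(F $ b * (fps_X * fps_const fps_X) ^ b) $ m = fps_X ^ b * F $ b $ (m - b)" if "b \<le> m" for b
  proof -
    have "F $ b * (fps_X * fps_const fps_X) ^ b = fps_const (fps_X ^ b) * (F $ b * fps_X ^ b)"
      by (simp only: power_mult_distrib fps_const_power mult.assoc mult.commute mult.left_commute)
    then show ?thesis using that
      by (simp only: fps_mult_left_const_nth fps_X_power_mult_right_nth) simp
  qed
  then show ?thesis unfolding subst_w_def by simp
qed

text \<open>By (w^a - u^a)/(w - u), the sum of u^i w^k over i + k = a - 1, a monomial u^a w^b of F
  contributes to u^i w^j exactly when b \<le> j and a = i + 1 + j - b. This is the origin of the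
  index in \<open>quot_wu\<close>.\<close>

lemma wu_quot_wu: "(fps_X - fps_const fps_X) * quot_wu F = lift_w (diag F) - F"
proof -
  have "((fps_X - fps_const fps_X) * quot_wu F) $ j $ i = (lift_w (diag F) - F) $ j $ i" for i j
  proof (cases i; cases j)
    show ?thesis if "i = 0" "j = 0" using that
      by (simp add: left_diff_distrib lift_w_def diag_nth)
    show ?thesis if "i = 0" "j = Suc j'" for j' using that
      by (simp add: left_diff_distrib lift_w_def diag_nth quot_wu_def)
    show ?thesis if "i = Suc i'" "j = 0" for i' using that
      by (simp add: left_diff_distrib lift_w_def diag_nth quot_wu_def)
    show ?thesis if "i = Suc i'" "j = Suc j'" for i' j' using that
      by (simp add: left_diff_distrib lift_w_def diag_nth quot_wu_def)
  qed
  then show ?thesis by (simp add: fps_eq_iff)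
qed

text \<open>Here (w^b - (ut)^b)/(w - ut) is the sum of (ut)^k w^j over j + k = b - 1, so u^i w^j
  collects t^k times the coefficient of u^(i-k) w^(j+1+k).\<close>

lemma wut_quot_wut:
  "(fps_X - fps_const fps_X * fps_const (fps_const fps_X)) * quot_wut F = F - fps_const (subst_ut F)"
proof -
  have "((fps_X - fps_const (fps_X * fps_const fps_X)) * quot_wut F) $ j $ i
      = (F - fps_const (subst_ut F)) $ j $ i" for i j
  proof (cases i; cases j)
    show ?thesis if "i = 0" "j = 0" using that
      by (simp add: left_diff_distrib subst_ut_nth mult.assoc)
    show ?thesis if "i = 0" "j = Suc j'" for j' using that
      by (simp add: left_diff_distrib quot_wut_def mult.assoc)
    show ?thesis if "i = Suc i'" "j = 0" for i' using that
      by (simp add: left_diff_distrib subst_ut_nth quot_wut_def mult.assoc sum.atMost_Suc_shift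
           sum_distrib_left del: sum.atMost_Suc)
    show ?thesis if "i = Suc i'" "j = Suc j'" for i' j' using that
      by (simp add: left_diff_distrib quot_wut_def mult.assoc sum.atMost_Suc_shift
           sum_distrib_left del: sum.atMost_Suc)
  qed
  then show ?thesis by (simp add: fps_eq_iff)
qed

definition fe_linear :: "rat fps fps fps \<Rightarrow> rat fps fps fps" where
  "fe_linear F = (let t = fps_const (fps_const fps_X); u = fps_const fps_X in
     u * t * quot_wu F + u * t ^ 2 * quot_wut F
       + fps_const (subst_ut F) * u * t * (fps_const B_ser + t))"

lemma functional_equation_iff:
  "functional_equation F \<longleftrightarrow>
    F = fps_const fps_X * fps_const (fps_const fps_X) * (fps_const B_ser + fps_const (fps_const fps_X))
      + fe_linear F"
proof -
  let ?t = "fps_const (fps_const fps_X) :: rat fps fps fps" and ?u = "fps_const fps_X :: rat fps fps fps"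
  have nz: "fps_X - ?u \<noteq> 0" "fps_X - ?u * ?t \<noteq> 0"
    by (auto simp: fps_eq_iff intro!: exI[of _ 1])
  have cancel: "Fraction_Field.Fract (a * (d * c)) d = Fraction_Field.Fract (a * c) 1"
    if "d \<noteq> 0" for a c d :: "rat fps fps fps"
    using that by (simp add: eq_fract algebra_simps)
  have "functional_equation F \<longleftrightarrow>
     Fraction_Field.Fract F 1 = Fraction_Field.Fract (?u * ?t * (fps_const B_ser + ?t)) 1
       + Fraction_Field.Fract (?u * ?t * quot_wu F) 1 + Fraction_Field.Fract (?u * ?t ^ 2 * quot_wut F) 1
       + Fraction_Field.Fract (fps_const (subst_ut F) * ?u * ?t * (fps_const B_ser + ?t)) 1"
    unfolding functional_equation_def Let_def wu_quot_wu[symmetric] wut_quot_wut[symmetric]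
    by (simp only: cancel[OF nz(1)] cancel[OF nz(2)])
  moreover have "Fraction_Field.Fract a 1 + Fraction_Field.Fract c 1 = Fraction_Field.Fract (a + c) 1"
    "Fraction_Field.Fract a 1 = Fraction_Field.Fract c 1 \<longleftrightarrow> a = c" for a c :: "rat fps fps fps"
    by (simp_all add: eq_fract)
  ultimately show ?thesis
    by (simp only: fe_linear_def Let_def add.assoc)
qed

section \<open>Uniqueness by t-adic contraction\<close>

lemma fps_X_power_dvd_eq_0:
  fixes z :: "rat fps"
  assumes "\<And>n. fps_X ^ n dvd z"
  shows "z = 0"
proof -
  have "z $ n = 0" for n
  proof -
    obtain y where "z = fps_X ^ Suc n * y" using assms[of "Suc n"] by (auto elim: dvdE)
    then show ?thesis by (simp only: fps_X_power_mult_nth) simp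
  qed
  then show ?thesis by (simp add: fps_eq_iff)
qed

lemma fe_linear_nth:
  "fe_linear F $ b = fps_const fps_X * fps_X * quot_wu F $ b
        + fps_const fps_X * fps_X * (fps_const fps_X * quot_wut F $ b)
        + (if b = 0 then fps_const fps_X * fps_X * (subst_ut F * (B_ser + fps_const fps_X)) else 0)"
  unfolding fe_linear_def Let_def
    by (simp add: power2_eq_square mult.assoc fps_const_add[symmetric] algebra_simps
       del: fps_const_add fps_const_mult flip: fps_const_mult)
       (simp add: algebra_simps)

text \<open>Each summand of \<open>fe_linear\<close> carries an explicit factor t, while the
  quotients and \<open>subst_ut\<close> merely add up coefficients of F times powers of t.\<close>

lemma fe_linear_contraction:
  assumes "\<And>a b. fps_X ^ n dvd F $ b $ a"
  shows "fps_X ^ Suc n dvd fe_linear F $ b $ a"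
proof -
  have 1: "fps_X ^ n dvd quot_wu F $ b $ a" for a b
    unfolding quot_wu_def by (auto intro!: dvd_sum assms)
  have 2: "fps_X ^ n dvd quot_wut F $ b $ a" for a b
    unfolding quot_wut_def by (auto intro!: dvd_sum dvd_mult assms)
  have 3: "fps_X ^ n dvd (subst_ut F * (B_ser + fps_const fps_X)) $ a" for a
    unfolding fps_mult_nth subst_ut_nth
    by (rule dvd_sum, rule dvd_mult2, rule dvd_sum, rule dvd_mult, rule assms)
  have 4: "fps_X ^ Suc n dvd (fps_const (fps_X :: rat fps) * fps_X * G) $ a"
    if "\<And>a. fps_X ^ n dvd G $ a" for G a
    using that by (cases a) (auto simp: mult.assoc intro!: mult_dvd_mono)
  show ?thesis
    unfolding fe_linear_nth using 1 2 3 by (auto simp del: power_Suc intro!: dvd_add 4 dvd_mult)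
qed

lemma fe_linear_diff: "fe_linear (F - G) = fe_linear F - fe_linear G"
proof -
  have eqs: "quot_wu (F - G) = quot_wu F - quot_wu G" "quot_wut (F - G) = quot_wut F - quot_wut G"
    "subst_ut (F - G) = subst_ut F - subst_ut G"
    by (simp_all add: fps_eq_iff quot_wu_def quot_wut_def subst_ut_nth sum_subtractf right_diff_distrib)
  show ?thesis
    by (simp only: fe_linear_def Let_def eqs fps_const_sub[symmetric]) algebra
qed

lemma functional_equation_unique:
  assumes "functional_equation F" "functional_equation G"
  shows "F = G"
proof -
  have eq: "F - G = fe_linear (F - G)"
    using assms unfolding functional_equation_iff fe_linear_diff by algebra
  have "fps_X ^ n dvd (F - G) $ b $ a" for n a b
  proof (induction n arbitrary: a b)
    case (Suc n)
    then show ?case by (subst eq) (rule fe_linear_contraction)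
  qed simp
  then have "(F - G) $ b $ a = 0" for a b by (rule fps_X_power_dvd_eq_0)
  then show ?thesis by (simp add: fps_eq_iff)
qed

section \<open>The kernel method\<close>

text \<open>Completing the square in the quadratic for b gives a square root of the discriminant
  with constant term 1. The ring is an integral domain, so this root and the quotient by 2tu are
  unique, which settles both definite descriptions. The five summands match the constructors of
  \<open>bar\<close> below.\<close>

lemma B_ser_eqI:
  fixes b :: "rat fps fps"
  defines "t \<equiv> fps_const fps_X" and "u \<equiv> fps_X"
  assumes b: "b = u * t ^ 2 + u * t * b + t * b + u * t ^ 2 * b + u * t * b ^ 2"
  shows "B_ser = b"
proof -
  define s where "s = 1 - t - u * (1 + t) * t - 2 * t * u * b"
  have s2: "s ^ 2 = t ^ 2 * (1 - t) ^ 2 * u ^ 2 - 2 * t * (1 - t ^ 2) * u + (1 - t) ^ 2"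
    using b unfolding s_def by algebra
  have s0: "s $ 0 $ 0 = 1"
    by (simp add: s_def t_def u_def fps_mult_nth)
  have "B_sqrt = s"
    unfolding B_sqrt_def Let_def t_def[symmetric] u_def[symmetric]
  proof (rule the_equality)
    fix s' assume s': "s' ^ 2 = t ^ 2 * (1 - t) ^ 2 * u ^ 2 - 2 * t * (1 - t ^ 2) * u + (1 - t) ^ 2
      \<and> s' $ 0 $ 0 = 1"
    then have "s' = s \<or> s' = - s" using s2 by (metis power2_eq_iff)
    then show "s' = s" using s' s0 by auto
  qed (use s2 s0 in simp)
  moreover have "1 - t - u * (1 + t) * t - s = 2 * t * u * b"
    by (simp only: s_def) algebra
  ultimately have "B_ser = (THE b'. 2 * t * u * b' = 2 * t * u * b)"
    unfolding B_ser_def Let_def t_def[symmetric] u_def[symmetric] by simp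
  also have "\<dots> = b"
  proof (rule the_equality)
    have "2 * t * u \<noteq> 0"
      by (simp add: t_def u_def)
    then show "b' = b" if "2 * t * u * b' = 2 * t * u * b" for b'
      using that by simp
  qed simp
  finally show ?thesis .
qed

text \<open>This is the kernel equation at u = qw, divided by w^2. The radical has constant term 1,
  so the numerator of \<open>q_ser\<close> is divisible by t and the division by 2t is
  exact.\<close>

lemma q_ser_eq: "q_ser * (1 + fps_X ^ 2) = 1 + fps_X * q_ser ^ 2"
  and q_ser_nth_0: "q_ser $ 0 = 1"
proof -
  let ?t = "fps_X :: rat fps"
  define p where "p = 1 - 4 * ?t + 2 * ?t ^ 2 + ?t ^ 4"
  define s where "s = fps_radical (\<lambda>_ _. 1) 2 p"
  have p0: "p $ 0 = 1" by (simp add: p_def)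
  have s2: "s ^ 2 = p"
    using power_radical[of p "\<lambda>_ _. 1" 1] p0 by (simp add: s_def numeral_2_eq_2)
  have s0: "s $ 0 = 1" by (simp add: s_def fps_radical_def numeral_2_eq_2)
  have "(?t ^ 2 + 1 - s) $ 0 = 0" by (simp add: s0)
  then have "?t ^ 2 + 1 - s = ?t * fps_shift 1 (?t ^ 2 + 1 - s)"
    by (auto simp: fps_eq_iff)
  then obtain r where r: "?t ^ 2 + 1 - s = ?t * r" by blast
  have c2: "fps_const (1/2) * 2 = (1 :: rat fps)"
    by (simp only: fps_numeral_fps_const fps_const_mult) simp
  have "?t ^ 2 + 1 - s = 2 * ?t * (fps_const (1/2) * r)" using c2 unfolding r by algebra
  then have "q_ser = (2 * ?t * (fps_const (1/2) * r)) / (2 * ?t)"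
    unfolding q_ser_def Let_def s_def p_def by simp
  then have "q_ser = fps_const (1/2) * r"
    by simp
  then have tq: "2 * ?t * q_ser = ?t ^ 2 + 1 - s" using c2 r by algebra
  have "4 * ?t * (q_ser * (1 + ?t ^ 2)) = 4 * ?t * (1 + ?t * q_ser ^ 2)"
    using tq s2 unfolding p_def by algebra
  then show *: "q_ser * (1 + ?t ^ 2) = 1 + ?t * q_ser ^ 2" by simp
  from arg_cong[OF *, of "\<lambda>f. f $ 0"] show "q_ser $ 0 = 1" by simp
qed

section \<open>Substituting multiples of w for u and w\<close>

lemma scale_w_nth [simp]: "scale_w c F $ n = c ^ n * F $ n"
  by (simp add: scale_w_def fps_compose_linear)

lemma scale_w_add: "scale_w c (F + G) = scale_w c F + scale_w c G"
  and scale_w_const [simp]: "scale_w c (fps_const r) = fps_const r"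
  and scale_w_scale_w: "scale_w c (scale_w d F) = scale_w (c * d) F"
  and scale_w_1 [simp]: "scale_w 1 F = F"
  and scale_w_one [simp]: "scale_w c 1 = 1"
  by (auto simp: fps_eq_iff algebra_simps power_mult_distrib)

lemma scale_w_mult: "scale_w c (F * G) = scale_w c F * scale_w c G"
  by (simp add: scale_w_def fps_compose_mult_distrib)

text \<open>
  This is \<open>F(t, c w, d w)\<close>.
\<close>

definition eval_uw :: "rat fps \<Rightarrow> rat fps \<Rightarrow> rat fps fps fps \<Rightarrow> rat fps fps" where
  "eval_uw c d F = Abs_fps (\<lambda>m. \<Sum>b\<le>m. c ^ (m - b) * d ^ b * F $ b $ (m - b))"

lemma eval_uw_add: "eval_uw c d (F + G) = eval_uw c d F + eval_uw c d G"
  and eval_uw_diff: "eval_uw c d (F - G) = eval_uw c d F - eval_uw c d G"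
  by (simp_all add: fps_eq_iff eval_uw_def sum.distrib sum_subtractf algebra_simps)

lemma eval_uw_w: "eval_uw c d (fps_X * F) = fps_const d * fps_X * eval_uw c d F"
proof -
  have "eval_uw c d (fps_X * F) $ m = (fps_X * (fps_const d * eval_uw c d F)) $ m" for m
    by (cases m) (simp_all add: eval_uw_def sum.atMost_Suc_shift sum_distrib_left algebra_simps
        del: sum.atMost_Suc)
  then show ?thesis by (simp add: fps_eq_iff mult_ac)
qed

lemma eval_uw_u: "eval_uw c d (fps_const fps_X * F) = fps_const c * fps_X * eval_uw c d F"
proof -
  have "eval_uw c d (fps_const fps_X * F) $ m = (fps_X * (fps_const c * eval_uw c d F)) $ m" for m
    by (cases m) (auto simp: eval_uw_def sum_distrib_left algebra_simps Suc_diff_le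
        intro!: sum.cong)
  then show ?thesis by (simp add: fps_eq_iff mult_ac)
qed

lemma eval_uw_t: "eval_uw c d (fps_const (fps_const r) * F) = fps_const r * eval_uw c d F"
  by (simp add: fps_eq_iff eval_uw_def sum_distrib_left algebra_simps)

lemma eval_uw_const: "eval_uw c d (fps_const G) = scale_w c G"
proof -
  have "(\<Sum>b\<le>m. c ^ (m - b) * d ^ b * fps_const G $ b $ (m - b)) = c ^ m * G $ m" for m
    by (subst sum.remove[of _ 0]) (auto intro!: sum.neutral)
  then show ?thesis by (simp add: fps_eq_iff eval_uw_def)
qed

lemma eval_uw_lift: "eval_uw c d (lift_w G) = scale_w d G"
proof -
  have "(\<Sum>b\<le>m. c ^ (m - b) * d ^ b * lift_w G $ b $ (m - b)) = d ^ m * G $ m" for m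
    by (subst sum.remove[of _ m]) (auto simp: lift_w_def intro!: sum.neutral)
  then show ?thesis by (simp add: fps_eq_iff eval_uw_def)
qed

lemma scale_subst_ut: "scale_w c (subst_ut F) = eval_uw c (c * fps_X) F"
proof -
  have "c ^ m * subst_ut F $ m = eval_uw c (c * fps_X) F $ m" for m
    by (auto simp: eval_uw_def subst_ut_nth sum_distrib_left power_mult_distrib
        algebra_simps simp flip: power_add intro!: sum.cong)
  then show ?thesis by (simp add: fps_eq_iff)
qed

text \<open>The equation is multiplied by (w - u)(w - ut) before u = c'w and w = d'w are
  substituted, so points where the kernel vanishes are admissible.\<close>

lemma functional_equation_eval:
  assumes "functional_equation F"
  fixes c' d' :: "rat fps"
  defines "c \<equiv> fps_const c'" and "d \<equiv> fps_const d'"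
  defines "t \<equiv> fps_const fps_X" and "w \<equiv> fps_X :: rat fps fps"
  defines "Y \<equiv> \<lambda>d. scale_w d (diag F)" and "X \<equiv> \<lambda>c. eval_uw c (c * fps_X) F"
  shows "eval_uw c' d' F * (d - c) * (d - c * t) =
    c * w * t * (scale_w c' B_ser + t) * (1 + X c') * (d - c) * (d - c * t)
    + c * t * (Y d' - eval_uw c' d' F) * (d - c * t)
    + c * t ^ 2 * (eval_uw c' d' F - X c') * (d - c)"
proof -
  let ?t = "fps_const (fps_const fps_X) :: rat fps fps fps"
  let ?u = "fps_const fps_X :: rat fps fps fps"
  let ?w = "fps_X :: rat fps fps fps"
  have 1: "F = ?u * ?t * (fps_const B_ser + ?t) + (?u * ?t * quot_wu F + ?u * ?t ^ 2 * quot_wut F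
      + fps_const (subst_ut F) * ?u * ?t * (fps_const B_ser + ?t))"
    using assms(1) unfolding functional_equation_iff fe_linear_def Let_def .
  have 2: "(?w - ?u) * quot_wu F = lift_w (diag F) - F"
    by (rule wu_quot_wu)
  have 3: "(?w - ?u * ?t) * quot_wut F = F - fps_const (subst_ut F)"
    by (rule wut_quot_wut)
  define A where "A = (B_ser + t) * (1 + subst_ut F)"
  have A: "fps_const A = (fps_const B_ser + ?t) * (1 + fps_const (subst_ut F))"
    by (simp add: A_def t_def flip: fps_const_mult fps_const_add)
  define P where "P = lift_w (diag F) - F"
  define Q where "Q = F - fps_const (subst_ut F)"
  \<comment> \<open>The substitution rules for \<open>eval_uw\<close> cover sums, constants and
    multiplication by one of t, u, w at a time. Hence everything is expanded into nested products of
    this kind.\<close>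
  have "?w * (?w * F) - ?u * (?w * F) - ?t * (?u * (?w * F)) + ?t * (?u * (?u * F)) =
      ?t * (?u * (?w * (?w * fps_const A))) - ?t * (?u * (?u * (?w * fps_const A)))
      - ?t * (?t * (?u * (?u * (?w * fps_const A)))) + ?t * (?t * (?u * (?u * (?u * fps_const A))))
      + (?t * (?u * (?w * P)) - ?t * (?t * (?u * (?u * P))))
      + (?t * (?t * (?u * (?w * Q))) - ?t * (?t * (?u * (?u * Q))))"
    using 1 2 3 unfolding A P_def[symmetric] Q_def[symmetric] by algebra
  from arg_cong[OF this, of "eval_uw c' d'"]
  have E: "d * w * (d * w * eval_uw c' d' F) - c * w * (d * w * eval_uw c' d' F)
      - t * (c * w * (d * w * eval_uw c' d' F)) + t * (c * w * (c * w * eval_uw c' d' F)) =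
      t * (c * w * (d * w * (d * w * scale_w c' A))) - t * (c * w * (c * w * (d * w * scale_w c' A)))
      - t * (t * (c * w * (c * w * (d * w * scale_w c' A)))) + t * (t * (c * w * (c * w * (c * w * scale_w c' A))))
      + (t * (c * w * (d * w * (Y d' - eval_uw c' d' F))) - t * (t * (c * w * (c * w * (Y d' - eval_uw c' d' F)))))
      + (t * (t * (c * w * (d * w * (eval_uw c' d' F - X c'))))
         - t * (t * (c * w * (c * w * (eval_uw c' d' F - X c')))))"
    unfolding P_def Q_def eval_uw_add eval_uw_diff eval_uw_w eval_uw_u eval_uw_t eval_uw_const eval_uw_lift
      scale_subst_ut t_def w_def c_def d_def Y_def X_def .
  have A': "scale_w c' A = (scale_w c' B_ser + t) * (1 + X c')"
    by (simp add: A_def X_def scale_w_mult scale_w_add scale_subst_ut t_def)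
  \<comment> \<open>Multiplying by the two denominators produced the factor w^2 in every term; it is
    cancelled here.\<close>
  have "w * w * (eval_uw c' d' F * (d - c) * (d - c * t)) = w * w * (
    c * w * t * (scale_w c' B_ser + t) * (1 + X c') * (d - c) * (d - c * t)
    + c * t * (Y d' - eval_uw c' d' F) * (d - c * t)
    + c * t ^ 2 * (eval_uw c' d' F - X c') * (d - c))"
    using E unfolding A' by algebra
  moreover have "w * w \<noteq> 0" by (simp add: w_def)
  ultimately show ?thesis by (metis mult_left_cancel)
qed

text \<open>
  Here \<open>E1\<close>, \<open>E2\<close>, \<open>X\<close>, \<open>Y\<close>, \<open>Y'\<close> stand for \<open>F(qw, w)\<close>, \<open>F(qw, tq\<^sup>2w)\<close>, \<open>F(qw, tqw)\<close>,
  \<open>F(w, w)\<close>, \<open>F(tq\<^sup>2w, tq\<^sup>2w)\<close>. By \<open>rel\<close> the unknowns \<open>E1\<close> and \<open>E2\<close> drop out of the two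
  equations, and \<open>X\<close> is then eliminated.
\<close>

lemma kernel_elimination:
  fixes t q z X Y Y' E1 E2 :: "'a :: idom"
  assumes rel: "q * (1 + t ^ 2) = 1 + t * q ^ 2"
    and nz: "t \<noteq> 0" "q \<noteq> 0" "t \<noteq> 1"
    and 1: "E1 * (1 - q) * (1 - q * t) = q * z * t * (1 + X) * (1 - q) * (1 - q * t)
        + q * t * (Y - E1) * (1 - q * t) + q * t ^ 2 * (E1 - X) * (1 - q)"
    and 2: "E2 * (t * q ^ 2 - q) * (t * q ^ 2 - q * t) =
        q * z * t * (1 + X) * (t * q ^ 2 - q) * (t * q ^ 2 - q * t)
        + q * t * (Y' - E2) * (t * q ^ 2 - q * t) + q * t ^ 2 * (E2 - X) * (t * q ^ 2 - q)"
  shows "(1 - t * (1 + t) * q - (t * (1 - t - t ^ 3) * q + t ^ 2) * z) * Y =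
    (1 + t ^ 2 - (1 - 2 * t + 2 * t ^ 2 + t ^ 4) * q) * z
    + ((1 - t) * q - 1 - ((1 - t + t ^ 2) * q - 1) * z) * Y'"
proof -
  have "t * (q * z * (1 + X) * ((1 - q) * (1 - q * t)) + q * (1 - q * t) * Y - q * t * (1 - q) * X) = 0"
    using 1 rel by algebra
  then have e1: "q * z * (1 + X) * ((1 - q) * (1 - q * t)) + q * (1 - q * t) * Y - q * t * (1 - q) * X = 0"
    using nz by simp
  have "q ^ 2 * t ^ 2 * (q * z * (1 + X) * ((1 - q) * (1 - q * t)) - (1 - q) * Y' + (1 - t * q) * X) = 0"
    using 2 rel by algebra
  then have e2: "q * z * (1 + X) * ((1 - q) * (1 - q * t)) - (1 - q) * Y' + (1 - t * q) * X = 0"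
    using nz by simp
  define M where "M = q * z * ((1 - q) * (1 - q * t))"
  \<comment> \<open>\<open>e1\<close> says M + q(1 - qt)Y = -(M - qt(1 - q))X, and \<open>e2\<close>
    says M - (1 - q)Y' = -(M + 1 - tq)X. Multiplying crosswise removes X; the M^2 terms then
    cancel.\<close>
  have e3: "(M + 1 - t * q) * (M + q * (1 - q * t) * Y) - (M - q * t * (1 - q)) * (M - (1 - q) * Y') = 0"
    using e1 e2 unfolding M_def by algebra
  \<comment> \<open>Modulo \<open>rel\<close> the common factor (1 - t)q splits off, for instance (1
    - qt)^2 = (1 - t)(1 - t(1 + t)q).\<close>
  have "(M + 1 - t * q) * (M + q * (1 - q * t) * Y) - (M - q * t * (1 - q)) * (M - (1 - q) * Y')
    = (1 - t) * q * ((1 - t * (1 + t) * q - (t * (1 - t - t ^ 3) * q + t ^ 2) * z) * Y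
      - (1 + t ^ 2 - (1 - 2 * t + 2 * t ^ 2 + t ^ 4) * q) * z
      - ((1 - t) * q - 1 - ((1 - t + t ^ 2) * q - 1) * z) * Y')"
    using rel unfolding M_def by algebra
  then have "(1 - t) * q * ((1 - t * (1 + t) * q - (t * (1 - t - t ^ 3) * q + t ^ 2) * z) * Y
      - (1 + t ^ 2 - (1 - 2 * t + 2 * t ^ 2 + t ^ 4) * q) * z
      - ((1 - t) * q - 1 - ((1 - t + t ^ 2) * q - 1) * z) * Y') = 0"
    using e3 by (simp only:)
  then have "(1 - t * (1 + t) * q - (t * (1 - t - t ^ 3) * q + t ^ 2) * z) * Y
      - (1 + t ^ 2 - (1 - 2 * t + 2 * t ^ 2 + t ^ 4) * q) * z
      - ((1 - t) * q - 1 - ((1 - t + t ^ 2) * q - 1) * z) * Y' = 0"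
    using nz by (simp only: mult_eq_0_iff) auto
  then show ?thesis by algebra
qed

text \<open>The coefficient ring \<open>rat fps\<close> is not a field: the constant term of g must
  itself be a unit, which is read off its own constant term.\<close>

lemma fps_divide_unit_mult:
  fixes f g :: "rat fps fps"
  assumes "g $ 0 $ 0 \<noteq> 0"
  shows "(f / g) * g = f"
proof -
  have "g $ 0 * inverse (g $ 0) = 1" using assms by (rule inverse_mult_eq_1')
  then have "g * inverse g = 1"
    unfolding fps_inverse_def by (rule fps_right_inverse)
  then have "inverse g * g = 1" by (simp only: mult.commute)
  moreover have "g $ 0 \<noteq> 0" using assms by auto
  ultimately show ?thesis by (simp only: fps_divide_unit mult.assoc mult_1_right not_False_eq_True)
qed

definition kernel_z :: "rat fps fps" where
  "kernel_z = (scale_w q_ser B_ser + fps_const fps_X) * fps_X"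

definition kernel_den :: "rat fps fps" where
  "kernel_den = (let t = fps_const fps_X; q = fps_const q_ser in
     1 - t * (1 + t) * q - (t * (1 - t - t ^ 3) * q + t ^ 2) * kernel_z)"

lemma kernel_den_nth_0: "kernel_den $ 0 $ 0 = 1"
  by (simp add: kernel_den_def Let_def kernel_z_def fps_mult_nth)

lemma K_ser_den: "K_ser * kernel_den = (let t = fps_const fps_X; q = fps_const q_ser in
    (1 - t) * q - 1 - ((1 - t + t ^ 2) * q - 1) * kernel_z)"
  using fps_divide_unit_mult[of kernel_den] kernel_den_nth_0
  unfolding K_ser_def Let_def kernel_den_def kernel_z_def mult.assoc by simp

lemma L_ser_den: "L_ser * kernel_den = (let t = fps_const fps_X; q = fps_const q_ser in
    (1 + t ^ 2 - (1 - 2 * t + 2 * t ^ 2 + t ^ 4) * q) * kernel_z)"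
  using fps_divide_unit_mult[of kernel_den] kernel_den_nth_0
  unfolding L_ser_def Let_def kernel_den_def kernel_z_def mult.assoc by simp

lemma diag_kernel_relation:
  assumes "functional_equation F"
  shows "diag F = L_ser + K_ser * scale_w (fps_X * q_ser ^ 2) (diag F)"
proof -
  define t :: "rat fps fps" where "t = fps_const fps_X"
  define q where "q = fps_const q_ser"
  have rel: "q * (1 + t ^ 2) = 1 + t * q ^ 2"
    using arg_cong[OF q_ser_eq, of fps_const] unfolding q_def t_def
    by (simp only: fps_const_power fps_const_mult fps_const_add flip: fps_const_1_eq_1)
  have nz: "t \<noteq> 0" by (simp add: t_def)
  have "q $ 0 $ 0 \<noteq> 0" by (simp add: q_def q_ser_nth_0)
  then have nz2: "q \<noteq> 0" by auto
  have "t $ 0 $ 0 \<noteq> 1" by (simp add: t_def)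
  then have nz3: "t \<noteq> 1" by auto
  have c: "fps_const (fps_X * q_ser ^ 2) = t * q ^ 2"
    unfolding t_def q_def by (simp only: fps_const_power fps_const_mult)
  have "kernel_den * diag F =
    (1 + t ^ 2 - (1 - 2 * t + 2 * t ^ 2 + t ^ 4) * q) * kernel_z
    + ((1 - t) * q - 1 - ((1 - t + t ^ 2) * q - 1) * kernel_z) * scale_w (fps_X * q_ser ^ 2) (diag F)"
    unfolding kernel_den_def Let_def t_def[symmetric] q_def[symmetric]
  proof (rule kernel_elimination[OF rel nz nz2 nz3])
    show "eval_uw q_ser 1 F * (1 - q) * (1 - q * t) =
        q * kernel_z * t * (1 + eval_uw q_ser (q_ser * fps_X) F) * (1 - q) * (1 - q * t)
        + q * t * (diag F - eval_uw q_ser 1 F) * (1 - q * t)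
        + q * t ^ 2 * (eval_uw q_ser 1 F - eval_uw q_ser (q_ser * fps_X) F) * (1 - q)"
      using functional_equation_eval[OF assms, of q_ser 1]
      unfolding t_def q_def kernel_z_def fps_const_1_eq_1 scale_w_1
      by (simp only: mult_ac)
    show "eval_uw q_ser (fps_X * q_ser ^ 2) F * (t * q ^ 2 - q) * (t * q ^ 2 - q * t) =
        q * kernel_z * t * (1 + eval_uw q_ser (q_ser * fps_X) F) * (t * q ^ 2 - q) * (t * q ^ 2 - q * t)
        + q * t * (scale_w (fps_X * q_ser ^ 2) (diag F) - eval_uw q_ser (fps_X * q_ser ^ 2) F) * (t * q ^ 2 - q * t)
        + q * t ^ 2 * (eval_uw q_ser (fps_X * q_ser ^ 2) F - eval_uw q_ser (q_ser * fps_X) F) * (t * q ^ 2 - q)"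
      using functional_equation_eval[OF assms, of q_ser "fps_X * q_ser ^ 2"]
      unfolding c unfolding t_def q_def kernel_z_def
      by (simp only: mult_ac)
  qed
  then have "kernel_den * diag F =
    L_ser * kernel_den + K_ser * kernel_den * scale_w (fps_X * q_ser ^ 2) (diag F)"
    unfolding K_ser_den L_ser_den Let_def t_def q_def .
  then have "kernel_den * diag F =
    kernel_den * (L_ser + K_ser * scale_w (fps_X * q_ser ^ 2) (diag F))"
    by (simp only: distrib_left mult_ac)
  moreover have "kernel_den \<noteq> 0" using kernel_den_nth_0 by auto
  ultimately show ?thesis by (metis mult_left_cancel)
qed

text \<open>At t = 0 we have q = 1, so both coefficients \<open>?a\<close> and \<open>?b\<close> of
  the numerator of K vanish. The denominator has constant term 1, so the vanishing passes to K
  coefficient by coefficient.\<close>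

lemma K_ser_nth_nth_0: "K_ser $ m $ 0 = 0"
proof (induction m rule: less_induct)
  case (less m)
  let ?a = "(1 - fps_X) * q_ser - 1" and ?b = "(1 - fps_X + fps_X ^ 2) * q_ser - 1"
  have "K_ser * kernel_den = fps_const ?a - fps_const ?b * kernel_z"
    unfolding K_ser_den Let_def
    by (simp only: fps_const_power fps_const_mult fps_const_add fps_const_sub flip: fps_const_1_eq_1)
  moreover have "?a $ 0 = 0" "?b $ 0 = 0" by (simp_all add: q_ser_nth_0)
  ultimately have "(K_ser * kernel_den) $ m $ 0 = 0" by simp
  moreover have "(K_ser * kernel_den) $ m $ 0 = (\<Sum>i=0..m. K_ser $ i $ 0 * kernel_den $ (m - i) $ 0)"
    by (simp add: fps_mult_nth fps_sum_nth)
  moreover have "\<dots> = K_ser $ m $ 0 * kernel_den $ (m - m) $ 0"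
    by (subst sum.remove[of _ m]) (auto intro!: sum.neutral less.IH)
  ultimately show ?case using kernel_den_nth_0 by simp
qed

lemma diag_iterated:
  assumes "functional_equation F"
  defines "c \<equiv> fps_X * q_ser ^ 2"
  shows "diag F = (\<Sum>k<n. scale_w (c ^ k) L_ser * (\<Prod>j<k. scale_w (c ^ j) K_ser))
    + scale_w (c ^ n) (diag F) * (\<Prod>j<n. scale_w (c ^ j) K_ser)"
proof (induction n)
  case (Suc n)
  have "scale_w (c ^ n) (diag F) = scale_w (c ^ n) L_ser
      + scale_w (c ^ n) K_ser * scale_w (c ^ Suc n) (diag F)"
    by (subst diag_kernel_relation[OF assms(1)])
      (simp add: c_def scale_w_add scale_w_mult scale_w_scale_w mult.commute)
  with Suc show ?case by (simp add: algebra_simps)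
qed simp

lemma by_t_nth: "by_t F $ n $ m = F $ m $ n"
  by (simp add: by_t_def)

lemma by_t_sum: "by_t (\<Sum>i\<in>I. F i) = (\<Sum>i\<in>I. by_t (F i))"
  by (simp add: fps_eq_iff by_t_nth fps_sum_nth)

text \<open>In the t-adic metric it is enough that every coefficient of t is eventually constant.
  The remainder after N iterations contains N factors K, each divisible by t, and so cannot affect
  t^n for n < N.\<close>

lemma diag_sums:
  assumes "functional_equation F"
  defines "c \<equiv> fps_X * q_ser ^ 2"
  shows "(\<lambda>k. by_t (scale_w (c ^ k) L_ser * (\<Prod>j<k. scale_w (c ^ j) K_ser))) sums by_t (diag F)"
  unfolding sums_def
proof (rule tendsto_fpsI)
  fix n
  have dvd: "fps_X ^ k dvd (\<Prod>j<k. scale_w (c ^ j) K_ser) $ m" for k m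
  proof (induction k arbitrary: m)
    case (Suc k)
    have "fps_X dvd scale_w (c ^ k) K_ser $ i" for i
    proof -
      have "K_ser $ i = fps_X * fps_shift 1 (K_ser $ i)"
        by (auto simp: fps_eq_iff K_ser_nth_nth_0)
      then have "fps_X dvd K_ser $ i" by (rule dvdI)
      then show ?thesis by (simp only: scale_w_nth dvd_mult)
    qed
    then have "fps_X ^ k * fps_X dvd ((\<Prod>j<k. scale_w (c ^ j) K_ser) * scale_w (c ^ k) K_ser) $ m"
      unfolding fps_mult_nth by (intro dvd_sum mult_dvd_mono Suc)
    then show ?case by (simp only: prod.lessThan_Suc power_Suc2)
  qed simp
  have "(\<Sum>k<N. by_t (scale_w (c ^ k) L_ser * (\<Prod>j<k. scale_w (c ^ j) K_ser))) $ n = by_t (diag F) $ n"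
    if "N > n" for N
  proof (rule fps_ext)
    fix m
    have "fps_X ^ N dvd (scale_w (c ^ N) (diag F) * (\<Prod>j<N. scale_w (c ^ j) K_ser)) $ m"
      unfolding fps_mult_nth by (intro dvd_sum dvd_mult dvd)
    then have "(scale_w (c ^ N) (diag F) * (\<Prod>j<N. scale_w (c ^ j) K_ser)) $ m $ n = 0"
      using that by (elim dvdE) (simp only: fps_X_power_mult_nth if_True)
    then show "(\<Sum>k<N. by_t (scale_w (c ^ k) L_ser * (\<Prod>j<k. scale_w (c ^ j) K_ser))) $ n $ m
        = by_t (diag F) $ n $ m"
      unfolding by_t_sum[symmetric] by_t_nth
      using arg_cong[OF diag_iterated[OF assms(1), of N], of "\<lambda>f. f $ m $ n"] by (simp add: c_def)
  qed
  then show "\<forall>\<^sub>F N in sequentially.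
      (\<Sum>k<N. by_t (scale_w (c ^ k) L_ser * (\<Prod>j<k. scale_w (c ^ j) K_ser))) $ n = by_t (diag F) $ n"
    unfolding eventually_sequentially by (intro exI[of _ "Suc n"]) auto
qed

section \<open>Walks as words\<close>

datatype dir = Up | Dn | Lt | Rt

fun dvec :: "dir \<Rightarrow> point" where
  "dvec Up = (0, 1)" | "dvec Dn = (0, -1)" | "dvec Lt = (-1, 0)" | "dvec Rt = (1, 0)"

fun verts :: "point \<Rightarrow> dir list \<Rightarrow> point list" where
  "verts c [] = []"
| "verts c (d # w) = (c + dvec d) # verts (c + dvec d) w"

fun endp :: "point \<Rightarrow> dir list \<Rightarrow> point" where
  "endp c [] = c"
| "endp c (d # w) = endp (c + dvec d) w"

text \<open>
  \<open>step_ok S v d\<close> means that a three-sided prudent walk with vertex set \<open>S\<close> and last vertex \<open>v\<close>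
  may continue with the step \<open>d\<close>.
\<close>

fun step_ok :: "point set \<Rightarrow> point \<Rightarrow> dir \<Rightarrow> bool" where
  "step_ok S (x, y) Up \<longleftrightarrow> (\<forall>y'>y. (x, y') \<notin> S) \<and>
     ((\<forall>s\<in>S. x \<le> fst s) \<or> (\<forall>s\<in>S. fst s \<le> x) \<or> (\<forall>s\<in>S. snd s \<le> y + 1))"
| "step_ok S (x, y) Dn \<longleftrightarrow> (\<forall>y'<y. (x, y') \<notin> S) \<and>
     ((\<forall>s\<in>S. x \<le> fst s) \<or> (\<forall>s\<in>S. fst s \<le> x) \<or> (\<forall>s\<in>S. snd s \<le> y - 1))"
| "step_ok S (x, y) Lt \<longleftrightarrow> (\<forall>x'<x. (x', y) \<notin> S) \<and>
     ((\<forall>s\<in>S. x - 1 \<le> fst s) \<or> (\<forall>s\<in>S. fst s \<le> x - 1) \<or> (\<forall>s\<in>S. snd s \<le> y)) \<and>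
     ((\<forall>s\<in>S. y \<le> snd s) \<longrightarrow> (\<forall>s\<in>S. x - 1 < fst s) \<or> (\<forall>s\<in>S. fst s < x - 1))"
| "step_ok S (x, y) Rt \<longleftrightarrow> (\<forall>x'>x. (x', y) \<notin> S) \<and>
     ((\<forall>s\<in>S. x + 1 \<le> fst s) \<or> (\<forall>s\<in>S. fst s \<le> x + 1) \<or> (\<forall>s\<in>S. snd s \<le> y)) \<and>
     ((\<forall>s\<in>S. y \<le> snd s) \<longrightarrow> (\<forall>s\<in>S. x + 1 < fst s) \<or> (\<forall>s\<in>S. fst s < x + 1))"

fun legal :: "point set \<Rightarrow> point \<Rightarrow> dir list \<Rightarrow> bool" where
  "legal S c [] \<longleftrightarrow> True"
| "legal S c (d # w) \<longleftrightarrow> step_ok S c d \<and> legal (insert (c + dvec d) S) (c + dvec d) w"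

text \<open>
  \<open>closes S c w\<close>: the steps \<open>w\<close> are allowed from \<open>c\<close> on, and the last of them goes from \<open>(1, 1)\<close>
  to \<open>(1, 0)\<close>.
\<close>

fun closes :: "point set \<Rightarrow> point \<Rightarrow> dir list \<Rightarrow> bool" where
  "closes S c [] \<longleftrightarrow> False"
| "closes S c (d # w) \<longleftrightarrow> step_ok S c d \<and>
     (if w = [] then c = (1, 1) \<and> d = Dn else closes (insert (c + dvec d) S) (c + dvec d) w)"

lemma verts_append: "verts c (u @ v) = verts c u @ verts (endp c u) v"
  by (induction u arbitrary: c) auto

lemma endp_append [simp]: "endp c (u @ v) = endp (endp c u) v"
  by (induction u arbitrary: c) auto

lemma legal_append:
  "legal S c (u @ v) \<longleftrightarrow> legal S c u \<and> legal (S \<union> set (verts c u)) (endp c u) v"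
  by (induction u arbitrary: S c) auto

lemma closes_append:
  "v \<noteq> [] \<Longrightarrow> closes S c (u @ v) \<longleftrightarrow> legal S c u \<and> closes (S \<union> set (verts c u)) (endp c u) v"
  by (induction u arbitrary: S c) auto

text \<open>
  A row has just been started: the box of \<open>S\<close> is \<open>m \<le> x \<le> 0\<close>, \<open>y \<le> h\<close>, and the part of the walk
  in the line \<open>y = h\<close> covers \<open>l \<le> x \<le> r\<close>. If \<open>m = 0\<close>, the walk so far is a vertical segment.
\<close>

definition row_state :: "point set \<Rightarrow> int \<Rightarrow> int \<Rightarrow> int \<Rightarrow> int \<Rightarrow> bool" where
  "row_state S l r m h \<longleftrightarrow> (0, 0) \<in> S \<and> 1 \<le> h \<and> m \<le> l \<and> l \<le> r \<and> r \<le> 0 \<and>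
     (\<forall>x y. (x, y) \<in> S \<longrightarrow> m \<le> x \<and> x \<le> 0 \<and> y \<le> h) \<and>
     (\<forall>x. (x, h) \<in> S \<longleftrightarrow> l \<le> x \<and> x \<le> r) \<and>
     (\<forall>x. m \<le> x \<and> x \<le> 0 \<longrightarrow> (\<exists>y<h. (x, y) \<in> S)) \<and>
     (m = 0 \<longrightarrow> (\<forall>y. (0, y) \<in> S \<longleftrightarrow> 0 \<le> y \<and> y \<le> h))"

text \<open>
  The walk is at \<open>(x, y)\<close> on the left side of its box, whose top is \<open>y = h\<close>, and arrived there by
  a step \<open>d\<close>. The clause for \<open>x = -1\<close> is needed because there a right step ends in the line
  \<open>x = 0\<close>, which is the right side of the box; only the rule about the bottom side can forbid it.
  The case \<open>x = 0\<close> occurs at the origin and while the walk starts straight downwards.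
\<close>

definition side_state :: "point set \<Rightarrow> int \<Rightarrow> int \<Rightarrow> int \<Rightarrow> dir \<Rightarrow> bool" where
  "side_state S x y h d \<longleftrightarrow> (0, 0) \<in> S \<and> (x, y) \<in> S \<and> 0 \<le> h \<and> y \<le> h \<and> x \<le> 0 \<and>
     (\<forall>x' y'. (x', y') \<in> S \<longrightarrow> x \<le> x' \<and> x' \<le> 0 \<and> y' \<le> h) \<and>
     (\<forall>x'. x \<le> x' \<and> x' \<le> 0 \<longrightarrow> (\<exists>y'\<le>h. (x', y') \<in> S)) \<and>
     (case d of Lt \<Rightarrow> \<forall>y'. (x, y') \<in> S \<longrightarrow> y' = y
        | Up \<Rightarrow> (\<forall>y'. (x, y') \<in> S \<longrightarrow> y' \<le> y) \<and> (x, y - 1) \<in> S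
        | Dn \<Rightarrow> (\<forall>y'. (x, y') \<in> S \<longrightarrow> y \<le> y') \<and> (x, y + 1) \<in> S
        | Rt \<Rightarrow> False) \<and>
     (x = -1 \<longrightarrow> (\<exists>b. (\<forall>y'. (0, y') \<in> S \<longleftrightarrow> b \<le> y' \<and> y' \<le> h) \<and> (b \<le> y \<or> d = Dn))) \<and>
     (x < 0 \<longrightarrow> (\<exists>x'>x. (x', h) \<in> S)) \<and>
     (x = 0 \<longrightarrow> h = 0 \<and> (\<forall>y'. (0, y') \<in> S \<longleftrightarrow> y \<le> y' \<and> y' \<le> 0) \<and> d = (if y = 0 then Lt else Dn))"

section \<open>Legal steps on the left side of the box and inside a row\<close>

lemma row_state_bounds:
  assumes "row_state S l r m h" "(x, y) \<in> S"
  shows "m \<le> x \<and> x \<le> 0 \<and> y \<le> h"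
proof -
  have "\<forall>x y. (x, y) \<in> S \<longrightarrow> m \<le> x \<and> x \<le> 0 \<and> y \<le> h"
    using assms(1) unfolding row_state_def by (elim conjE)
  then show ?thesis using assms(2) by blast
qed

lemma row_state_column:
  assumes "row_state S l r m h" "m \<le> x" "x \<le> 0"
  shows "\<exists>y<h. (x, y) \<in> S"
proof -
  have "\<forall>x. m \<le> x \<and> x \<le> 0 \<longrightarrow> (\<exists>y<h. (x, y) \<in> S)"
    using assms(1) unfolding row_state_def by (elim conjE)
  then show ?thesis using assms(2,3) by blast
qed

lemma side_state_bounds:
  assumes "side_state S x y h d" "(x', y') \<in> S"
  shows "x \<le> x' \<and> x' \<le> 0 \<and> y' \<le> h"
proof -
  have "\<forall>x' y'. (x', y') \<in> S \<longrightarrow> x \<le> x' \<and> x' \<le> 0 \<and> y' \<le> h"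
    using assms(1) unfolding side_state_def by (elim conjE)
  then show ?thesis using assms(2) by blast
qed

lemma side_Lt:
  assumes "side_state S x y h d"
  shows "step_ok S (x, y) Lt" "side_state (insert (x - 1, y) S) (x - 1) y h Lt"
proof -
  have S: "x \<le> fst s" if "s \<in> S" for s
    using that assms unfolding side_state_def by (cases s) auto
  then have "x - 1 < fst s" if "s \<in> S" for s using that by fastforce
  then show "step_ok S (x, y) Lt" using S by force
  have 1: "\<exists>y'\<le>h. (x', y') \<in> insert (x - 1, y) S" if "x - 1 \<le> x'" "x' \<le> 0" for x'
    using that assms unfolding side_state_def by (cases "x' = x - 1") auto
  have 2: "\<exists>x'>x - 1. (x', h) \<in> insert (x - 1, y) S"
  proof (cases "x < 0")
    case True
    then obtain x' where "x' > x" "(x', h) \<in> S" using assms unfolding side_state_def by blast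
    then show ?thesis by (intro exI[of _ x']) auto
  next
    case False
    then show ?thesis using assms unfolding side_state_def by (intro exI[of _ 0]) auto
  qed
  have 3: "\<exists>b. (\<forall>y'. (0, y') \<in> insert (x - 1, y) S \<longleftrightarrow> b \<le> y' \<and> y' \<le> h) \<and> (b \<le> y \<or> Lt = Dn)"
    if "x - 1 = - 1"
    using that assms unfolding side_state_def by (intro exI[of _ y]) auto
  have "(x - 1, y') \<notin> S" for y' using S[of "(x - 1, y')"] by auto
  then have 4: "y' = y" if "(x - 1, y') \<in> insert (x - 1, y) S" for y'
    using that by auto
  have "x \<le> x' \<and> x' \<le> 0 \<and> y' \<le> h" if "(x', y') \<in> S" for x' y'
    using that assms unfolding side_state_def by blast
  moreover have "x \<le> 0" "y \<le> h" using assms unfolding side_state_def by blast+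
  ultimately have 5: "x - 1 \<le> x' \<and> x' \<le> 0 \<and> y' \<le> h" if "(x', y') \<in> insert (x - 1, y) S" for x' y'
    using that by fastforce
  show "side_state (insert (x - 1, y) S) (x - 1) y h Lt"
    using assms 1 2 3 4 5 unfolding side_state_def dir.case by auto
qed

lemma side_Dn:
  assumes "side_state S x y h d" "d \<noteq> Up"
  shows "step_ok S (x, y) Dn" "side_state (insert (x, y - 1) S) x (y - 1) h Dn"
proof -
  have "x \<le> fst s" if "s \<in> S" for s
    using that assms unfolding side_state_def by (cases s) auto
  moreover have C: "\<forall>y'. (x, y') \<in> S \<longrightarrow> y \<le> y'"
    using assms unfolding side_state_def by (cases d) auto
  ultimately show "step_ok S (x, y) Dn" by auto
  have 4: "\<forall>y'. (x, y') \<in> insert (x, y - 1) S \<longrightarrow> y - 1 \<le> y'"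
    using C by force
  have 3: "\<exists>b. (\<forall>y'. (0, y') \<in> insert (x, y - 1) S \<longleftrightarrow> b \<le> y' \<and> y' \<le> h)" if "x = - 1"
    using that assms unfolding side_state_def by auto
  have 2: "\<exists>x'>x. (x', h) \<in> insert (x, y - 1) S" if "x < 0"
    using that assms unfolding side_state_def by auto
  have 1: "\<exists>y'\<le>h. (x', y') \<in> insert (x, y - 1) S" if "x \<le> x'" "x' \<le> 0" for x'
    using that assms unfolding side_state_def by auto
  have 5: "h = 0 \<and> (\<forall>y'. (0, y') \<in> insert (x, y - 1) S \<longleftrightarrow> y - 1 \<le> y' \<and> y' \<le> 0) \<and> y - 1 \<noteq> 0" if "x = 0"
    using that assms unfolding side_state_def by (cases d) force+
  show "side_state (insert (x, y - 1) S) x (y - 1) h Dn"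
    using assms 1 2 3 4 5 unfolding side_state_def dir.case by auto
qed

lemma side_Up:
  assumes "side_state S x y h d" "d \<noteq> Dn"
  shows "step_ok S (x, y) Up"
    "y < h \<Longrightarrow> side_state (insert (x, y + 1) S) x (y + 1) h Up"
    "y = h \<Longrightarrow> row_state (insert (x, y + 1) S) x x x (h + 1)"
proof -
  have "x \<le> fst s" if "s \<in> S" for s
    using that assms unfolding side_state_def by (cases s) auto
  moreover have C: "\<forall>y'. (x, y') \<in> S \<longrightarrow> y' \<le> y"
    using assms unfolding side_state_def by (cases d) auto
  ultimately show "step_ok S (x, y) Up" by auto
  have 4: "\<forall>y'. (x, y') \<in> insert (x, y + 1) S \<longrightarrow> y' \<le> y + 1"
    using C by force
  have 3: "\<exists>b. (\<forall>y'. (0, y') \<in> insert (x, y + 1) S \<longleftrightarrow> b \<le> y' \<and> y' \<le> h) \<and> b \<le> y + 1" if "x = - 1"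
  proof -
    have "x = -1 \<longrightarrow> (\<exists>b. (\<forall>y'. (0, y') \<in> S \<longleftrightarrow> b \<le> y' \<and> y' \<le> h) \<and> (b \<le> y \<or> d = Dn))"
      using assms(1) unfolding side_state_def by (elim conjE)
    then obtain b where "\<forall>y'. (0, y') \<in> S \<longleftrightarrow> b \<le> y' \<and> y' \<le> h" "b \<le> y"
      using \<open>x = -1\<close> assms(2) by blast
    then show ?thesis using \<open>x = -1\<close> by (intro exI[of _ b]) auto
  qed
  have 2: "\<exists>x'>x. (x', h) \<in> insert (x, y + 1) S" if "x < 0"
    using that assms unfolding side_state_def by auto
  have 1: "\<exists>y'\<le>h. (x', y') \<in> insert (x, y + 1) S" if "x \<le> x'" "x' \<le> 0" for x'
    using that assms unfolding side_state_def by auto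
  have 5: "h = 0 \<and> y = 0" if "x = 0"
    using that assms unfolding side_state_def by (auto split: if_splits)
  show "side_state (insert (x, y + 1) S) x (y + 1) h Up" if "y < h"
    using that assms 1 2 3 4 5 unfolding side_state_def dir.case by auto
  have 6: "\<exists>y'<h + 1. (x', y') \<in> insert (x, y + 1) S" if "x \<le> x'" "x' \<le> 0" for x'
    using 1[OF that] by force
  have 7: "(x', h + 1) \<in> insert (x, y + 1) S \<longleftrightarrow> x \<le> x' \<and> x' \<le> x" if "y = h" for x'
    using that side_state_bounds[OF assms(1), of x' "h + 1"] by auto
  show "row_state (insert (x, y + 1) S) x x x (h + 1)" if "y = h"
    using that assms 5 6 7[OF that] unfolding side_state_def row_state_def by force
qed

text \<open>A right step at y = h runs into the vertex of S in the top line. For y < h it could end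
  only on the right side of the box, so x = -1. Prudence then puts y below the whole column x = 0,
  making it the bottom of the box, and the step would run along the bottom without enlarging the
  box.\<close>

lemma side_not:
  assumes "side_state S x y h d"
  shows "d = Up \<Longrightarrow> \<not> step_ok S (x, y) Dn" "d = Dn \<Longrightarrow> \<not> step_ok S (x, y) Up"
    "x < 0 \<Longrightarrow> \<not> step_ok S (x, y) Rt"
proof -
  show "\<not> step_ok S (x, y) Dn" if "d = Up"
    using that assms unfolding side_state_def by force
  show "\<not> step_ok S (x, y) Up" if "d = Dn"
    using that assms unfolding side_state_def by force
  show "\<not> step_ok S (x, y) Rt" if "x < 0"
  proof
    assume ok: "step_ok S (x, y) Rt"
    obtain x' where x': "x' > x" "(x', h) \<in> S" using assms \<open>x < 0\<close> unfolding side_state_def by blast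
    have S: "(x, y) \<in> S" "(0, 0) \<in> S" "y \<le> h" using assms unfolding side_state_def by blast+
    have "y \<noteq> h" using x' ok by auto
    then have "x = -1" using x' ok S \<open>x < 0\<close> by force
    then obtain b where b: "\<And>y'. (0, y') \<in> S \<longleftrightarrow> b \<le> y' \<and> y' \<le> h" "b \<le> y \<or> d = Dn"
      using assms unfolding side_state_def by blast
    have "(0, y) \<notin> S" using ok \<open>x = -1\<close> by auto
    then have "y < b" "d = Dn" using b S by auto
    then have "\<forall>y'. (x, y') \<in> S \<longrightarrow> y \<le> y'" using assms unfolding side_state_def by auto
    then have C: "y \<le> y'" if "(-1, y') \<in> S" for y' using that \<open>x = -1\<close> by blast
    have X: "x' = -1 \<or> x' = 0" if "(x', y') \<in> S" for x' y'
    proof -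
      have "x \<le> x' \<and> x' \<le> 0" using that assms unfolding side_state_def by blast
      then show ?thesis using \<open>x = -1\<close> by auto
    qed
    have "y \<le> snd s" if "s \<in> S" for s
      using X[of "fst s" "snd s"] C[of "snd s"] b(1)[of "snd s"] \<open>y < b\<close> that
      by (cases s) auto
    then have "\<forall>s\<in>S. y \<le> snd s" by blast
    then show False using ok S \<open>x = -1\<close> by force
  qed
qed

lemma row_Up:
  assumes "row_state S l r m h" "l \<le> x" "x \<le> r"
  shows "step_ok S (x, h) Up" "row_state (insert (x, h + 1) S) x x m (h + 1)"
proof -
  have S: "m \<le> x' \<and> x' \<le> 0 \<and> y' \<le> h" if "(x', y') \<in> S" for x' y'
    using row_state_bounds[OF assms(1) that] .
  have "snd s \<le> h + 1" if "s \<in> S" for s using S[of "fst s" "snd s"] that by auto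
  moreover have "(x, y') \<notin> S" if "y' > h" for y' using S[of x y'] that by auto
  ultimately show "step_ok S (x, h) Up" by auto
  have 1: "m \<le> x' \<and> x' \<le> 0 \<and> y' \<le> h + 1" if "(x', y') \<in> insert (x, h + 1) S" for x' y'
  proof -
    have "m \<le> l" "r \<le> 0" using assms(1) unfolding row_state_def by simp_all
    then show ?thesis using that S[of x' y'] assms(2,3) by fastforce
  qed
  have 2: "(x', h + 1) \<in> insert (x, h + 1) S \<longleftrightarrow> x \<le> x' \<and> x' \<le> x" for x'
    using S[of x' "h + 1"] by auto
  have 3: "\<exists>y'<h + 1. (x', y') \<in> insert (x, h + 1) S" if "m \<le> x' \<and> x' \<le> 0" for x'
  proof -
    obtain y' where "y' < h" "(x', y') \<in> S" using row_state_column[OF assms(1)] \<open>m \<le> x' \<and> x' \<le> 0\<close> by blast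
    then show ?thesis by (intro exI[of _ y']) auto
  qed
  have 4: "(0, y) \<in> insert (x, h + 1) S \<longleftrightarrow> 0 \<le> y \<and> y \<le> h + 1" if "m = 0" for y
  proof -
    have "(0, y) \<in> S \<longleftrightarrow> 0 \<le> y \<and> y \<le> h" "0 \<le> h" "x = 0"
      using that assms unfolding row_state_def by auto
    then show ?thesis by auto
  qed
  show "row_state (insert (x, h + 1) S) x x m (h + 1)"
    using assms 1 2 3 4 unfolding row_state_def by auto
qed

lemma row_Rt:
  assumes "row_state S l r m h" "r < 0"
  shows "step_ok S (r, h) Rt" "row_state (insert (r + 1, h) S) l (r + 1) m h"
proof -
  have S: "m \<le> x' \<and> x' \<le> 0 \<and> y' \<le> h" if "(x', y') \<in> S" for x' y'
    using row_state_bounds[OF assms(1) that] .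
  have row: "(x', h) \<in> S \<longleftrightarrow> l \<le> x' \<and> x' \<le> r" for x'
    using assms unfolding row_state_def by blast
  have z: "(0, 0) \<in> S" "1 \<le> h" "m \<le> l" "l \<le> r" using assms unfolding row_state_def by blast+
  have "snd s \<le> h" if "s \<in> S" for s using S[of "fst s" "snd s"] that by auto
  moreover have "\<not> (\<forall>s\<in>S. h \<le> snd s)" using z by force
  ultimately show "step_ok S (r, h) Rt" using row by auto
  have 1: "m \<le> x' \<and> x' \<le> 0 \<and> y' \<le> h" if "(x', y') \<in> insert (r + 1, h) S" for x' y'
    using that S[of x' y'] assms(2) z by auto
  have 2: "(x', h) \<in> insert (r + 1, h) S \<longleftrightarrow> l \<le> x' \<and> x' \<le> r + 1" for x'
    using row[of x'] z by auto
  have 3: "\<exists>y'<h. (x', y') \<in> insert (r + 1, h) S" if "m \<le> x' \<and> x' \<le> 0" for x'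
    using that assms unfolding row_state_def by auto
  show "row_state (insert (r + 1, h) S) l (r + 1) m h"
    using assms(2) 1 2 3 z unfolding row_state_def by auto
qed

lemma row_Lt:
  assumes "row_state S l r m h" "m < l"
  shows "step_ok S (l, h) Lt" "row_state (insert (l - 1, h) S) (l - 1) r m h"
proof -
  have S: "m \<le> x' \<and> x' \<le> 0 \<and> y' \<le> h" if "(x', y') \<in> S" for x' y'
    using row_state_bounds[OF assms(1) that] .
  have row: "(x', h) \<in> S \<longleftrightarrow> l \<le> x' \<and> x' \<le> r" for x'
    using assms unfolding row_state_def by blast
  have z: "(0, 0) \<in> S" "1 \<le> h" "l \<le> r" "r \<le> 0" using assms unfolding row_state_def by blast+
  have "snd s \<le> h" if "s \<in> S" for s using S[of "fst s" "snd s"] that by auto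
  moreover have "\<not> (\<forall>s\<in>S. h \<le> snd s)" using z by force
  ultimately show "step_ok S (l, h) Lt" using row by auto
  have 1: "m \<le> x' \<and> x' \<le> 0 \<and> y' \<le> h" if "(x', y') \<in> insert (l - 1, h) S" for x' y'
    using that S[of x' y'] assms(2) z by auto
  have 2: "(x', h) \<in> insert (l - 1, h) S \<longleftrightarrow> l - 1 \<le> x' \<and> x' \<le> r" for x'
    using row[of x'] z by auto
  have 3: "\<exists>y'<h. (x', y') \<in> insert (l - 1, h) S" if "m \<le> x' \<and> x' \<le> 0" for x'
    using that assms unfolding row_state_def by auto
  show "row_state (insert (l - 1, h) S) (l - 1) r m h"
    using assms(2) 1 2 3 z unfolding row_state_def by auto
qed

lemma row_Lt_exit:
  assumes "row_state S m r m h"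
  shows "step_ok S (m, h) Lt" "side_state (insert (m - 1, h) S) (m - 1) h h Lt"
proof -
  have S: "m \<le> x' \<and> x' \<le> 0 \<and> y' \<le> h" if "(x', y') \<in> S" for x' y'
    using row_state_bounds[OF assms(1) that] .
  have z: "(0, 0) \<in> S" "1 \<le> h" "m \<le> r" "r \<le> 0" "(m, h) \<in> S" using assms unfolding row_state_def by auto
  have "m - 1 < fst s" if "s \<in> S" for s using S[of "fst s" "snd s"] that by auto
  moreover have "m - 1 \<le> fst s" if "s \<in> S" for s using S[of "fst s" "snd s"] that by auto
  moreover have "(x', h) \<notin> S" if "x' < m" for x' using S[of x' h] that by auto
  ultimately show "step_ok S (m, h) Lt" by auto
  have 1: "m - 1 \<le> x' \<and> x' \<le> 0 \<and> y' \<le> h" if "(x', y') \<in> insert (m - 1, h) S" for x' y'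
    using that S[of x' y'] z by auto
  have 3: "\<exists>y'\<le>h. (x', y') \<in> insert (m - 1, h) S" if "m - 1 \<le> x' \<and> x' \<le> 0" for x'
  proof (cases "x' = m - 1")
    case False
    then have "m \<le> x'" "x' \<le> 0" using that by auto
    then obtain y' where "y' < h" "(x', y') \<in> S" using row_state_column[OF assms] by blast
    then show ?thesis by (intro exI[of _ y']) auto
  qed auto
  have 4: "y' = h" if "(m - 1, y') \<in> insert (m - 1, h) S" for y'
    using that S[of "m - 1" y'] by auto
  have 5: "(0, y') \<in> insert (m - 1, h) S \<longleftrightarrow> 0 \<le> y' \<and> y' \<le> h" if "m = 0" for y'
  proof -
    have "(0, y') \<in> S \<longleftrightarrow> 0 \<le> y' \<and> y' \<le> h"
      using that assms unfolding row_state_def by auto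
    then show ?thesis using that by auto
  qed
  have 6: "\<exists>x'>m - 1. (x', h) \<in> insert (m - 1, h) S" using z by (intro exI[of _ m]) auto
  have 7: "\<exists>b. (\<forall>y'. (0, y') \<in> insert (m - 1, h) S \<longleftrightarrow> b \<le> y' \<and> y' \<le> h) \<and> (b \<le> h \<or> Lt = Dn)"
    if "m - 1 = - 1"
    using 5 z that by (intro exI[of _ 0]) auto
  show "side_state (insert (m - 1, h) S) (m - 1) h h Lt"
    using z 1 3 4 6 7 unfolding side_state_def dir.case by auto
qed

text \<open>Going down is imprudent because each column of the box has a vertex strictly below the
  row; going back horizontally is imprudent because of the row itself.\<close>

lemma row_not:
  assumes "row_state S l r m h"
  shows "l \<le> x \<Longrightarrow> x \<le> r \<Longrightarrow> \<not> step_ok S (x, h) Dn"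
    "l < x \<Longrightarrow> x \<le> r \<Longrightarrow> \<not> step_ok S (x, h) Lt"
    "l \<le> x \<Longrightarrow> x < r \<Longrightarrow> \<not> step_ok S (x, h) Rt"
proof -
  show "\<not> step_ok S (x, h) Dn" if "l \<le> x" "x \<le> r"
  proof -
    have "m \<le> x \<and> x \<le> 0" using that assms unfolding row_state_def by auto
    then show ?thesis using assms unfolding row_state_def by auto
  qed
  show "\<not> step_ok S (x, h) Lt" if "l < x" "x \<le> r"
  proof -
    have "(l, h) \<in> S" using assms unfolding row_state_def by auto
    then show ?thesis using that by auto
  qed
  show "\<not> step_ok S (x, h) Rt" if "l \<le> x" "x < r"
  proof -
    have "(r, h) \<in> S" using assms unfolding row_state_def by auto
    then show ?thesis using that by auto
  qed
qed

text \<open>The last step ends at (1,0). This is not the left side of the box, since (0,0) was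
  visited, nor the top, since (1,1) was visited. So it is the right side, and the conclusion passes
  back to all earlier vertex sets.\<close>

lemma closes_bound:
  assumes "closes S c w" "(0, 0) \<in> S" "c \<in> S"
  shows "(1, 0) \<notin> S \<and> (\<forall>s\<in>S. fst s \<le> 1)"
  using assms
proof (induction S c w rule: closes.induct)
  case (2 S c d w)
  show ?case
  proof (cases "w = []")
    case True
    then have "step_ok S (1, 1) Dn" "(1, 1) \<in> S"
      using 2(2,4) by (auto simp del: step_ok.simps)
    moreover have "\<not> (\<forall>s\<in>S. 1 \<le> fst s)" using 2(3) by force
    moreover have "\<not> (\<forall>s\<in>S. snd s \<le> 1 - 1)" using \<open>(1, 1) \<in> S\<close> by force
    ultimately show ?thesis unfolding step_ok.simps by force
  next
    case False
    then show ?thesis using 2 by auto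
  qed
qed simp

text \<open>
  A walk that visits \<open>(1, h)\<close> and \<open>(1, h + 1)\<close> with \<open>h \<ge> 1\<close> before reaching \<open>(1, 1)\<close> is stuck outside:
  it can go below the line \<open>y = h + 1\<close> only on the left side of the box.
\<close>

lemma not_closes_above:
  assumes "closes S (x, y) w" "(0, 0) \<in> S" "(1, h) \<in> S" "(1, h + 1) \<in> S" "(x, y) \<in> S"
    "1 \<le> h" "h + 1 \<le> y \<or> x \<le> -1"
  shows False
  using assms
proof (induction w arbitrary: S x y)
  case (Cons d w)
  have w: "w \<noteq> []" using Cons.prems by (auto split: if_splits)
  have ok: "step_ok S (x, y) d" and cl: "closes (insert ((x, y) + dvec d) S) ((x, y) + dvec d) w"
    using Cons.prems(1) w by auto
  have x: "x \<le> 1" using closes_bound[OF Cons.prems(1,2,5)] Cons.prems(5) by auto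
  have IH: "(x, y) + dvec d = (x', y') \<Longrightarrow> \<not> (h + 1 \<le> y' \<or> x' \<le> - 1)" for x' y'
    using Cons.IH[of "insert ((x, y) + dvec d) S" x' y'] cl Cons.prems(2-6) by auto
  have no: "(0, 0) \<in> S" "(1, h) \<in> S" "(1, h + 1) \<in> S" "(x, y) \<in> S" by fact+
  show False
  proof (cases d)
    case Up then show ?thesis using IH[of x "y + 1"] Cons.prems(7) by auto
  next
    case Lt then show ?thesis using IH[of "x - 1" y] Cons.prems(7) by auto
  next
    case Dn
    have "\<not> (h + 1 \<le> y - 1 \<or> x \<le> - 1)" using IH[of x "y - 1"] Dn by auto
    then have "y = h + 1" "x = 0 \<or> x = 1" using Cons.prems(7) x by auto
    then show ?thesis using ok Dn no \<open>1 \<le> h\<close> by auto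
  next
    case Rt
    have "\<not> (h + 1 \<le> y \<or> x + 1 \<le> - 1)" using IH[of "x + 1" y] Rt by auto
    then have xy: "x = -1" "y \<le> h" using Cons.prems(7) by auto
    have "\<not> (\<forall>s\<in>S. x + 1 \<le> fst s)" using no xy by force
    moreover have "\<not> (\<forall>s\<in>S. fst s \<le> x + 1)" using no xy by force
    moreover have "\<not> (\<forall>s\<in>S. snd s \<le> y)" using no xy by force
    ultimately show ?thesis using ok unfolding Rt step_ok.simps by blast
  qed
qed simp

text \<open>Up is possible only at y = h, and then the walk is stuck by
  \<open>not_closes_above\<close>; right is excluded by \<open>closes_bound\<close>. At y = h a left
  step meets (0, h). Lower down it would have to end on the left side of the box, so x = 0 is that
  side, and the last hypothesis makes the column x = 0 block it.\<close>

lemma closes_down: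
  assumes "closes S (1, y) w" "(0, 0) \<in> S" "(0, h) \<in> S" "1 \<le> y" "y \<le> h"
    "\<And>y'. y \<le> y' \<Longrightarrow> y' \<le> h \<Longrightarrow> (1, y') \<in> S"
    "\<And>y'. \<forall>s\<in>S. 0 \<le> fst s \<Longrightarrow> 0 \<le> y' \<Longrightarrow> y' \<le> h \<Longrightarrow> (0, y') \<in> S"
  shows "w = replicate (nat y) Dn"
  using assms
proof (induction w arbitrary: S y)
  case (Cons d w)
  show ?case
  proof (cases "w = []")
    case True
    then show ?thesis using Cons.prems(1) by simp
  next
    case w: False
    have ok: "step_ok S (1, y) d" and cl: "closes (insert ((1, y) + dvec d) S) ((1, y) + dvec d) w"
      using Cons.prems(1) w by auto
    have y: "(1, y) \<in> S" "(1, h) \<in> S" using Cons.prems by auto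
    have bound: "(1, 0) \<notin> insert ((1, y) + dvec d) S" "fst ((1, y) + dvec d) \<le> 1"
      using closes_bound[OF cl] Cons.prems(2) by auto
    show ?thesis
    proof (cases d)
      case Up
      have "y = h"
      proof (rule ccontr)
        assume "y \<noteq> h"
        then have "(1, y + 1) \<in> S" using Cons.prems(4-6) by auto
        then show False using ok Up by auto
      qed
      then show ?thesis
        using not_closes_above[of "insert (1, h + 1) S" 1 "h + 1" w h] cl Up Cons.prems(2-5) y by auto
    next
      case Rt then show ?thesis using bound by simp
    next
      case Lt
      have "y \<noteq> h" using ok Lt Cons.prems(3) by auto
      then have "\<not> (\<forall>s\<in>S. snd s \<le> y)" using y Cons.prems(5) by force
      moreover have "\<not> (\<forall>s\<in>S. fst s \<le> 0)" using y by force
      ultimately have "\<forall>s\<in>S. 0 \<le> fst s" using ok Lt by auto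
      then have "(0, y) \<in> S" using Cons.prems(4,5,7) by auto
      then show ?thesis using ok Lt by auto
    next
      case Dn
      have "y \<noteq> 1" using bound Dn by auto
      have "w = replicate (nat (y - 1)) Dn"
      proof (rule Cons.IH[of "insert (1, y - 1) S"])
        show "(1, y') \<in> insert (1, y - 1) S" if "y - 1 \<le> y'" "y' \<le> h" for y'
          using that Cons.prems(6)[of y'] by (cases "y' = y - 1") auto
        show "(0, y') \<in> insert (1, y - 1) S"
          if "\<forall>s\<in>insert (1, y - 1) S. 0 \<le> fst s" "0 \<le> y'" "y' \<le> h" for y'
          using that Cons.prems(7)[of y'] by auto
      qed (use Cons.prems(2-5) cl Dn \<open>y \<noteq> 1\<close> in auto)
      moreover have "nat y = Suc (nat (y - 1))" using Cons.prems(4) by auto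
      ultimately show ?thesis using Dn by simp
    qed
  qed
qed simp

text \<open>On x = 1 below the axis the walk is trapped. Beside the column x = 0 that column blocks
  left steps; below it a left step lies on the bottom side without enlarging the box. Right steps
  and the vertex (1,0) are excluded by \<open>closes_bound\<close>. The disjunction is the
  invariant: level with the column, or descending below everything visited.\<close>

lemma not_closes_below:
  assumes "closes S (1, y) w" "(1, y) \<in> S" "y < 0" "b \<le> 0"
    "\<And>y'. (0, y') \<in> S \<longleftrightarrow> b \<le> y' \<and> y' \<le> 0"
    "b \<le> y \<and> (\<forall>s\<in>S. b \<le> snd s) \<or> (1, y + 1) \<in> S \<and> (\<forall>s\<in>S. y \<le> snd s)"
  shows False
  using assms
proof (induction w arbitrary: S y)
  case (Cons d w)
  have w: "w \<noteq> []" using Cons.prems by (auto split: if_splits)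
  have ok: "step_ok S (1, y) d" and cl: "closes (insert ((1, y) + dvec d) S) ((1, y) + dvec d) w"
    using Cons.prems(1) w by auto
  have z: "(0, 0) \<in> S" using Cons.prems(4,5) by simp
  have bound: "(1, 0) \<notin> insert ((1, y) + dvec d) S" "fst ((1, y) + dvec d) \<le> 1"
    using closes_bound[OF cl] z by auto
  have IH: "closes (insert (1, y') S) (1, y') w \<Longrightarrow> y' < 0 \<Longrightarrow>
    \<not> (b \<le> y' \<and> (\<forall>s\<in>insert (1, y') S. b \<le> snd s) \<or>
       (1, y' + 1) \<in> S \<and> (\<forall>s\<in>insert (1, y') S. y' \<le> snd s))" for y'
    using Cons.IH[of "insert (1, y') S" y'] Cons.prems(4,5) by auto
  show False
  proof (cases d)
    case Up
    have "y + 1 \<noteq> 0" using bound Up by auto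
    then have "\<not> (b \<le> y \<and> (\<forall>s\<in>S. b \<le> snd s))" using IH[of "y + 1"] cl Up Cons.prems(3) by auto
    then show ?thesis using ok Up Cons.prems(6) by auto
  next
    case Rt then show ?thesis using bound by simp
  next
    case Lt
    have "(0, y) \<notin> S" using ok Lt by auto
    then have "\<not> b \<le> y" using Cons.prems(3,5) by auto
    then have "\<forall>s\<in>S. y \<le> snd s" using Cons.prems(6) by auto
    then show ?thesis using ok Lt z by force
  next
    case Dn
    have *: "\<not> (b \<le> y - 1 \<and> (\<forall>s\<in>S. b \<le> snd s) \<or> (\<forall>s\<in>S. y - 1 \<le> snd s))"
      using IH[of "y - 1"] cl Dn Cons.prems(2,3) by auto
    have "\<exists>s\<in>S. snd s < y - 1" using * by (auto simp: not_le)
    then obtain s where "s \<in> S" "snd s < y - 1" by blast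
    then have "b \<le> y" "\<forall>s\<in>S. b \<le> snd s" using Cons.prems(6) by force+
    then have "\<not> b \<le> y - 1" using * by auto
    then have "b = y" using \<open>b \<le> y\<close> by auto
    then show ?thesis using \<open>\<forall>s\<in>S. b \<le> snd s\<close> \<open>s \<in> S\<close> \<open>snd s < y - 1\<close> by force
  qed
qed simp

declare step_ok.simps [simp del]

text \<open>
  A \<open>bar\<close> is the left contour of a bargraph hanging from a horizontal line: a word in \<open>Up\<close>, \<open>Dn\<close>,
  \<open>Lt\<close> without reversals that does not start with \<open>Up\<close>, has total height 1 and no earlier prefix
  of positive height. The constructors follow the first-passage decomposition of these words and
  are named after the steps they add.
\<close>

datatype bar = BLU | BL bar | BDU bar | BDLU bar | BDL bar bar

fun flat :: "bar \<Rightarrow> dir list" where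
  "flat BLU = [Lt, Up]"
| "flat (BL b) = Lt # flat b"
| "flat (BDU b) = Dn # flat b @ [Up]"
| "flat (BDLU b) = Dn # flat b @ [Lt, Up]"
| "flat (BDL b c) = Dn # flat b @ Lt # flat c"

fun bar_width :: "bar \<Rightarrow> nat" where
  "bar_width BLU = 1"
| "bar_width (BL b) = Suc (bar_width b)"
| "bar_width (BDU b) = bar_width b"
| "bar_width (BDLU b) = Suc (bar_width b)"
| "bar_width (BDL b c) = Suc (bar_width b + bar_width c)"

text \<open>The number of letters \<open>Lt\<close> and \<open>Up\<close> in
  \<open>flat b\<close>.\<close>

fun bar_hp :: "bar \<Rightarrow> nat" where
  "bar_hp BLU = 2"
| "bar_hp (BL b) = Suc (bar_hp b)"
| "bar_hp (BDU b) = Suc (bar_hp b)"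
| "bar_hp (BDLU b) = bar_hp b + 2"
| "bar_hp (BDL b c) = Suc (bar_hp b + bar_hp c)"

text \<open>
  The state after an \<open>Up\<close> step along the left side, which starts a new row if it crosses the old
  top line \<open>y = h\<close>.
\<close>

definition up_state :: "point set \<Rightarrow> int \<Rightarrow> int \<Rightarrow> int \<Rightarrow> bool" where
  "up_state S x y h \<longleftrightarrow> (if y \<le> h then side_state S x y h Up else y = h + 1 \<and> row_state S x x x y)"

lemma up_state_Up:
  assumes "side_state S x y h d" "d \<noteq> Dn"
  shows "up_state (insert (x, y + 1) S) x (y + 1) h"
proof -
  have "y \<le> h" using assms(1) by (simp add: side_state_def)
  then show ?thesis using side_Up(2,3)[OF assms] by (cases "y = h") (auto simp: up_state_def)
qed

text \<open>The hypothesis on \<open>d\<close> excludes a reversal, since a bar may start with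
  \<open>Dn\<close>. Inner bars begin after a step that is not \<open>Up\<close>, or their first
  step is unrestricted because a \<open>Lt\<close> precedes them.\<close>

lemma bar_legal:
  assumes "side_state S x y h d" "d = Up \<Longrightarrow> hd (flat b) = Lt"
  shows "legal S (x, y) (flat b) \<and> endp (x, y) (flat b) = (x - int (bar_width b), y + 1) \<and>
    up_state (S \<union> set (verts (x, y) (flat b))) (x - int (bar_width b)) (y + 1) h"
  using assms
proof (induction b arbitrary: S x y d)
  case BLU
  note 2 = side_Lt[OF BLU(1)]
  from side_Up(1)[OF 2(2)] up_state_Up[OF 2(2)] 2(1) show ?case
    by (auto simp: insert_commute)
next
  case (BL b)
  from side_Lt[OF BL(2)] show ?case using BL.IH[of "insert (x - 1, y) S" "x - 1" y Lt]
    by (auto simp: algebra_simps)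
next
  case (BDU b)
  have d: "d \<noteq> Up" using BDU(3) by auto
  have y: "y \<le> h" using BDU(2) by (simp add: side_state_def)
  from side_Dn[OF BDU(2) d] have 1: "step_ok S (x, y) Dn" "side_state (insert (x, y - 1) S) x (y - 1) h Dn" .
  note 2 = BDU.IH[OF 1(2), simplified]
  let ?S = "S \<union> set (verts (x, y) (Dn # flat b))"
  \<comment> \<open>The inner bar started at y - 1 and ends at y \<le> h, so it has not crossed the
    top line and the walk is still on the left side.\<close>
  have 3: "side_state ?S (x - int (bar_width b)) y h Up" using 2 y by (simp add: up_state_def)
  from side_Up(1)[OF 3] up_state_Up[OF 3] 1 2 show ?case
    by (auto simp: legal_append verts_append insert_commute)
next
  case (BDLU b)
  have d: "d \<noteq> Up" using BDLU(3) by auto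
  have y: "y \<le> h" using BDLU(2) by (simp add: side_state_def)
  from side_Dn[OF BDLU(2) d] have 1: "step_ok S (x, y) Dn" "side_state (insert (x, y - 1) S) x (y - 1) h Dn" .
  note 2 = BDLU.IH[OF 1(2), simplified]
  let ?S = "S \<union> set (verts (x, y) (Dn # flat b))"
  have 3: "side_state ?S (x - int (bar_width b)) y h Up" using 2 y by (simp add: up_state_def)
  note 4 = side_Lt[OF 3]
  from side_Up(1)[OF 4(2)] up_state_Up[OF 4(2)] 1 2 4(1) show ?case
    by (auto simp: legal_append verts_append algebra_simps insert_commute)
next
  case (BDL b c)
  have d: "d \<noteq> Up" using BDL(4) by auto
  have y: "y \<le> h" using BDL(3) by (simp add: side_state_def)
  from side_Dn[OF BDL(3) d] have 1: "step_ok S (x, y) Dn" "side_state (insert (x, y - 1) S) x (y - 1) h Dn" .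
  note 2 = BDL.IH(1)[OF 1(2), simplified]
  let ?S = "S \<union> set (verts (x, y) (Dn # flat b))"
  have 3: "side_state ?S (x - int (bar_width b)) y h Up" using 2 y by (simp add: up_state_def)
  note 4 = side_Lt[OF 3]
  note 5 = BDL.IH(2)[OF 4(2), simplified]
  have "insert (x - int (bar_width b) - 1, y) ?S \<union> set (verts (x - int (bar_width b) - 1, y) (flat c))
    = S \<union> set (verts (x, y) (flat (BDL b c)))"
    using 2 by (auto simp: verts_append)
  then show ?case using 1 2 4(1) 5
    by (auto simp: legal_append algebra_simps)
qed

text \<open>This reads off the first-passage decomposition. Since the walk closes, it cannot stay on
  the left side forever. After \<open>Dn\<close> the induction hypothesis finds the first return to
  the old height, and a second application treats what follows.\<close>

lemma side_parse:
  assumes "closes S (x, y) w" "side_state S x y h d"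
  shows "\<exists>g v. w = g @ v \<and> v \<noteq> [] \<and> (g = [Up] \<and> d \<noteq> Dn \<or> (\<exists>b. g = flat b \<and> (d = Up \<longrightarrow> hd g = Lt)))"
  using assms
proof (induction w arbitrary: S x y d rule: length_induct)
  case (1 w)
  note cl = "1.prems"(1) and st = "1.prems"(2)
  have x: "x \<le> 0" and z: "(0, 0) \<in> S" "(x, y) \<in> S" "y \<le> h" using st by (auto simp: side_state_def)
  obtain e w' where w: "w = e # w'" using cl by (cases w) auto
  have w': "w' \<noteq> []" using cl x w by (auto split: if_splits)
  have ok: "step_ok S (x, y) e" and cl': "closes (insert ((x, y) + dvec e) S) ((x, y) + dvec e) w'"
    using cl w w' by auto
  show ?case
  proof (cases e)
    case Up
    then have "d \<noteq> Dn" using side_not(2)[OF st] ok by blast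
    then show ?thesis using w w' Up by (intro exI[of _ "[Up]"] exI[of _ w']) auto
  next
    case Rt
    have "\<not> x < 0" using side_not(3)[OF st] ok Rt by blast
    then have "x = 0" using x by simp
    then have col: "\<And>y'. (0, y') \<in> S \<longleftrightarrow> y \<le> y' \<and> y' \<le> 0" and h: "h = 0"
      using st by (auto simp: side_state_def)
    have S: "fst s = 0" if "s \<in> S" for s
      using side_state_bounds[OF st, of "fst s" "snd s"] that \<open>x = 0\<close> by auto
    have "y \<noteq> 0" using closes_bound[OF cl'] z \<open>x = 0\<close> Rt by auto
    then have "y < 0" using z h by auto
    have "y \<le> snd s" if "s \<in> S" for s using S[OF that] col[of "snd s"] that by (cases s) auto
    then have False
      using not_closes_below[of "insert (1, y) S" y w' y] cl' Rt \<open>x = 0\<close> \<open>y < 0\<close> col by auto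
    then show ?thesis ..
  next
    case Lt
    have st': "side_state (insert (x - 1, y) S) (x - 1) y h Lt" by (rule side_Lt[OF st])
    have "closes (insert (x - 1, y) S) (x - 1, y) w'" using cl' Lt by simp
    then obtain g v where g: "w' = g @ v" "v \<noteq> []" "g = [Up] \<or> (\<exists>b. g = flat b)"
      using "1.IH" st' w by (metis length_Cons lessI)
    then obtain b where b: "Lt # g = flat b" by (metis flat.simps(1,2))
    then have "hd (flat b) = Lt" by (metis list.sel(1))
    moreover have "w = flat b @ v" using g(1) w Lt b by (metis append_Cons)
    ultimately show ?thesis using g(2) by blast
  next
    case Dn
    then have d: "d \<noteq> Up" using side_not(1)[OF st] ok by blast
    have st': "side_state (insert (x, y - 1) S) x (y - 1) h Dn" by (rule side_Dn(2)[OF st d])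
    have cl'': "closes (insert (x, y - 1) S) (x, y - 1) w'" using cl' Dn by simp
    then obtain b v where g: "w' = flat b @ v" "v \<noteq> []"
      using "1.IH"[rule_format, of w' "insert (x, y - 1) S" x "y - 1" Dn] st' w by auto
    let ?S = "insert (x, y - 1) S \<union> set (verts (x, y - 1) (flat b))"
    have "up_state ?S (x - int (bar_width b)) y h" "endp (x, y - 1) (flat b) = (x - int (bar_width b), y)"
      using bar_legal[OF st', of b] by auto
    then have "side_state ?S (x - int (bar_width b)) y h Up" "closes ?S (x - int (bar_width b), y) v"
      using z cl'' unfolding g(1) closes_append[OF g(2)] by (auto simp: up_state_def)
    then obtain g' v' where g': "v = g' @ v'" "v' \<noteq> []" "g' = [Up] \<or> (\<exists>c. g' = flat c \<and> hd g' = Lt)"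
      using "1.IH"[rule_format, of v ?S "x - int (bar_width b)" y Up] w g(1) by auto
    have "\<exists>c. flat c = Dn # flat b @ g'"
    proof (cases "g' = [Up]")
      case False
      then obtain c where c: "g' = flat c" "hd g' = Lt" using g' by auto
      then consider "c = BLU" | c' where "c = BL c'" by (cases c) auto
      then show ?thesis using c by cases (metis flat.simps(1,4), metis flat.simps(2,5))
    qed (metis flat.simps(3))
    then show ?thesis using w Dn g g' d by (metis append.assoc append_Cons)
  qed
qed

text \<open>
  An item describes the next row of the polygon, relative to a current top row with \<open>a\<close> cells whose
  left end has distance \<open>b\<close> from the left side of the box: \<open>Short i\<close> is a row of \<open>i + 1 \<le> a\<close> cells,
  \<open>Over i\<close> overhangs by \<open>i + 1 \<le> b\<close> cells, and \<open>Ext\<close> and \<open>ExtBar g\<close> leave the box on the left,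
  without or with a bargraph. In terms of coordinates, the left end of the row is \<open>x = 1 - a\<close> and
  the left side of the box is \<open>x = 1 - a - b\<close>.
\<close>

datatype item = Short nat | Over nat | Ext | ExtBar bar

fun item_ok :: "nat \<times> nat \<Rightarrow> item \<Rightarrow> bool" where
  "item_ok (a, b) (Short i) \<longleftrightarrow> i < a"
| "item_ok (a, b) (Over i) \<longleftrightarrow> i < b"
| "item_ok (a, b) Ext \<longleftrightarrow> True"
| "item_ok (a, b) (ExtBar g) \<longleftrightarrow> True"

fun item_next :: "nat \<times> nat \<Rightarrow> item \<Rightarrow> nat \<times> nat" where
  "item_next (a, b) (Short i) = (i + 1, a + b - 1 - i)"
| "item_next (a, b) (Over i) = (a + i + 1, b - i - 1)"
| "item_next (a, b) Ext = (a + b + 1, 0)"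
| "item_next (a, b) (ExtBar g) = (a + b + 1 + bar_width g, 0)"

text \<open>Again this counts the letters \<open>Lt\<close> and \<open>Up\<close> of the item; the
  right steps of \<open>Short\<close> balance left steps counted before.\<close>

fun item_hp :: "nat \<times> nat \<Rightarrow> item \<Rightarrow> nat" where
  "item_hp (a, b) (Short i) = 1"
| "item_hp (a, b) (Over i) = i + 2"
| "item_hp (a, b) Ext = b + 2"
| "item_hp (a, b) (ExtBar g) = b + 1 + bar_hp g"

fun item_word :: "nat \<times> nat \<Rightarrow> item \<Rightarrow> dir list" where
  "item_word (a, b) (Short i) = replicate (a - 1 - i) Rt @ [Up]"
| "item_word (a, b) (Over i) = replicate (i + 1) Lt @ [Up]"
| "item_word (a, b) Ext = replicate (b + 1) Lt @ [Up]"
| "item_word (a, b) (ExtBar g) = replicate (b + 1) Lt @ flat g"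

fun code_ok :: "nat \<times> nat \<Rightarrow> item list \<Rightarrow> bool" where
  "code_ok s [] \<longleftrightarrow> True"
| "code_ok s (i # is) \<longleftrightarrow> item_ok s i \<and> code_ok (item_next s i) is"

fun code_hp :: "nat \<times> nat \<Rightarrow> item list \<Rightarrow> nat" where
  "code_hp s [] = 0"
| "code_hp s (i # is) = item_hp s i + code_hp (item_next s i) is"

fun code_word :: "nat \<times> nat \<Rightarrow> item list \<Rightarrow> dir list" where
  "code_word s [] = []"
| "code_word s (i # is) = item_word s i @ code_word (item_next s i) is"

abbreviation code_end :: "nat \<times> nat \<Rightarrow> item list \<Rightarrow> nat \<times> nat" where
  "code_end \<equiv> foldl item_next"

text \<open>The closing path: along the top of the last row to x = 1, then down to (1,0).\<close>

definition final_word :: "nat \<Rightarrow> nat \<Rightarrow> dir list" where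
  "final_word a h = replicate a Rt @ replicate h Dn"

section \<open>Words of items and codes are legal\<close>

lemma row_Rts:
  assumes "row_state S l r m h" "r + int k \<le> 0"
  shows "legal S (r, h) (replicate k Rt) \<and> endp (r, h) (replicate k Rt) = (r + int k, h) \<and>
    row_state (S \<union> set (verts (r, h) (replicate k Rt))) l (r + int k) m h"
  using assms
proof (induction k arbitrary: S r)
  case (Suc k)
  have "r < 0" using Suc.prems by simp
  note 1 = row_Rt[OF Suc.prems(1) this]
  have "r + 1 + int k \<le> 0" using Suc.prems(2) by simp
  from Suc.IH[OF 1(2) this] 1(1) show ?case by (simp add: algebra_simps)
qed simp

lemma row_Lts:
  assumes "row_state S l r m h" "m \<le> l - int k"
  shows "legal S (l, h) (replicate k Lt) \<and> endp (l, h) (replicate k Lt) = (l - int k, h) \<and>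
    row_state (S \<union> set (verts (l, h) (replicate k Lt))) (l - int k) r m h"
  using assms
proof (induction k arbitrary: S l)
  case (Suc k)
  have "m < l" using Suc.prems by simp
  note 1 = row_Lt[OF Suc.prems(1) this]
  have "m \<le> l - 1 - int k" using Suc.prems(2) by simp
  from Suc.IH[OF 1(2) this] 1(1) show ?case by (simp add: algebra_simps)
qed simp

lemma row_Lts_exit:
  assumes "row_state S l r m h"
  defines "w \<equiv> replicate (Suc (nat (l - m))) Lt"
  shows "legal S (l, h) w \<and> endp (l, h) w = (m - 1, h) \<and>
    side_state (S \<union> set (verts (l, h) w)) (m - 1) h h Lt"
proof -
  have m: "m \<le> l" using assms(1) by (simp add: row_state_def)
  define w' where "w' = replicate (nat (l - m)) Lt"
  have w: "w = w' @ [Lt]" by (simp add: w_def w'_def replicate_append_same)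
  have "legal S (l, h) w' \<and> endp (l, h) w' = (m, h) \<and>
    row_state (S \<union> set (verts (l, h) w')) m r m h"
    using row_Lts[OF assms(1), of "nat (l - m)"] m unfolding w'_def by simp
  moreover from this have "step_ok (S \<union> set (verts (l, h) w')) (m, h) Lt"
    "side_state (insert (m - 1, h) (S \<union> set (verts (l, h) w'))) (m - 1) h h Lt"
    using row_Lt_exit by blast+
  ultimately show ?thesis by (simp add: w legal_append verts_append)
qed

lemma item_legal:
  fixes a b :: nat
  assumes "row_state S x x m h" "x = 1 - int a" "m = x - int b" "item_ok (a, b) i"
  shows "legal S (x, h) (item_word (a, b) i) \<and>
    (case item_next (a, b) i of (a', b') \<Rightarrow>
      endp (x, h) (item_word (a, b) i) = (1 - int a', h + 1) \<and>
      row_state (S \<union> set (verts (x, h) (item_word (a, b) i)))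
        (1 - int a') (1 - int a') (1 - int a' - int b') (h + 1))"
proof (cases i)
  case (Short k)
  then have k: "k < a" using assms(4) by simp
  let ?w = "replicate (a - 1 - k) Rt"
  have 1: "legal S (x, h) ?w \<and> endp (x, h) ?w = (- int k, h) \<and>
    row_state (S \<union> set (verts (x, h) ?w)) x (- int k) m h"
    using row_Rts[OF assms(1), of "a - 1 - k"] assms(2) k by (simp add: of_nat_diff)
  moreover from this have "step_ok (S \<union> set (verts (x, h) ?w)) (- int k, h) Up"
    "row_state (insert (- int k, h + 1) (S \<union> set (verts (x, h) ?w))) (- int k) (- int k) m (h + 1)"
    using row_Up[of "S \<union> set (verts (x, h) ?w)" x "- int k" m h "- int k"] assms(2) k by auto
  moreover have "1 - int (k + 1) - int (a + b - 1 - k) = m" using assms(2,3) k by simp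
  ultimately show ?thesis using Short by (simp add: legal_append verts_append)
next
  case (Over k)
  then have k: "k < b" using assms(4) by simp
  let ?w = "replicate (k + 1) Lt"
  let ?x = "x - int (k + 1)"
  have 1: "legal S (x, h) ?w \<and> endp (x, h) ?w = (?x, h) \<and>
    row_state (S \<union> set (verts (x, h) ?w)) ?x x m h"
    by (rule row_Lts[OF assms(1)]) (use assms(3) k in simp)
  moreover from this have "step_ok (S \<union> set (verts (x, h) ?w)) (?x, h) Up"
    "row_state (insert (?x, h + 1) (S \<union> set (verts (x, h) ?w))) ?x ?x m (h + 1)"
    using row_Up[of "S \<union> set (verts (x, h) ?w)" ?x x m h ?x] by simp_all
  moreover have "1 - int (a + k + 1) - int (b - k - 1) = m" "?x = 1 - int (a + k + 1)"
    using assms(2,3) k by simp_all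
  ultimately show ?thesis using Over
    by (simp add: legal_append verts_append del: replicate.simps verts.simps legal.simps endp.simps)
      (simp add: algebra_simps)
next
  case Ext
  let ?w = "replicate (b + 1) Lt"
  have "nat (x - m) = b" using assms(3) by simp
  then have 1: "legal S (x, h) ?w \<and> endp (x, h) ?w = (m - 1, h) \<and>
    side_state (S \<union> set (verts (x, h) ?w)) (m - 1) h h Lt"
    using row_Lts_exit[OF assms(1)] by simp
  moreover from this have "step_ok (S \<union> set (verts (x, h) ?w)) (m - 1, h) Up"
    "row_state (insert (m - 1, h + 1) (S \<union> set (verts (x, h) ?w))) (m - 1) (m - 1) (m - 1) (h + 1)"
    using side_Up(1,3)[of "S \<union> set (verts (x, h) ?w)" "m - 1" h h Lt] by simp_all
  moreover have "m - 1 = 1 - int (a + b + 1)" using assms(2,3) by simp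
  ultimately show ?thesis using Ext
    by (simp add: legal_append verts_append del: replicate.simps verts.simps legal.simps endp.simps)
      simp
next
  case (ExtBar g)
  let ?w = "replicate (b + 1) Lt"
  let ?S = "S \<union> set (verts (x, h) ?w)"
  have "nat (x - m) = b" using assms(3) by simp
  then have 1: "legal S (x, h) ?w \<and> endp (x, h) ?w = (m - 1, h) \<and>
    side_state ?S (m - 1) h h Lt"
    using row_Lts_exit[OF assms(1)] by simp
  moreover from this have "legal ?S (m - 1, h) (flat g)"
    "endp (m - 1, h) (flat g) = (m - 1 - int (bar_width g), h + 1)"
    "row_state (?S \<union> set (verts (m - 1, h) (flat g))) (m - 1 - int (bar_width g))
       (m - 1 - int (bar_width g)) (m - 1 - int (bar_width g)) (h + 1)"
    using bar_legal[of ?S "m - 1" h h Lt g] by (simp_all add: up_state_def)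
  moreover have "m - 1 - int (bar_width g) = 1 - int (a + b + 1 + bar_width g)" using assms(2,3) by simp
  ultimately show ?thesis using ExtBar
    by (simp add: legal_append verts_append Un_assoc
        del: replicate.simps verts.simps legal.simps endp.simps)
qed

lemma code_legal:
  assumes "row_state S x x m h" "x = 1 - int a" "m = x - int b" "code_ok (a, b) is"
    "code_end (a, b) is = (a', b')"
  shows "legal S (x, h) (code_word (a, b) is) \<and>
      endp (x, h) (code_word (a, b) is) = (1 - int a', h + int (length is)) \<and>
      row_state (S \<union> set (verts (x, h) (code_word (a, b) is)))
        (1 - int a') (1 - int a') (1 - int a' - int b') (h + int (length is))"
  using assms
proof (induction "is" arbitrary: S x m h a b)
  case (Cons i "is")
  obtain a1 b1 where n: "item_next (a, b) i = (a1, b1)" by fastforce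
  let ?S = "S \<union> set (verts (x, h) (item_word (a, b) i))"
  have "item_ok (a, b) i" using Cons.prems(4) by simp
  from item_legal[OF Cons.prems(1-3) this] n
  have 1: "legal S (x, h) (item_word (a, b) i)" "endp (x, h) (item_word (a, b) i) = (1 - int a1, h + 1)"
    "row_state ?S (1 - int a1) (1 - int a1) (1 - int a1 - int b1) (h + 1)"
    by auto
  have "code_ok (a1, b1) is" "code_end (a1, b1) is = (a', b')" using Cons.prems(4,5) n by simp_all
  from Cons.IH[OF 1(3) refl refl this] 1 show ?case
    by (simp add: n legal_append verts_append Un_assoc add.assoc)
qed auto

section \<open>Closing a polygon, and reading a code off a closing word\<close>

lemma closes_replicate_Dn:
  assumes "\<forall>s\<in>S. fst s \<le> 1" "\<forall>y'<y. (1, y') \<notin> S" "1 \<le> y"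
  shows "closes S (1, y) (replicate (nat y) Dn)"
  using assms
proof (induction "nat y" arbitrary: S y)
  case (Suc n)
  show ?case
  proof (cases "y = 1")
    case True
    then show ?thesis using Suc.prems by (simp add: step_ok.simps)
  next
    case False
    then have n: "n = nat (y - 1)" "nat y = Suc (nat (y - 1))" "replicate (nat (y - 1)) Dn \<noteq> []"
      using Suc by auto
    have "closes (insert (1, y - 1) S) (1, y - 1) (replicate (nat (y - 1)) Dn)"
      using Suc.prems False by (intro Suc.hyps(1)[OF n(1)]) auto
    then show ?thesis using Suc.prems n(2,3) by (simp add: step_ok.simps)
  qed
qed simp

lemma row_exit:
  assumes "row_state S l 0 m h"
  shows "step_ok S (0, h) Rt" "closes (insert (1, h) S) (1, h) (replicate (nat h) Dn)"
proof -
  have S: "fst s \<le> 0" "snd s \<le> h" if "s \<in> S" for s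
    using row_state_bounds[OF assms, of "fst s" "snd s"] that by auto
  have z: "(0, 0) \<in> S" "1 \<le> h" using assms by (simp_all add: row_state_def)
  have "\<not> (\<forall>s\<in>S. h \<le> snd s)" using z by force
  moreover have "(x, y) \<notin> S" if "x > 0" for x y using S[of "(x, y)"] that by auto
  ultimately show "step_ok S (0, h) Rt" using S by (auto simp: step_ok.simps)
  have "fst s \<le> 1" if "s \<in> S" for s using S[OF that] by simp
  then show "closes (insert (1, h) S) (1, h) (replicate (nat h) Dn)"
    using \<open>\<And>x y. 0 < x \<Longrightarrow> (x, y) \<notin> S\<close> z by (intro closes_replicate_Dn) auto
qed

lemma final_closes:
  assumes "row_state S x x m h" "x = 1 - int a"
  shows "closes S (x, h) (final_word a (nat h))"
proof -
  have a: "a = Suc (a - 1)" using assms by (auto simp: row_state_def)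
  have h: "replicate (nat h) Dn \<noteq> []" using assms by (auto simp: row_state_def)
  let ?w = "replicate (a - 1) Rt"
  have "legal S (x, h) ?w \<and> endp (x, h) ?w = (0, h) \<and>
    row_state (S \<union> set (verts (x, h) ?w)) x 0 m h"
    using row_Rts[OF assms(1), of "a - 1"] assms(2) a by simp
  moreover have "final_word a (nat h) = ?w @ Rt # replicate (nat h) Dn"
    by (subst a) (simp add: final_word_def replicate_app_Cons_same)
  ultimately show ?thesis using row_exit[of "S \<union> set (verts (x, h) ?w)" x m h] h
    by (simp add: closes_append)
qed

text \<open>Right steps within the box end with an \<open>Up\<close>, or they continue to x = 1,
  where \<open>closes_down\<close> forces the straight descent. \<open>Lt\<close> can come only
  before the first right step, hence l = r.\<close>

lemma row_parse_Rt:
  assumes "row_state S l r m h" "closes S (r, h) w"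
  shows "(\<exists>k v. r + int k \<le> 0 \<and> v \<noteq> [] \<and> w = replicate k Rt @ Up # v) \<or>
    w = final_word (nat (1 - r)) (nat h) \<or> l = r \<and> hd w = Lt"
  using assms
proof (induction w arbitrary: S r)
  case (Cons d w)
  note st = Cons.prems(1)
  have r: "r \<le> 0" "l \<le> r" and z: "(0, 0) \<in> S" "(r, h) \<in> S" "1 \<le> h" using st by (auto simp: row_state_def)
  have w: "w \<noteq> []" using Cons.prems(2) r by (auto split: if_splits)
  have ok: "step_ok S (r, h) d" and cl: "closes (insert ((r, h) + dvec d) S) ((r, h) + dvec d) w"
    using Cons.prems(2) w by auto
  show ?case
  proof (cases d)
    case Up
    then have "r + int 0 \<le> 0 \<and> w \<noteq> [] \<and> d # w = replicate 0 Rt @ Up # w" using w r by simp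
    then show ?thesis by blast
  next
    case Dn
    then show ?thesis using row_not(1)[OF st r(2) order_refl] ok by blast
  next
    case Lt
    then have "l = r" using row_not(2)[OF st _ order_refl] ok r by fastforce
    then show ?thesis using Lt by simp
  next
    case Rt
    show ?thesis
    proof (cases "r < 0")
      case True
      have "closes (insert (r + 1, h) S) (r + 1, h) w" using cl Rt by simp
      from Cons.IH[OF row_Rt(2)[OF st True] this] r
      consider k v where "r + 1 + int k \<le> 0" "v \<noteq> []" "w = replicate k Rt @ Up # v"
        | "w = final_word (nat (1 - (r + 1))) (nat h)" by auto
      then show ?thesis
      proof cases
        case 1
        then have "r + int (Suc k) \<le> 0 \<and> v \<noteq> [] \<and> d # w = replicate (Suc k) Rt @ Up # v"
          using Rt by simp
        then show ?thesis by blast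
      next
        case 2
        have "nat (1 - r) = Suc (nat (1 - (r + 1)))" using True by simp
        then show ?thesis using 2 Rt by (simp add: final_word_def)
      qed
    next
      case False
      then have "r = 0" using r by simp
      have "w = replicate (nat h) Dn"
      proof (rule closes_down)
        show "closes (insert (1, h) S) (1, h) w" using cl Rt \<open>r = 0\<close> by simp
        \<comment> \<open>If nothing lies left of x = 0, then m = 0, since column m is occupied, and
          the last clause of \<open>row_state\<close> fills the column x = 0.\<close>
        show "(0, y') \<in> insert (1, h) S"
          if nn: "\<forall>s\<in>insert (1, h) S. 0 \<le> fst s" and y': "0 \<le> y'" "y' \<le> h" for y'
        proof -
          have "m \<le> 0" using st by (auto simp: row_state_def)
          then obtain y where "(m, y) \<in> S" using row_state_column[OF st order_refl] by blast
          then have "m = 0" using nn \<open>m \<le> 0\<close> by force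
          then show ?thesis using st y' by (simp add: row_state_def)
        qed
      qed (use z \<open>r = 0\<close> in auto)
      then show ?thesis using Rt \<open>r = 0\<close> by (simp add: final_word_def)
    qed
  qed
qed simp

lemma row_parse_Lt:
  assumes "row_state S l r m h" "closes S (l, h) w"
  shows "(\<exists>k v. m \<le> l - int k \<and> v \<noteq> [] \<and> w = replicate k Lt @ Up # v) \<or>
    (\<exists>v. v \<noteq> [] \<and> w = replicate (Suc (nat (l - m))) Lt @ v) \<or> l = r \<and> hd w = Rt"
  using assms
proof (induction w arbitrary: S l)
  case (Cons d w)
  note st = Cons.prems(1)
  have r: "l \<le> 0" "l \<le> r" "m \<le> l" using st by (auto simp: row_state_def)
  have w: "w \<noteq> []" using Cons.prems(2) r by (auto split: if_splits)
  have ok: "step_ok S (l, h) d" and cl: "closes (insert ((l, h) + dvec d) S) ((l, h) + dvec d) w"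
    using Cons.prems(2) w by auto
  show ?case
  proof (cases d)
    case Up
    then have "m \<le> l - int 0 \<and> w \<noteq> [] \<and> d # w = replicate 0 Lt @ Up # w" using w r by simp
    then show ?thesis by blast
  next
    case Dn
    then show ?thesis using row_not(1)[OF st order_refl r(2)] ok by blast
  next
    case Rt
    then have "l = r" using row_not(3)[OF st order_refl] ok r by fastforce
    then show ?thesis using Rt by simp
  next
    case Lt
    show ?thesis
    proof (cases "m < l")
      case True
      have "closes (insert (l - 1, h) S) (l - 1, h) w" using cl Lt by simp
      from Cons.IH[OF row_Lt(2)[OF st True] this] r
      consider k v where "m \<le> l - 1 - int k" "v \<noteq> []" "w = replicate k Lt @ Up # v"
        | v where "v \<noteq> []" "w = replicate (Suc (nat (l - 1 - m))) Lt @ v" by auto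
      then show ?thesis
      proof cases
        case 1
        then have "m \<le> l - int (Suc k) \<and> v \<noteq> [] \<and> d # w = replicate (Suc k) Lt @ Up # v"
          using Lt by simp
        then show ?thesis by blast
      next
        case 2
        have "nat (l - m) = Suc (nat (l - 1 - m))" using True by simp
        then show ?thesis using 2 Lt by auto
      qed
    next
      case False
      then have "nat (l - m) = 0" using r by simp
      then show ?thesis using Lt w by auto
    qed
  qed
qed simp

lemma row_parse:
  fixes a b :: nat
  assumes "row_state S x x m h" "x = 1 - int a" "m = x - int b" "closes S (x, h) w"
  shows "w = final_word a (nat h) \<or>
    (\<exists>i v. item_ok (a, b) i \<and> v \<noteq> [] \<and> w = item_word (a, b) i @ v)"
proof -
  have a: "nat (1 - x) = a" "nat (x - m) = b" using assms by simp_all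
  consider k v where "x + int k \<le> 0" "v \<noteq> []" "w = replicate k Rt @ Up # v"
    | "w = final_word a (nat h)" | "hd w = Lt"
    using row_parse_Rt[OF assms(1,4)] unfolding a by blast
  then show ?thesis
  proof cases
    case 1
    then have "k < a" using assms(2) by simp
    then have "item_ok (a, b) (Short (a - 1 - k)) \<and> v \<noteq> [] \<and> w = item_word (a, b) (Short (a - 1 - k)) @ v"
      using 1 by simp
    then show ?thesis by blast
  next
    case 3
    then consider k v where "m \<le> x - int k" "v \<noteq> []" "w = replicate k Lt @ Up # v"
      | v where "v \<noteq> []" "w = replicate (Suc b) Lt @ v"
      using row_parse_Lt[OF assms(1,4)] unfolding a by auto
    then show ?thesis
    proof cases
      case (1 k v)
      then obtain j where "k = Suc j" using 3 by (cases k) auto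
      then have "item_ok (a, b) (Over j) \<and> v \<noteq> [] \<and> w = item_word (a, b) (Over j) @ v"
        using 1 assms(3) by simp
      then show ?thesis by blast
    next
      case (2 v)
      let ?u = "replicate (Suc b) Lt"
      let ?S = "S \<union> set (verts (x, h) ?u)"
      have u: "legal S (x, h) ?u \<and> endp (x, h) ?u = (m - 1, h) \<and> side_state ?S (m - 1) h h Lt"
        using row_Lts_exit[OF assms(1)] unfolding a .
      then have "closes ?S (m - 1, h) v" using assms(4) unfolding 2(2) closes_append[OF 2(1)] by simp
      from side_parse[OF this] u obtain g v' where
        g: "v = g @ v'" "v' \<noteq> []" "g = [Up] \<or> (\<exists>c. g = flat c)" by blast
      then consider "g = [Up]" | c where "g = flat c" by blast
      then show ?thesis
      proof cases
        case 1
        then have "item_ok (a, b) Ext \<and> v' \<noteq> [] \<and> w = item_word (a, b) Ext @ v'" using 2 g by simp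
        then show ?thesis by blast
      next
        case (2 c)
        then have "item_ok (a, b) (ExtBar c) \<and> v' \<noteq> [] \<and> w = item_word (a, b) (ExtBar c) @ v'"
          using \<open>w = ?u @ v\<close> g by simp
        then show ?thesis by blast
      qed
    qed
  qed simp
qed

lemma item_word_neq_Nil [simp]: "item_word s i \<noteq> []"
  by (cases s; cases i) auto

lemma code_parse:
  fixes a b :: nat
  assumes "row_state S x x m (int h)" "x = 1 - int a" "m = x - int b" "closes S (x, int h) w"
  shows "\<exists>is. code_ok (a, b) is \<and>
    w = code_word (a, b) is @ final_word (fst (code_end (a, b) is)) (h + length is)"
  using assms
proof (induction w arbitrary: S x m h a b rule: length_induct)
  case (1 w)
  from row_parse[OF "1.prems"] consider "w = final_word a h"
    | i v where "item_ok (a, b) i" "v \<noteq> []" "w = item_word (a, b) i @ v" by auto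
  then show ?case
  proof cases
    case 1
    then show ?thesis by (intro exI[of _ "[]"]) simp
  next
    case (2 i v)
    obtain a' b' where n: "item_next (a, b) i = (a', b')" by fastforce
    let ?S = "S \<union> set (verts (x, int h) (item_word (a, b) i))"
    have "endp (x, int h) (item_word (a, b) i) = (1 - int a', int (Suc h)) \<and>
      row_state ?S (1 - int a') (1 - int a') (1 - int a' - int b') (int (Suc h))"
      using item_legal[OF "1.prems"(1-3) 2(1)] n by (simp add: add.commute)
    moreover from this have "closes ?S (1 - int a', int (Suc h)) v"
      using "1.prems"(4) unfolding 2(3) closes_append[OF 2(2)] by simp
    moreover have "length v < length w" using 2(3) by simp
    ultimately obtain "is" where "code_ok (a', b') is"
      "v = code_word (a', b') is @ final_word (fst (code_end (a', b') is)) (Suc h + length is)"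
      using "1.IH" by blast
    then show ?thesis using 2 n by (intro exI[of _ "i # is"]) simp
  qed
qed

text \<open>
  The root state \<open>(0, 0)\<close> belongs to an empty row at the virtual vertex \<open>(1, 0)\<close>. The first letter
  \<open>Lt\<close> of the code word, which leads from there to the origin, is the closing edge of the polygon
  and not a step of the walk; hence \<open>tl\<close>.
\<close>

definition root_word :: "item list \<Rightarrow> dir list" where
  "root_word is = tl (code_word (0, 0) is) @ final_word (fst (code_end (0, 0) is)) (length is)"

text \<open>The direction \<open>Lt\<close> is that of the closing edge from (1,0), so the walk may
  start upwards, downwards or to the left.\<close>

lemma side_state_origin: "side_state {(0, 0)} 0 0 0 Lt"
  by (auto simp: side_state_def)

text \<open>In the state (0,0) only \<open>Ext\<close> and \<open>ExtBar\<close> are available.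
  Their words begin with exactly one additional \<open>Lt\<close>, the one dropped by
  \<open>tl\<close>; what remains starts on the left side of the one-point box.\<close>

lemma root_row_state:
  assumes "code_ok (0, 0) is" "is \<noteq> []" "code_end (0, 0) is = (a, b)"
  defines "w \<equiv> tl (code_word (0, 0) is)"
  shows "legal {(0, 0)} (0, 0) w \<and> endp (0, 0) w = (1 - int a, int (length is)) \<and>
    row_state ({(0, 0)} \<union> set (verts (0, 0) w)) (1 - int a) (1 - int a) (1 - int a - int b) (int (length is))"
proof -
  obtain i is' where i: "is = i # is'" using assms(2) by (cases "is") auto
  obtain a1 b1 where n: "item_next (0, 0) i = (a1, b1)" by fastforce
  let ?u = "tl (item_word (0, 0) i)"
  let ?S = "{(0, 0)} \<union> set (verts (0, 0) ?u)"
  have "up_state (insert (0, 1) {(0, 0)}) 0 1 0" "step_ok {(0, 0)} (0, 0) Up"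
    using up_state_Up[OF side_state_origin] side_Up(1)[OF side_state_origin] by simp_all
  then have 1: "legal {(0, 0)} (0, 0) ?u \<and> endp (0, 0) ?u = (1 - int a1, 1) \<and>
    row_state ?S (1 - int a1) (1 - int a1) (1 - int a1 - int b1) 1"
    using assms(1) i n bar_legal[OF side_state_origin]
    by (cases i) (auto simp: up_state_def insert_commute)
  have w: "w = ?u @ code_word (a1, b1) is'"
    unfolding w_def i using n by (cases "item_word (0, 0) i") simp_all
  have "code_ok (a1, b1) is'" "code_end (a1, b1) is' = (a, b)" using assms(1,3) i n by simp_all
  from code_legal[OF _ refl refl this, of ?S 1] 1 show ?thesis
    by (simp add: w i legal_append verts_append)
qed

lemma closes_origin_iff:
  "closes {(0, 0)} (0, 0) w \<longleftrightarrow> (\<exists>is. is \<noteq> [] \<and> code_ok (0, 0) is \<and> w = root_word is)"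
proof
  assume "closes {(0, 0)} (0, 0) w"
  from side_parse[OF this side_state_origin]
  obtain g v where g: "w = g @ v" "v \<noteq> []" "g = [Up] \<or> (\<exists>b. g = flat b)" by blast
  then obtain i where i: "g = tl (item_word (0, 0) i)" "item_ok (0, 0) i"
  proof -
    have "[Up] = tl (item_word (0, 0) Ext)" "flat b = tl (item_word (0, 0) (ExtBar b))" for b by simp_all
    then show ?thesis using that g(3) by (metis item_ok.simps(3,4))
  qed
  obtain a b where n: "item_next (0, 0) i = (a, b)" by fastforce
  have "legal {(0, 0)} (0, 0) g \<and> endp (0, 0) g = (1 - int a, 1) \<and>
    row_state ({(0, 0)} \<union> set (verts (0, 0) g)) (1 - int a) (1 - int a) (1 - int a - int b) 1"
    using root_row_state[of "[i]"] i n by simp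
  moreover from this have "closes ({(0, 0)} \<union> set (verts (0, 0) g)) (1 - int a, 1) v"
    using \<open>closes _ _ w\<close> unfolding g(1) closes_append[OF g(2)] by simp
  ultimately obtain "is" where ok: "code_ok (a, b) is"
    "v = code_word (a, b) is @ final_word (fst (code_end (a, b) is)) (1 + length is)"
    using code_parse[where h = 1 and w = v and a = a and b = b] by fastforce
  have "w = root_word (i # is)"
    using ok i n unfolding g(1) root_word_def by (cases "item_word (0, 0) i") simp_all
  then show "\<exists>is. is \<noteq> [] \<and> code_ok (0, 0) is \<and> w = root_word is"
    using ok i n by (intro exI[of _ "i # is"]) simp
next
  assume "\<exists>is. is \<noteq> [] \<and> code_ok (0, 0) is \<and> w = root_word is"
  then obtain "is" where ok: "is \<noteq> []" "code_ok (0, 0) is" "w = root_word is" by blast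
  obtain a b where e: "code_end (0, 0) is = (a, b)" by fastforce
  have "final_word a (length is) \<noteq> []" using ok(1) by (simp add: final_word_def)
  then show "closes {(0, 0)} (0, 0) w"
    using root_row_state[OF ok(2,1) e] final_closes[of _ "1 - int a" "1 - int a - int b" "int (length is)" a]
    by (simp add: ok(3) root_word_def e closes_append)
qed

section \<open>Unique readability of words\<close>

lemma flat_append_neq_Up [simp]: "flat b @ u \<noteq> Up # v" "Up # v \<noteq> flat b @ u"
  by (cases b; simp)+

text \<open>A bar ends at its first arrival at height 1, so no bar is a proper prefix of another.
  The inner bar after \<open>Dn\<close> is therefore determined, and the letters following it tell
  the constructors apart.\<close>

lemma flat_prefix_free: "flat b @ u = flat c @ v \<Longrightarrow> b = c \<and> u = v"
proof (induction b arbitrary: c u v)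
  case BLU then show ?case by (cases c) auto
next
  case (BL b) then show ?case by (cases c) (auto dest: BL.IH)
next
  case (BDU b)
  show ?case
  proof (cases c)
    case (BDU c1)
    then have "flat b @ Up # u = flat c1 @ Up # v" using BDU.prems by simp
    from BDU.IH[OF this] BDU show ?thesis by simp
  next
    case (BDLU c1)
    then have "flat b @ Up # u = flat c1 @ Lt # Up # v" using BDU.prems by simp
    from BDU.IH[OF this] BDLU show ?thesis by simp
  next
    case (BDL c1 c2)
    then have "flat b @ Up # u = flat c1 @ Lt # flat c2 @ v" using BDU.prems by simp
    from BDU.IH[OF this] BDL show ?thesis by simp
  qed (use BDU.prems in simp_all)
next
  case (BDLU b)
  show ?case
  proof (cases c)
    case (BDU c1)
    then have "flat b @ Lt # Up # u = flat c1 @ Up # v" using BDLU.prems by simp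
    from BDLU.IH[OF this] BDU show ?thesis by simp
  next
    case (BDLU c1)
    then have "flat b @ Lt # Up # u = flat c1 @ Lt # Up # v" using BDLU.prems by simp
    from BDLU.IH[OF this] BDLU show ?thesis by simp
  next
    case (BDL c1 c2)
    then have "flat b @ Lt # Up # u = flat c1 @ Lt # flat c2 @ v" using BDLU.prems by simp
    from BDLU.IH[OF this] BDL show ?thesis by simp
  qed (use BDLU.prems in simp_all)
next
  case (BDL b b')
  show ?case
  proof (cases c)
    case (BDL c1 c2)
    then have "flat b @ Lt # flat b' @ u = flat c1 @ Lt # flat c2 @ v" using BDL.prems by simp
    from BDL.IH(1)[OF this] BDL.IH(2)[of u c2 v] BDL show ?thesis by simp
  next
    case (BDU c1)
    then have "flat b @ Lt # flat b' @ u = flat c1 @ Up # v" using BDL.prems by simp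
    from BDL.IH(1)[OF this] show ?thesis by simp
  next
    case (BDLU c1)
    then have "flat b @ Lt # flat b' @ u = flat c1 @ Lt # Up # v" using BDL.prems by simp
    from BDL.IH(1)[OF this] show ?thesis by simp
  qed (use BDL.prems in simp_all)
qed

lemma flat_append_eq_iff: "flat b @ u = flat c @ v \<longleftrightarrow> b = c \<and> u = v"
  using flat_prefix_free by blast

lemma replicate_append_Cons_eq_iff:
  assumes "y \<noteq> x" "z \<noteq> x"
  shows "replicate k x @ y # u = replicate n x @ z # v \<longleftrightarrow> k = n \<and> y = z \<and> u = v"
proof (induction k arbitrary: n)
  case 0 then show ?case using assms by (cases n) auto
next
  case (Suc k) then show ?case using assms by (cases n) auto
qed

text \<open>The number of \<open>Lt\<close> before the next letter identifies the item: none for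
  \<open>Short\<close>, at most b for \<open>Over\<close> by \<open>item_ok\<close>, b + 1 for
  \<open>Ext\<close>. In \<open>ExtBar\<close> the bar after b + 1 letters \<open>Lt\<close> does
  not start with \<open>Up\<close>.\<close>

lemma item_word_prefix_free:
  assumes "item_word s i @ u = item_word s j @ v" "item_ok s i" "item_ok s j"
  shows "i = j \<and> u = v"
proof -
  obtain a b where s: "s = (a, b)" by fastforce
  have Rt [simp]: "replicate n Rt @ Up # x \<noteq> Lt # y" "Lt # y \<noteq> replicate n Rt @ Up # x" for n x y
    by (cases n; simp)+
  have Ov_EB [simp]: "replicate k Lt @ Up # x \<noteq> replicate b Lt @ flat g @ y"
    "replicate b Lt @ flat g @ y \<noteq> replicate k Lt @ Up # x" if "k < b" for k g x y
  proof -
    have "replicate b Lt = replicate k Lt @ Lt # replicate (b - k - 1) Lt"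
      using that by (simp flip: replicate_Suc replicate_add)
    then show "replicate k Lt @ Up # x \<noteq> replicate b Lt @ flat g @ y"
      "replicate b Lt @ flat g @ y \<noteq> replicate k Lt @ Up # x" by simp_all
  qed
  show ?thesis
    using assms unfolding s
    by (cases i; cases j) (auto simp: replicate_append_Cons_eq_iff flat_append_eq_iff)
qed

lemma Up_in_flat: "Up \<in> set (flat b)"
  by (induction b) auto

lemma Up_in_item_word: "Up \<in> set (item_word s i)"
  by (cases s; cases i) (auto simp: Up_in_flat)

lemma Up_notin_final_word: "Up \<notin> set (final_word a h)"
  by (simp add: final_word_def)

text \<open>Every item word contains \<open>Up\<close> and the closing path does not, so the end of
  the code is visible in the word.\<close>

lemma code_word_inj:
  assumes "code_word s is @ final_word a h = code_word s js @ final_word a' h'"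
    "code_ok s is" "code_ok s js"
  shows "is = js"
  using assms
proof (induction "is" arbitrary: s js)
  case Nil
  show ?case
  proof (cases js)
    case (Cons j js')
    then have "Up \<in> set (final_word a h)" using Nil.prems(1) Up_in_item_word[of s j] by simp
    then show ?thesis using Up_notin_final_word by blast
  qed simp
next
  case (Cons i "is")
  show ?case
  proof (cases js)
    case Nil
    then have "final_word a' h' = code_word s (i # is) @ final_word a h" using Cons.prems(1) by simp
    then have "Up \<in> set (final_word a' h')" using Up_in_item_word[of s i] by simp
    then show ?thesis using Up_notin_final_word by blast
  next
    case (Cons j js')
    then have "i = j" "code_word (item_next s i) is @ final_word a h = code_word (item_next s j) js' @ final_word a' h'"
      using item_word_prefix_free[of s i _ j] Cons.prems by auto
    then show ?thesis using Cons.IH[of "item_next s i" js'] Cons.prems Cons by auto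
  qed
qed

lemma root_word_inj: "inj_on root_word {is. is \<noteq> [] \<and> code_ok (0, 0) is}"
proof (rule inj_onI)
  fix "is" js
  assume ok: "is \<in> {is. is \<noteq> [] \<and> code_ok (0, 0) is}" and ok': "js \<in> {is. is \<noteq> [] \<and> code_ok (0, 0) is}"
    and eq: "root_word is = root_word js"
  \<comment> \<open>The letter removed by \<open>tl\<close> is always \<open>Lt\<close> and can be
    restored.\<close>
  have Lt: "code_word (0, 0) ks = Lt # tl (code_word (0, 0) ks)" if "ks \<noteq> []" "code_ok (0, 0) ks" for ks
  proof (cases ks)
    case (Cons k ks')
    then show ?thesis using that by (cases k) auto
  qed (use that in simp)
  show "is = js"
    using code_word_inj[of "(0, 0)" "is" _ _ js] eq ok ok' Lt[of "is"] Lt[of js]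
    unfolding root_word_def by (metis (mono_tags, lifting) append_Cons mem_Collect_eq)
qed

section \<open>Length and half-perimeter\<close>

lemma length_flat: "length (flat b) + bar_width b + 1 = 2 * bar_hp b"
  by (induction b) auto

text \<open>An amortised count: a row of a cells leaves a right steps to be made up to x = 1, and
  each new row adds one down step to the closing path. Including these debts makes the total twice
  the weight.\<close>

lemma length_item_word:
  assumes "item_ok (a, b) i"
  shows "length (item_word (a, b) i) + fst (item_next (a, b) i) + 1 = 2 * item_hp (a, b) i + a"
proof (cases i)
  case (ExtBar g)
  then show ?thesis using length_flat[of g] by simp
qed (use assms in auto)

lemma length_code_word:
  assumes "code_ok (a, b) is"
  shows "length (code_word (a, b) is) + fst (code_end (a, b) is) + length is = 2 * code_hp (a, b) is + a"
  using assms
proof (induction "is" arbitrary: a b)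
  case (Cons i "is")
  obtain a' b' where n: "item_next (a, b) i = (a', b')" by fastforce
  then show ?case using Cons.IH[of a' b'] Cons.prems length_item_word[of a b i] by simp
qed simp

text \<open>The closing path pays the debts of all rows; the \<open>Suc\<close> counts the closing
  edge, that is, the letter lost to \<open>tl\<close>.\<close>

lemma length_root_word:
  assumes "code_ok (0, 0) is" "is \<noteq> []"
  shows "Suc (length (root_word is)) = 2 * code_hp (0, 0) is"
proof -
  have "code_word (0, 0) is \<noteq> []" using assms(2) by (cases "is") auto
  then show ?thesis using length_code_word[OF assms(1)]
    by (cases "code_word (0, 0) is") (auto simp: root_word_def final_word_def)
qed

section \<open>Words and three-sided prudent walks\<close>

definition walk :: "dir list \<Rightarrow> point list" where
  "walk w = (0, 0) # verts (0, 0) w"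

text \<open>All conditions on one step in terms of the prefix q only, so that walks can be treated
  by appending vertices.\<close>

definition sided_step :: "point list \<Rightarrow> point \<Rightarrow> point \<Rightarrow> bool" where
  "sided_step q v v' \<longleftrightarrow> v' - v \<in> unit_vectors \<and>
     (\<forall>k::int. k \<ge> 1 \<longrightarrow> (fst v + k * fst (v' - v), snd v + k * snd (v' - v)) \<notin> set q) \<and>
     (fst v' = xmin (q @ [v']) \<or> snd v' = ymax (q @ [v']) \<or> fst v' = xmax (q @ [v'])) \<and>
     (v' - v \<in> {(1, 0), (-1, 0)} \<and> snd v' = ymin (q @ [v']) \<longrightarrow> bbox q \<subset> bbox (q @ [v']))"

lemma three_sided_iff:
  "three_sided p \<longleftrightarrow> p \<noteq> [] \<and> hd p = (0, 0) \<and> distinct p \<and>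
     (\<forall>i. Suc i < length p \<longrightarrow> sided_step (take (Suc i) p) (p ! i) (p ! Suc i))"
  unfolding three_sided_def prudent_def saw_def sided_step_def Let_def
  by (auto simp flip: take_Suc_conv_app_nth)

lemma three_sided_snoc:
  assumes "p \<noteq> []"
  shows "three_sided (p @ [v]) \<longleftrightarrow> three_sided p \<and> v \<notin> set p \<and> sided_step p (last p) v"
proof -
  have "(\<forall>i. Suc i < length (p @ [v]) \<longrightarrow>
      sided_step (take (Suc i) (p @ [v])) ((p @ [v]) ! i) ((p @ [v]) ! Suc i)) \<longleftrightarrow>
    (\<forall>i. Suc i < length p \<longrightarrow> sided_step (take (Suc i) p) (p ! i) (p ! Suc i)) \<and> sided_step p (last p) v"
    (is "?L \<longleftrightarrow> ?R1 \<and> ?R2")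
  proof (intro iffI conjI allI impI)
    fix i assume "?L" "Suc i < length p"
    then show "sided_step (take (Suc i) p) (p ! i) (p ! Suc i)"
      by (auto simp: nth_append dest!: spec[of _ i])
  next
    assume "?L"
    then show "?R2" using assms by (auto simp: nth_append last_conv_nth dest!: spec[of _ "length p - 1"])
  next
    fix i assume R: "?R1 \<and> ?R2" and i: "Suc i < length (p @ [v])"
    show "sided_step (take (Suc i) (p @ [v])) ((p @ [v]) ! i) ((p @ [v]) ! Suc i)"
    proof (cases "Suc i < length p")
      case True
      then show ?thesis using R by (auto simp: nth_append)
    next
      case False
      then have "Suc i = length p" using i by simp
      moreover from this have "i = length p - 1" "i < length p" by simp_all
      ultimately show ?thesis using R assms by (auto simp: nth_append last_conv_nth)
    qed
  qed
  then show ?thesis using assms unfolding three_sided_iff by auto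
qed

lemma unit_vectors_eq: "unit_vectors = range dvec"
proof -
  have "(UNIV :: dir set) = {Up, Dn, Lt, Rt}" using dir.exhaust by auto
  then have "range dvec = dvec ` {Up, Dn, Lt, Rt}" by simp
  then show ?thesis by (auto simp: unit_vectors_def)
qed

lemma Min_eq_insert_iff:
  assumes "finite A"
  shows "x = Min (insert x A) \<longleftrightarrow> (\<forall>a\<in>A. x \<le> (a :: int))"
    "x = Max (insert x A) \<longleftrightarrow> (\<forall>a\<in>A. a \<le> x)"
  using assms by (auto intro: Min_eqI[symmetric] Max_eqI[symmetric]) (metis Min_le finite_insert insertI2, metis Max_ge finite_insert insertI2)

text \<open>A horizontal step stays within the vertical extent of the box and so enlarges it only by
  passing its left or right side. This gives the bottom-side clause of
  \<open>step_ok\<close>.\<close>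

lemma bbox_horizontal_iff:
  assumes "v \<in> set q" "snd v' = snd v"
  shows "bbox q \<subset> bbox (q @ [v']) \<longleftrightarrow> (\<forall>s\<in>set q. fst v' < fst s) \<or> (\<forall>s\<in>set q. fst s < fst v')"
proof -
  let ?X = "fst ` set q" and ?Y = "snd ` set q"
  have ne: "?X \<noteq> {}" "?Y \<noteq> {}" "snd v' \<in> ?Y" using assms by auto
  have Y: "Min ?Y \<le> snd v'" "snd v' \<le> Max ?Y" using ne by auto
  have b: "bbox q = {Min ?X..Max ?X} \<times> {Min ?Y..Max ?Y}"
    "bbox (q @ [v']) = {min (fst v') (Min ?X)..max (fst v') (Max ?X)} \<times> {Min ?Y..Max ?Y}"
    using ne by (auto simp: bbox_def xmin_def xmax_def ymin_def ymax_def insert_absorb)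
  have lt: "(\<forall>s\<in>set q. fst v' < fst s) \<longleftrightarrow> fst v' < Min ?X" "(\<forall>s\<in>set q. fst s < fst v') \<longleftrightarrow> Max ?X < fst v'"
    using ne by auto
  show ?thesis unfolding b lt
  proof
    assume "{Min ?X..Max ?X} \<times> {Min ?Y..Max ?Y}
        \<subset> {min (fst v') (Min ?X)..max (fst v') (Max ?X)} \<times> {Min ?Y..Max ?Y}"
    then show "fst v' < Min ?X \<or> Max ?X < fst v'" by (auto simp: min_def max_def split: if_splits)
  next
    assume lt: "fst v' < Min ?X \<or> Max ?X < fst v'"
    have "(fst v', snd v') \<in> {min (fst v') (Min ?X)..max (fst v') (Max ?X)} \<times> {Min ?Y..Max ?Y}"
      using Y by (simp add: mem_Times_iff)
    moreover have "(fst v', snd v') \<notin> {Min ?X..Max ?X} \<times> {Min ?Y..Max ?Y}" using lt by auto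
    moreover have "{Min ?X..Max ?X} \<times> {Min ?Y..Max ?Y}
        \<subseteq> {min (fst v') (Min ?X)..max (fst v') (Max ?X)} \<times> {Min ?Y..Max ?Y}" by auto
    ultimately show "{Min ?X..Max ?X} \<times> {Min ?Y..Max ?Y}
        \<subset> {min (fst v') (Min ?X)..max (fst v') (Max ?X)} \<times> {Min ?Y..Max ?Y}" by blast
  qed
qed

lemma all_shift_iff: "(\<forall>k\<ge>1. P (y + k)) \<longleftrightarrow> (\<forall>y'>y. P (y' :: int))" "(\<forall>k\<ge>1. P (y - k)) \<longleftrightarrow> (\<forall>y'<y. P y')"
proof -
  have "P y'" if "\<forall>k\<ge>1. P (y + k)" "y < y'" for y' using that(1)[rule_format, of "y' - y"] that(2) by simp
  then show "(\<forall>k\<ge>1. P (y + k)) \<longleftrightarrow> (\<forall>y'>y. P y')" by auto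
  have "P y'" if "\<forall>k\<ge>1. P (y - k)" "y' < y" for y' using that(1)[rule_format, of "y - y'"] that(2) by simp
  then show "(\<forall>k\<ge>1. P (y - k)) \<longleftrightarrow> (\<forall>y'<y. P y')" by auto
qed

lemma sided_step_iff:
  assumes "v \<in> set q"
  shows "sided_step q v v' \<longleftrightarrow> (\<exists>d. v' = v + dvec d \<and> step_ok (set q) v d)"
proof -
  have "sided_step q v (v + dvec d) \<longleftrightarrow> step_ok (set q) v d" for d
  proof -
    obtain x y where v: "v = (x, y)" by fastforce
    have mm: "fst v' = xmin (q @ [v']) \<longleftrightarrow> (\<forall>s\<in>set q. fst v' \<le> fst s)"
      "fst v' = xmax (q @ [v']) \<longleftrightarrow> (\<forall>s\<in>set q. fst s \<le> fst v')"
      "snd v' = ymin (q @ [v']) \<longleftrightarrow> (\<forall>s\<in>set q. snd v' \<le> snd s)"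
      "snd v' = ymax (q @ [v']) \<longleftrightarrow> (\<forall>s\<in>set q. snd s \<le> snd v')" for v'
      unfolding xmin_def xmax_def ymin_def ymax_def
      using Min_eq_insert_iff[of "fst ` set q" "fst v'"] Min_eq_insert_iff[of "snd ` set q" "snd v'"]
      by simp_all
    have d: "v + dvec d - v = dvec d" "dvec d \<in> unit_vectors" by (simp_all add: unit_vectors_eq)
    have h: "d = Lt \<or> d = Rt \<Longrightarrow> bbox q \<subset> bbox (q @ [v + dvec d]) \<longleftrightarrow>
      (\<forall>s\<in>set q. fst (v + dvec d) < fst s) \<or> (\<forall>s\<in>set q. fst s < fst (v + dvec d))"
      by (rule bbox_horizontal_iff[OF assms]) auto
    have sh: "(\<forall>k\<ge>1. (x, y + k) \<notin> set q) \<longleftrightarrow> (\<forall>y'>y. (x, y') \<notin> set q)"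
      "(\<forall>k\<ge>1. (x, y - k) \<notin> set q) \<longleftrightarrow> (\<forall>y'<y. (x, y') \<notin> set q)"
      "(\<forall>k\<ge>1. (x + k, y) \<notin> set q) \<longleftrightarrow> (\<forall>x'>x. (x', y) \<notin> set q)"
      "(\<forall>k\<ge>1. (x - k, y) \<notin> set q) \<longleftrightarrow> (\<forall>x'<x. (x', y) \<notin> set q)"
      using all_shift_iff[of "\<lambda>z. (x, z) \<notin> set q" y] all_shift_iff[of "\<lambda>z. (z, y) \<notin> set q" x]
      by simp_all
    have side: "A \<or> C \<or> B \<longleftrightarrow> A \<or> B \<or> C" for A B C by blast
    show ?thesis
      unfolding sided_step_def mm d side
      using h by (cases d) (simp_all add: v step_ok.simps sh unit_vectors_def)
  qed
  moreover have "\<exists>d. v' = v + dvec d" if "sided_step q v v'"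
    using that unfolding sided_step_def unit_vectors_eq by (metis add.commute diff_add_cancel imageE)
  ultimately show ?thesis by blast
qed

lemma dvec_inj: "dvec d = dvec d' \<longleftrightarrow> d = d'"
  by (cases d; cases d') auto

lemma step_ok_notin: "step_ok S v d \<Longrightarrow> v + dvec d \<notin> S"
  by (cases v; cases d) (auto simp: step_ok.simps)

lemma last_walk: "last (walk w) = endp (0, 0) w"
proof -
  have "last (c # verts c w) = endp c w" for c
    by (induction w arbitrary: c) auto
  then show ?thesis by (simp add: walk_def)
qed

lemma legal_iff_three_sided: "three_sided (walk w) \<longleftrightarrow> legal {(0, 0)} (0, 0) w"
proof (induction w rule: rev_induct)
  case Nil
  show ?case by (simp add: three_sided_iff walk_def)
next
  case (snoc d w)
  have w: "walk (w @ [d]) = walk w @ [endp (0, 0) w + dvec d]" "walk w \<noteq> []"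
    "set (walk w) = {(0, 0)} \<union> set (verts (0, 0) w)"
    by (simp_all add: walk_def verts_append)
  have l: "endp (0, 0) w \<in> set (walk w)" using last_in_set[OF w(2)] by (simp add: last_walk)
  have "sided_step (walk w) (endp (0, 0) w) (endp (0, 0) w + dvec d) \<longleftrightarrow>
     step_ok (set (walk w)) (endp (0, 0) w) d"
    unfolding sided_step_iff[OF l] by (simp add: dvec_inj)
  \<comment> \<open>Prudence with k = 1 already says that the new vertex is unvisited, so
    distinctness is no separate condition.\<close>
  then have "endp (0, 0) w + dvec d \<notin> set (walk w) \<and> sided_step (walk w) (last (walk w)) (endp (0, 0) w + dvec d) \<longleftrightarrow>
     step_ok (set (walk w)) (endp (0, 0) w) d"
    using step_ok_notin[of "set (walk w)" "endp (0, 0) w" d] unfolding last_walk by blast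
  then show ?case unfolding w(1) three_sided_snoc[OF w(2)] snoc.IH by (simp add: legal_append w(3))
qed

lemma three_sided_imp_walk: "three_sided p \<Longrightarrow> \<exists>w. p = walk w"
proof (induction p rule: rev_induct)
  case Nil then show ?case by (simp add: three_sided_iff)
next
  case (snoc v p)
  show ?case
  proof (cases "p = []")
    case True
    then show ?thesis using snoc.prems by (intro exI[of _ "[]"]) (simp add: three_sided_iff walk_def)
  next
    case False
    then obtain w where w: "p = walk w" and s: "sided_step p (last p) v"
      using snoc unfolding three_sided_snoc[OF False] by blast
    then obtain d where "v = last p + dvec d" using sided_step_iff[of "last p" p v] False by auto
    then have "p @ [v] = walk (w @ [d])" by (simp add: w last_walk) (simp add: walk_def verts_append)
    then show ?thesis by blast
  qed
qed

lemma closes_iff: "closes S c w \<longleftrightarrow> legal S c w \<and> (\<exists>u. w = u @ [Dn] \<and> endp c u = (1, 1))"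
proof (induction S c w rule: closes.induct)
  case (2 S c d w)
  show ?case
  proof (cases "w = []")
    case False
    have "(\<exists>u. d # w = u @ [Dn] \<and> endp c u = (1, 1)) \<longleftrightarrow> (\<exists>u. w = u @ [Dn] \<and> endp (c + dvec d) u = (1, 1))"
    proof
      assume "\<exists>u. d # w = u @ [Dn] \<and> endp c u = (1, 1)"
      then obtain u where "d # w = u @ [Dn]" "endp c u = (1, 1)" by blast
      then show "\<exists>u. w = u @ [Dn] \<and> endp (c + dvec d) u = (1, 1)" using False by (cases u) auto
    next
      assume "\<exists>u. w = u @ [Dn] \<and> endp (c + dvec d) u = (1, 1)"
      then obtain u where "w = u @ [Dn]" "endp (c + dvec d) u = (1, 1)" by blast
      then show "\<exists>u. d # w = u @ [Dn] \<and> endp c u = (1, 1)" by (intro exI[of _ "d # u"]) simp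
    qed
    then show ?thesis using 2 False by simp
  qed auto
qed simp

lemma length_walk [simp]: "length (walk w) = Suc (length w)"
proof -
  have "length (verts c w) = length w" for c by (induction w arbitrary: c) auto
  then show ?thesis by (simp add: walk_def)
qed

lemma walk_snoc: "walk (w @ [d]) = walk w @ [endp (0, 0) w + dvec d]"
  by (simp add: walk_def verts_append)

lemma generic_polygon_iff: "generic_polygon p \<longleftrightarrow> (\<exists>w. p = walk w \<and> closes {(0, 0)} (0, 0) w)"
proof
  assume g: "generic_polygon p"
  then obtain w where w: "p = walk w"
    using three_sided_imp_walk by (auto simp: generic_polygon_def three_sided_polygon_def)
  then have "length w \<ge> 2" using g by (simp add: generic_polygon_def three_sided_polygon_def steps_def)
  then obtain u d where u: "w = u @ [d]" by (cases w rule: rev_cases) auto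
  have "walk u ! length u = endp (0, 0) u" by (metis last_walk last_conv_nth length_walk diff_Suc_1 walk_def list.distinct(1))
  then have "endp (0, 0) u = (1, 1)" using g
    by (simp add: generic_polygon_def w u walk_snoc nth_append)
  moreover have "endp (0, 0) u + dvec d = (1, 0)" using g by (simp add: generic_polygon_def w u walk_snoc)
  ultimately have "d = Dn" by (cases d) auto
  then show "\<exists>w. p = walk w \<and> closes {(0, 0)} (0, 0) w"
    using g w u \<open>endp (0, 0) u = (1, 1)\<close>
    by (auto simp: closes_iff generic_polygon_def three_sided_polygon_def legal_iff_three_sided)
next
  assume "\<exists>w. p = walk w \<and> closes {(0, 0)} (0, 0) w"
  then obtain u where u: "p = walk (u @ [Dn])" "legal {(0, 0)} (0, 0) (u @ [Dn])" "endp (0, 0) u = (1, 1)"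
    by (auto simp: closes_iff)
  have "u \<noteq> []" using u(3) by auto
  moreover have "walk u ! length u = endp (0, 0) u" by (metis last_walk last_conv_nth length_walk diff_Suc_1 walk_def list.distinct(1))
  ultimately show "generic_polygon p" using u legal_iff_three_sided[of "u @ [Dn]"]
    by (auto simp: generic_polygon_def three_sided_polygon_def steps_def walk_snoc nth_append
        unit_vectors_def Suc_le_eq simp flip: zero_prod_def)
qed

lemma walk_inj: "walk w = walk w' \<longleftrightarrow> w = w'"
proof -
  have "verts c w = verts c w' \<Longrightarrow> w = w'" for c
  proof (induction w arbitrary: c w')
    case Nil then show ?case by (cases w') auto
  next
    case (Cons d w) then show ?case by (cases w') (auto simp: dvec_inj)
  qed
  then show ?thesis by (auto simp: walk_def)
qed

definition code_walk :: "item list \<Rightarrow> point list" where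
  "code_walk is = walk (root_word is)"

lemma generic_polygon_codes:
  "bij_betw code_walk {is. is \<noteq> [] \<and> code_ok (0, 0) is} {p. generic_polygon p}"
proof -
  have "inj_on code_walk {is. is \<noteq> [] \<and> code_ok (0, 0) is}"
    using root_word_inj unfolding inj_on_def code_walk_def walk_inj by blast
  moreover have "code_walk ` {is. is \<noteq> [] \<and> code_ok (0, 0) is} = {p. generic_polygon p}"
    unfolding generic_polygon_iff closes_origin_iff code_walk_def by blast
  ultimately show ?thesis by (simp add: bij_betw_def)
qed

lemma half_perimeter_code_walk:
  assumes "code_ok (0, 0) is" "is \<noteq> []"
  shows "half_perimeter (code_walk is) = code_hp (0, 0) is"
  using length_root_word[OF assms] by (simp add: half_perimeter_def steps_def code_walk_def)

section \<open>Enclosed cells\<close>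

abbreviation edge :: "point \<Rightarrow> point \<Rightarrow> complex set" where
  "edge u v \<equiv> closed_segment (embed u) (embed v)"

definition adjacent :: "point \<Rightarrow> point \<Rightarrow> bool" where
  "adjacent u v \<longleftrightarrow> v - u \<in> unit_vectors"

lemma Re_embed [simp]: "Re (embed u) = of_int (fst u)"
  and Im_embed [simp]: "Im (embed u) = of_int (snd u)"
  by (simp_all add: embed_def)

lemma embed_eq_iff [simp]: "embed u = embed v \<longleftrightarrow> u = v"
  by (simp add: complex_eq_iff prod_eq_iff)

lemma adjacent_neq: "adjacent u v \<Longrightarrow> u \<noteq> v"
  by (auto simp: adjacent_def unit_vectors_def zero_prod_def)

lemma horizontal_edge: "edge (x, y) (x + 1, y) = {z. Im z = of_int y \<and> of_int x \<le> Re z \<and> Re z \<le> of_int x + 1}"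
  by (subst closed_segment_same_Im) (auto simp: closed_segment_eq_real_ivl)

lemma vertical_edge: "edge (x, y) (x, y + 1) = {z. Re z = of_int x \<and> of_int y \<le> Im z \<and> Im z \<le> of_int y + 1}"
  by (subst closed_segment_same_Re) (auto simp: closed_segment_eq_real_ivl)

lemma adjacent_cases:
  assumes "adjacent u v"
  obtains x y where "{u, v} = {(x, y), (x + 1, y)}" "edge u v = edge (x, y) (x + 1, y)"
    | x y where "{u, v} = {(x, y), (x, y + 1)}" "edge u v = edge (x, y) (x, y + 1)"
proof -
  obtain a b where u: "u = (a, b)" by fastforce
  have "v \<in> {(a + 1, b), (a - 1, b), (a, b + 1), (a, b - 1)}"
    using assms unfolding adjacent_def unit_vectors_def u by (cases v) auto
  then consider "v = (a + 1, b)" | "v = (a - 1, b)" | "v = (a, b + 1)" | "v = (a, b - 1)" by blast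
  then show ?thesis
  proof cases
    case 1 then show ?thesis using that(1)[of a b] u by simp
  next
    case 2 then show ?thesis using that(1)[of "a - 1" b] u by (simp add: closed_segment_commute insert_commute)
  next
    case 3 then show ?thesis using that(2)[of a b] u by simp
  next
    case 4 then show ?thesis using that(2)[of a "b - 1"] u by (simp add: closed_segment_commute insert_commute)
  qed
qed

text \<open>A non-lattice point of a unit edge determines both endpoints by rounding its coordinates
  down and up. Hence distinct edges meet only in common vertices.\<close>

lemma edge_point_cases:
  assumes "adjacent u v" "z \<in> edge u v"
  shows "z = embed u \<or> z = embed v \<or>
    z \<notin> range embed \<and> {u, v} = {(\<lfloor>Re z\<rfloor>, \<lfloor>Im z\<rfloor>), (\<lceil>Re z\<rceil>, \<lceil>Im z\<rceil>)}"
  using assms(1)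
proof (cases rule: adjacent_cases)
  case (1 x y)
  then have z: "Im z = of_int y" "of_int x \<le> Re z" "Re z \<le> of_int x + 1"
    using assms(2) unfolding horizontal_edge by auto
  have uv: "z = embed u \<or> z = embed v \<longleftrightarrow> z = embed (x, y) \<or> z = embed (x + 1, y)"
    using 1(1) by (auto simp: doubleton_eq_iff)
  show ?thesis
  proof (cases "Re z = of_int x \<or> Re z = of_int x + 1")
    case True
    then have "z = embed (x, y) \<or> z = embed (x + 1, y)" using z by (auto simp: complex_eq_iff)
    then show ?thesis using uv by blast
  next
    case False
    then have "\<lfloor>Re z\<rfloor> = x" "\<lceil>Re z\<rceil> = x + 1" using z by linarith+
    moreover from this have "z \<notin> range embed" by auto
    ultimately show ?thesis using 1(1) z by simp
  qed
next
  case (2 x y)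
  then have z: "Re z = of_int x" "of_int y \<le> Im z" "Im z \<le> of_int y + 1"
    using assms(2) unfolding vertical_edge by auto
  have uv: "z = embed u \<or> z = embed v \<longleftrightarrow> z = embed (x, y) \<or> z = embed (x, y + 1)"
    using 2(1) by (auto simp: doubleton_eq_iff)
  show ?thesis
  proof (cases "Im z = of_int y \<or> Im z = of_int y + 1")
    case True
    then have "z = embed (x, y) \<or> z = embed (x, y + 1)" using z by (auto simp: complex_eq_iff)
    then show ?thesis using uv by blast
  next
    case False
    then have "\<lfloor>Im z\<rfloor> = y" "\<lceil>Im z\<rceil> = y + 1" using z by linarith+
    moreover from this have "z \<notin> range embed" by auto
    ultimately show ?thesis using 2(1) z by simp
  qed
qed

lemma edge_Int_edge:
  assumes "adjacent u v" "adjacent u' v'" "{u, v} \<noteq> {u', v'}"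
  shows "edge u v \<inter> edge u' v' \<subseteq> embed ` ({u, v} \<inter> {u', v'})"
proof
  fix z assume "z \<in> edge u v \<inter> edge u' v'"
  then show "z \<in> embed ` ({u, v} \<inter> {u', v'})"
    using edge_point_cases[OF assms(1), of z] edge_point_cases[OF assms(2), of z] assms(3) by auto
qed

text \<open>The case of two vertices ends the recursion early; a constant last segment would destroy
  injectivity.\<close>

fun polyline :: "point list \<Rightarrow> real \<Rightarrow> complex" where
  "polyline [] = linepath 0 0"
| "polyline [u] = linepath (embed u) (embed u)"
| "polyline [u, v] = linepath (embed u) (embed v)"
| "polyline (u # v # p) = linepath (embed u) (embed v) +++ polyline (v # p)"

fun chain :: "point list \<Rightarrow> bool" where
  "chain (u # v # p) \<longleftrightarrow> adjacent u v \<and> chain (v # p)"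
| "chain _ \<longleftrightarrow> True"

lemma set_zip_tl_subset: "(u, v) \<in> set (zip p (tl p)) \<Longrightarrow> u \<in> set p \<and> v \<in> set p"
  by (metis list.set_sel(2) set_zip_leftD set_zip_rightD tl_Nil)

lemma chain_adjacent: "chain p \<Longrightarrow> (u, v) \<in> set (zip p (tl p)) \<Longrightarrow> adjacent u v"
  by (induction p rule: chain.induct) auto

lemma polyline_arc:
  assumes "length p \<ge> 2" "distinct p" "chain p"
  shows "arc (polyline p) \<and> pathstart (polyline p) = embed (hd p) \<and>
    pathfinish (polyline p) = embed (last p) \<and>
    path_image (polyline p) = (\<Union>(u, v)\<in>set (zip p (tl p)). edge u v)"
  using assms
proof (induction p rule: polyline.induct)
  case (3 u v)
  then show ?case by (auto simp: arc_linepath)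
next
  case (4 u v w p)
  let ?p = "v # w # p"
  have IH: "arc (polyline ?p)" "pathstart (polyline ?p) = embed v" "pathfinish (polyline ?p) = embed (last ?p)"
    "path_image (polyline ?p) = (\<Union>(u, v)\<in>set (zip ?p (tl ?p)). edge u v)"
    using 4 by auto
  \<comment> \<open>Since u does not occur among the later vertices, v is the only vertex the first
    edge can share with a later one.\<close>
  have "edge u v \<inter> path_image (polyline ?p) \<subseteq> {embed v}"
  proof
    fix z assume "z \<in> edge u v \<inter> path_image (polyline ?p)"
    then have "z \<in> (\<Union>(u, v)\<in>set (zip ?p (tl ?p)). edge u v)" "z \<in> edge u v"
      unfolding IH(4) by blast+
    then obtain a b where ab: "(a, b) \<in> set (zip ?p (tl ?p))" "z \<in> edge a b" "z \<in> edge u v"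
      by blast
    have "a \<in> set ?p" "b \<in> set ?p" using set_zip_tl_subset[OF ab(1)] by auto
    then have "a \<noteq> u" "b \<noteq> u" using 4(3) by auto
    moreover have "adjacent a b" using chain_adjacent[OF _ ab(1)] 4(4) by simp
    moreover from calculation have "{u, v} \<noteq> {a, b}" by auto
    ultimately have "z \<in> embed ` ({u, v} \<inter> {a, b})" using edge_Int_edge[of u v a b] ab 4(4) by auto
    then show "z \<in> {embed v}" using \<open>a \<noteq> u\<close> \<open>b \<noteq> u\<close> by blast
  qed
  then have "arc (linepath (embed u) (embed v) +++ polyline ?p)"
    using 4(3,4) IH by (intro arc_join) (auto simp: arc_linepath)
  then show ?case using IH by (simp add: path_image_join)
qed auto

lemma closed_polygon_eq:
  assumes "p \<noteq> []"
  shows "closed_polygon p = (\<Union>(u, v)\<in>set (zip p (tl p)). edge u v) \<union> edge (last p) (hd p)"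
proof -
  obtain n where n: "length p = Suc n" using assms by (cases p) auto
  have "closed_polygon p = (\<Union>i<n. edge (p ! i) (p ! (Suc i mod Suc n))) \<union> edge (p ! n) (p ! 0)"
    unfolding closed_polygon_def n lessThan_Suc by auto
  also have "(\<Union>i<n. edge (p ! i) (p ! (Suc i mod Suc n))) = (\<Union>i<n. edge (p ! i) (p ! Suc i))"
    by (intro SUP_cong) auto
  also have "\<dots> = (\<Union>(u, v)\<in>set (zip p (tl p)). edge u v)"
    using n by (force simp: set_zip nth_tl)
  finally show ?thesis using n assms by (simp add: last_conv_nth hd_conv_nth)
qed

lemma closed_polygon_loop:
  assumes "length p \<ge> 3" "distinct p" "chain p" "adjacent (last p) (hd p)"
  obtains g where "simple_path g" "pathfinish g = pathstart g" "path_image g = closed_polygon p"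
proof
  have p: "arc (polyline p)" "pathstart (polyline p) = embed (hd p)" "pathfinish (polyline p) = embed (last p)"
    "path_image (polyline p) = (\<Union>(u, v)\<in>set (zip p (tl p)). edge u v)"
    using polyline_arc[of p] assms by auto
  let ?l = "linepath (embed (last p)) (embed (hd p))"
  have "p \<noteq> []" using assms by auto
  have int: "path_image (polyline p) \<inter> path_image ?l \<subseteq> {embed (hd p), embed (last p)}"
  proof
    fix z assume "z \<in> path_image (polyline p) \<inter> path_image ?l"
    then obtain a b where ab: "(a, b) \<in> set (zip p (tl p))" "z \<in> edge a b" "z \<in> edge (last p) (hd p)"
      unfolding p(4) by auto
    obtain i where "i < length p - 1" and i': "a = p ! i" "b = p ! Suc i"
      using ab(1) by (auto simp: set_zip nth_tl)
    then have i: "Suc i < length p" "a = p ! i" "b = p ! Suc i" by simp_all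
    \<comment> \<open>The closing edge is none of the edges of the walk. With only two vertices it
      would be, hence the bound on the length.\<close>
    have "{a, b} \<noteq> {last p, hd p}"
    proof
      assume "{a, b} = {last p, hd p}"
      then consider "p ! i = p ! 0" "p ! Suc i = p ! (length p - 1)" | "p ! Suc i = p ! 0"
        unfolding i using \<open>p \<noteq> []\<close> by (auto simp: doubleton_eq_iff last_conv_nth hd_conv_nth)
      then show False
      proof cases
        case 1
        then have "i = 0" "Suc i = length p - 1"
          using i(1) assms(2) \<open>p \<noteq> []\<close> nth_eq_iff_index_eq[of p] by auto
        then show False using assms(1) by simp
      next
        case 2
        then show False using i(1) assms(2) nth_eq_iff_index_eq[OF assms(2) i(1), of 0] \<open>p \<noteq> []\<close> by simp
      qed
    qed
    moreover have "adjacent a b" using chain_adjacent[OF assms(3) ab(1)] .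
    ultimately show "z \<in> {embed (hd p), embed (last p)}"
      using edge_Int_edge[of a b "last p" "hd p"] ab assms(4) by auto
  qed
  show "simple_path (polyline p +++ ?l)"
    using p int adjacent_neq[OF assms(4)] by (intro simple_path_join_loop) (auto simp: arc_linepath)
  show "pathfinish (polyline p +++ ?l) = pathstart (polyline p +++ ?l)" using p by simp
  show "path_image (polyline p +++ ?l) = closed_polygon p"
    using p closed_polygon_eq[OF \<open>p \<noteq> []\<close>] by (simp add: path_image_join)
qed

lemma closed_polygon_point:
  assumes "p \<noteq> []" "chain p" "adjacent (last p) (hd p)" "z \<in> closed_polygon p"
  obtains u v where "u \<in> set p" "v \<in> set p" "adjacent u v" "z \<in> edge u v"
proof -
  have "(\<exists>u v. (u, v) \<in> set (zip p (tl p)) \<and> z \<in> edge u v) \<or> z \<in> edge (last p) (hd p)"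
    using assms(4) unfolding closed_polygon_eq[OF assms(1)] by auto
  then show ?thesis
    using that assms(1,3) chain_adjacent[OF assms(2)] set_zip_tl_subset by (metis hd_in_set last_in_set)
qed

text \<open>The ray is convex, so it lies in one component of the complement, and it makes that
  component unbounded.\<close>

lemma not_inside_upper_ray:
  assumes "\<And>z'. Re z' = Re z \<Longrightarrow> Im z \<le> Im z' \<Longrightarrow> z' \<notin> C"
  shows "z \<notin> inside C"
proof
  assume "z \<in> inside C"
  then have b: "bounded (connected_component_set (- C) z)" by (simp add: inside_def)
  let ?R = "{z'. Re z' = Re z \<and> Im z \<le> Im z'}"
  have "?R = {z'. Re z' = Re z} \<inter> {z'. Im z' \<ge> Im z}" by auto
  then have "convex ?R"
    using convex_Int[OF convex_hyperplane[of 1 "Re z"] convex_halfspace_ge[of "Im z" \<i>]]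
    by (simp add: inner_complex_def)
  then have "?R \<subseteq> connected_component_set (- C) z"
    using assms by (intro connected_component_maximal convex_connected) auto
  then have "bounded ?R" using b bounded_subset by blast
  then obtain B where B: "\<And>z'. z' \<in> ?R \<Longrightarrow> norm z' \<le> B" by (auto simp: bounded_iff)
  let ?z = "Complex (Re z) (max (Im z) (\<bar>B\<bar> + 1))"
  have "norm ?z \<le> B" by (rule B) auto
  moreover have "\<bar>Im ?z\<bar> \<le> norm ?z" by (rule abs_Im_le_cmod)
  ultimately show False by (auto simp: max_def split: if_splits)
qed

text \<open>
  By the Jordan curve theorem, points of the curve are limits of inside points. Near the midpoint of
  a top edge these can only lie in the cell below it. If the top edge is missing, the centre of the
  cell sees infinity along a vertical ray.
\<close>

lemma enclosed_cell_iff_top_edge: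
  assumes p: "length p \<ge> 3" "distinct p" "chain p" "adjacent (last p) (hd p)"
    and top: "\<And>v. v \<in> set p \<Longrightarrow> snd v \<le> h"
    and row: "\<And>x. (x, h) \<in> set p \<Longrightarrow> (x + 1, h) \<in> set p \<Longrightarrow> edge (x, h) (x + 1, h) \<subseteq> closed_polygon p"
  shows "(x, h - 1) \<in> enclosed_cells p \<longleftrightarrow> (x, h) \<in> set p \<and> (x + 1, h) \<in> set p"
proof -
  let ?C = "closed_polygon p"
  have "p \<noteq> []" using p(1) by auto
  note pt = closed_polygon_point[OF this p(3,4)]
  have above: "z \<notin> ?C" if "Im z > of_int h" for z
  proof
    assume "z \<in> ?C"
    then obtain u v where uv: "u \<in> set p" "v \<in> set p" "adjacent u v" "z \<in> edge u v" by (rule pt)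
    from uv(3) show False
    proof (cases rule: adjacent_cases)
      case (1 x y)
      then have "Im z = of_int y" "(x, y) \<in> set p" using uv unfolding horizontal_edge by auto
      then show ?thesis using that top[of "(x, y)"] by simp
    next
      case (2 x y)
      then have "Im z \<le> of_int (y + 1)" "(x, y + 1) \<in> set p" using uv unfolding vertical_edge by auto
      then show ?thesis using that top[of "(x, y + 1)"] by simp
    qed
  qed
  \<comment> \<open>An open vertical strip between consecutive integers contains no point of a
    vertical edge, so the curve crosses it only at integer heights. This is used both for the ray
    above the cell and for the cell being disjoint from the curve.\<close>
  have generic: "(x, y) \<in> set p \<and> (x + 1, y) \<in> set p \<and> Im z = of_int y"
    if "z \<in> ?C" "of_int x < Re z" "Re z < of_int x + 1" "of_int y - 1 < Im z" "Im z \<le> of_int y" for z x y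
  proof -
    obtain u v where uv: "u \<in> set p" "v \<in> set p" "adjacent u v" "z \<in> edge u v" using \<open>z \<in> ?C\<close> by (rule pt)
    from uv(3) show ?thesis
    proof (cases rule: adjacent_cases)
      case (1 x' y')
      then have z: "Im z = of_int y'" "of_int x' \<le> Re z" "Re z \<le> of_int x' + 1" "(x', y') \<in> set p" "(x' + 1, y') \<in> set p"
        using uv unfolding horizontal_edge by auto
      then have "x' = x" "y' = y" using that by linarith+
      then show ?thesis using z by simp
    next
      case (2 x' y')
      then have "Re z = of_int x'" using uv unfolding vertical_edge by auto
      then have "x < x'" "real_of_int x' < real_of_int (x + 1)" using that(2,3) by simp_all
      then show ?thesis unfolding of_int_less_iff by simp
    qed
  qed
  have cell: "box (embed (x, h - 1)) (embed ((x, h - 1) + (1, 1))) =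
    {z. of_int x < Re z \<and> Re z < of_int x + 1 \<and> of_int h - 1 < Im z \<and> Im z < of_int h}"
    by (auto simp: in_box_complex_iff)
  let ?B = "box (embed (x, h - 1)) (embed ((x, h - 1) + (1, 1)))"
  show ?thesis
  proof
    assume enc: "(x, h - 1) \<in> enclosed_cells p"
    show "(x, h) \<in> set p \<and> (x + 1, h) \<in> set p"
    proof (rule ccontr)
      assume not: "\<not> ((x, h) \<in> set p \<and> (x + 1, h) \<in> set p)"
      let ?z = "Complex (of_int x + 1 / 2) (of_int h - 1 / 2)"
      have "z' \<notin> ?C" if "Re z' = Re ?z" "Im ?z \<le> Im z'" for z'
        using generic[of z' x h] above[of z'] that not by (cases "Im z' > of_int h") auto
      then have "?z \<notin> inside ?C" by (rule not_inside_upper_ray)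
      moreover have "?z \<in> ?B" unfolding cell by simp
      ultimately show False using enc unfolding enclosed_cells_def by blast
    qed
  next
    assume vs: "(x, h) \<in> set p \<and> (x + 1, h) \<in> set p"
    obtain g where g: "simple_path g" "pathfinish g = pathstart g" "path_image g = ?C"
      using closed_polygon_loop[OF p] .
    have J: "frontier (inside ?C) = ?C" using Jordan_inside_outside[OF g(1,2)] g(3) by simp
    let ?z = "Complex (of_int x + 1 / 2) (of_int h)"
    have e: "edge (x, h) (x + 1, h) \<subseteq> ?C" using row vs by blast
    have "?z \<in> ?C" using e unfolding horizontal_edge by auto
    then have "?z \<in> closure (inside ?C)" using J unfolding frontier_def by blast
    then obtain z where z: "z \<in> inside ?C" "dist z ?z < 1 / 2"
      unfolding closure_approachable by (meson half_gt_zero zero_less_one)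
    have "\<bar>Re z - Re ?z\<bar> < 1 / 2" "\<bar>Im z - Im ?z\<bar> < 1 / 2"
      using z(2) abs_Re_le_cmod[of "z - ?z"] abs_Im_le_cmod[of "z - ?z"] by (auto simp: dist_norm)
    then have zz: "of_int x < Re z" "Re z < of_int x + 1" "of_int h - 1 < Im z"
      unfolding abs_less_iff complex.sel by linarith+
    have "z \<notin> ?C" using z(1) inside_no_overlap by blast
    have "\<not> Im z > of_int h" using not_inside_upper_ray[of z ?C] above z(1) by force
    moreover have "Im z \<noteq> of_int h" using e zz \<open>z \<notin> ?C\<close> unfolding horizontal_edge by auto
    ultimately have "z \<in> ?B" unfolding cell using zz by auto
    have "?B \<inter> ?C = {}" using generic[of _ x h] unfolding cell by fastforce
    then have "?B \<subseteq> connected_component_set (- ?C) z"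
      using \<open>z \<in> ?B\<close> by (intro connected_component_maximal convex_connected convex_box) auto
    then show "(x, h - 1) \<in> enclosed_cells p"
      unfolding enclosed_cells_def using inside_same_component z(1) by blast
  qed
qed

section \<open>The top row of the polygon of a code\<close>

lemma chain_verts: "chain (c # verts c w)"
  by (induction w arbitrary: c) (simp_all add: adjacent_def unit_vectors_eq)

lemma chain_walk: "chain (walk w)"
  by (simp add: walk_def chain_verts)

lemma verts_edge:
  "(endp c u, endp c u + dvec d) \<in> set (zip (c # verts c (u @ d # v)) (verts c (u @ d # v)))"
  by (induction u arbitrary: c) auto

lemma walk_edge: "(endp (0, 0) u, endp (0, 0) u + dvec d) \<in> set (zip (walk (u @ d # v)) (tl (walk (u @ d # v))))"
  using verts_edge[of "(0, 0)"] by (simp add: walk_def)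

lemma set_verts_replicate_Rt: "set (verts (x, y) (replicate k Rt)) = {x + 1..x + int k} \<times> {y}"
  by (induction k arbitrary: x) auto

lemma set_verts_replicate_Dn: "set (verts (x, y) (replicate k Dn)) = {x} \<times> {y - int k..y - 1}"
  by (induction k arbitrary: y) auto

lemma endp_replicate_Rt: "endp (x, y) (replicate k Rt) = (x + int k, y)"
  by (induction k arbitrary: x) auto

text \<open>The vertices are those of the last \<open>row_state\<close> together with the closing
  path on y = h and x = 1, so the box and the top line can be read off that state.\<close>

lemma code_walk_shape:
  assumes "code_ok (0, 0) is" "is \<noteq> []" "code_end (0, 0) is = (a, b)"
  defines "h \<equiv> int (length is)"
  shows "v \<in> set (code_walk is) \<Longrightarrow> snd v \<le> h \<and> 1 - int a - int b \<le> fst v"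
    and "(x, h) \<in> set (code_walk is) \<longleftrightarrow> 1 - int a \<le> x \<and> x \<le> 1"
    and "\<exists>y. (1 - int a - int b, y) \<in> set (code_walk is)"
    and "1 - int a \<le> x \<Longrightarrow> x \<le> 0 \<Longrightarrow>
      ((x, h), (x + 1, h)) \<in> set (zip (code_walk is) (tl (code_walk is)))"
    and "a \<ge> 1"
proof -
  let ?w = "tl (code_word (0, 0) is)"
  let ?S = "{(0, 0)} \<union> set (verts (0, 0) ?w)"
  have w: "endp (0, 0) ?w = (1 - int a, h)"
    and st: "row_state ?S (1 - int a) (1 - int a) (1 - int a - int b) h"
    using root_row_state[OF assms(1-3)] by (simp_all add: h_def)
  have rw: "root_word is = ?w @ replicate a Rt @ replicate (length is) Dn"
    by (simp add: root_word_def assms(3) final_word_def)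
  have set: "set (code_walk is) = ?S \<union> {2 - int a..1} \<times> {h} \<union> {1} \<times> {0..h - 1}"
    by (auto simp: code_walk_def walk_def rw verts_append w endp_replicate_Rt set_verts_replicate_Rt
        set_verts_replicate_Dn h_def)
  have z: "1 \<le> h" "1 - int a \<le> 0" using st by (simp_all add: row_state_def)
  then show "a \<ge> 1" by simp
  have S: "1 - int a - int b \<le> x \<and> x \<le> 0 \<and> y \<le> h" if "(x, y) \<in> ?S" for x y
    using row_state_bounds[OF st that] .
  show "snd v \<le> h \<and> 1 - int a - int b \<le> fst v" if v: "v \<in> set (code_walk is)" for v
  proof (cases "v \<in> ?S")
    case True
    then show ?thesis using S[of "fst v" "snd v"] by simp
  next
    case False
    then show ?thesis using v z unfolding set by auto
  qed
  have row: "(x, h) \<in> ?S \<longleftrightarrow> x = 1 - int a" for x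
    using st by (auto simp: row_state_def)
  show "(x, h) \<in> set (code_walk is) \<longleftrightarrow> 1 - int a \<le> x \<and> x \<le> 1"
  proof -
    have "(x, h) \<in> set (code_walk is) \<longleftrightarrow> (x, h) \<in> ?S \<or> 2 - int a \<le> x \<and> x \<le> 1"
      unfolding set using z by auto
    then show ?thesis unfolding row using z by auto
  qed
  show "\<exists>y. (1 - int a - int b, y) \<in> set (code_walk is)"
    using row_state_column[OF st, of "1 - int a - int b"] z(2) unfolding set by auto
  show "((x, h), (x + 1, h)) \<in> set (zip (code_walk is) (tl (code_walk is)))"
    if x: "1 - int a \<le> x" "x \<le> 0"
  proof -
    define j where "j = nat (x - (1 - int a))"
    have j: "j < a" "x = 1 - int a + int j" using x by (auto simp: j_def)
    then have "a = j + Suc (a - Suc j)" by simp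
    then have "replicate a Rt = replicate j Rt @ Rt # replicate (a - Suc j) Rt"
      by (metis replicate_Suc replicate_add)
    then have "root_word is = (?w @ replicate j Rt) @ Rt # (replicate (a - Suc j) Rt @ replicate (length is) Dn)"
      by (simp add: rw)
    moreover have "endp (0, 0) (?w @ replicate j Rt) = (x, h)" using j by (simp add: w endp_replicate_Rt)
    ultimately show ?thesis using walk_edge[of "?w @ replicate j Rt" Rt] by (simp add: code_walk_def)
  qed
qed

lemma code_walk_top_row:
  assumes "code_ok (0, 0) is" "is \<noteq> []" "code_end (0, 0) is = (a, b)"
  shows "card (top_row (code_walk is)) = a" "top_offset (code_walk is) = b"
proof -
  let ?p = "code_walk is"
  define h where "h = int (length is)"
  note sh = code_walk_shape[OF assms, folded h_def]
  have g: "generic_polygon ?p" using generic_polygon_codes assms by (auto simp: bij_betw_def)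
  then have p: "length ?p \<ge> 3" "distinct ?p" "last ?p = (1, 0)" "hd ?p = (0, 0)"
    by (auto simp: generic_polygon_def three_sided_polygon_def three_sided_iff steps_def)
  have ne: "?p \<noteq> []" using p(1) by auto
  have adj: "adjacent (last ?p) (hd ?p)" by (simp add: p adjacent_def unit_vectors_def)
  have ch: "chain ?p" by (simp add: code_walk_def chain_walk)
  have x01: "(x, h) \<in> set ?p \<and> (x + 1, h) \<in> set ?p \<longleftrightarrow> 1 - int a \<le> x \<and> x \<le> 0" for x
    by (auto simp: sh(2))
  have cells: "(x, h - 1) \<in> enclosed_cells ?p \<longleftrightarrow> 1 - int a \<le> x \<and> x \<le> 0" for x
    unfolding x01[symmetric]
  proof (rule enclosed_cell_iff_top_edge[OF p(1,2) ch adj])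
    show "snd v \<le> h" if "v \<in> set ?p" for v using sh(1)[OF that] by simp
    show "edge (x, h) (x + 1, h) \<subseteq> closed_polygon ?p" if "(x, h) \<in> set ?p" "(x + 1, h) \<in> set ?p" for x
    proof -
      have "((x, h), (x + 1, h)) \<in> set (zip ?p (tl ?p))" using that x01[of x] sh(4)[of x] by blast
      then show ?thesis unfolding closed_polygon_eq[OF ne] by blast
    qed
  qed
  have "(1, h) \<in> set ?p" by (simp add: sh(2))
  then have ymax: "ymax ?p = h" unfolding ymax_def using sh(1) by (intro Max_eqI) force+
  obtain y where "(1 - int a - int b, y) \<in> set ?p" using sh(3) by blast
  then have xmin: "xmin ?p = 1 - int a - int b" unfolding xmin_def using sh(1) by (intro Min_eqI) force+
  have top: "top_row ?p = {1 - int a..0} \<times> {h - 1}"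
  proof (rule set_eqI)
    fix c :: point
    obtain x y where c: "c = (x, y)" by fastforce
    show "c \<in> top_row ?p \<longleftrightarrow> c \<in> {1 - int a..0} \<times> {h - 1}"
      unfolding top_row_def ymax c mem_Collect_eq snd_conv using cells[of x] by (cases "y = h - 1") simp_all
  qed
  show "card (top_row ?p) = a" unfolding top by (simp add: card_cartesian_product)
  have "Min (fst ` top_row ?p) = 1 - int a" unfolding top using sh(5) by (intro Min_eqI) force+
  then show "top_offset ?p = b" by (simp add: top_offset_def xmin)
qed

definition codes :: "nat \<Rightarrow> nat \<Rightarrow> nat \<Rightarrow> item list set" where
  "codes n a b = {is. code_ok (0, 0) is \<and> code_hp (0, 0) is = n \<and> code_end (0, 0) is = (a, b)}"

lemma bij_betw_Collect_filter:
  assumes "bij_betw f A B" "\<And>x. x \<in> A \<Longrightarrow> P x \<longleftrightarrow> Q (f x)"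
  shows "bij_betw f {x \<in> A. P x} {y \<in> B. Q y}"
  using assms unfolding bij_betw_def by (auto intro: inj_on_subset)

text \<open>The bijection matches all three statistics; the empty code is removed because it
  describes no polygon.\<close>

lemma card_polygons_eq_card_codes:
  "card {p. generic_polygon p \<and> half_perimeter p = n \<and> card (top_row p) = a \<and> top_offset p = b}
    = card (codes n a b - {[]})"
proof -
  have "bij_betw code_walk {is \<in> {is. is \<noteq> [] \<and> code_ok (0, 0) is}. is \<in> codes n a b}
    {p \<in> {p. generic_polygon p}. half_perimeter p = n \<and> card (top_row p) = a \<and> top_offset p = b}"
  proof (rule bij_betw_Collect_filter[OF generic_polygon_codes])
    fix "is" assume ok: "is \<in> {is. is \<noteq> [] \<and> code_ok (0, 0) is}"
    obtain a' b' where e: "code_end (0, 0) is = (a', b')" by fastforce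
    show "is \<in> codes n a b \<longleftrightarrow> half_perimeter (code_walk is) = n \<and>
        card (top_row (code_walk is)) = a \<and> top_offset (code_walk is) = b"
      using ok code_walk_top_row[OF _ _ e] half_perimeter_code_walk e by (auto simp: codes_def)
  qed
  moreover have "{is \<in> {is. is \<noteq> [] \<and> code_ok (0, 0) is}. is \<in> codes n a b} = codes n a b - {[]}"
    by (auto simp: codes_def)
  ultimately show ?thesis using bij_betw_same_card by fastforce
qed

section \<open>Generating functions\<close>

text \<open>
  In \<open>gf f g A\<close> the exponent of \<open>t\<close> is \<open>f\<close> and the exponent of the outer variable is \<open>g\<close>. Infinite
  classes would be counted as \<open>0\<close>, hence the finiteness assumptions below.
\<close>

definition gf :: "('x \<Rightarrow> nat) \<Rightarrow> ('x \<Rightarrow> nat) \<Rightarrow> 'x set \<Rightarrow> rat fps fps" where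
  "gf f g A = Abs_fps (\<lambda>k. Abs_fps (\<lambda>n. of_nat (card {x \<in> A. f x = n \<and> g x = k})))"

lemma gf_nth: "gf f g A $ k $ n = of_nat (card {x \<in> A. f x = n \<and> g x = k})"
  by (simp add: gf_def)

lemma gf_Un:
  assumes "A \<inter> B = {}" "\<And>n. finite {x \<in> A. f x = n}" "\<And>n. finite {x \<in> B. f x = n}"
  shows "gf f g (A \<union> B) = gf f g A + gf f g B"
proof -
  have "card {x \<in> A \<union> B. f x = n \<and> g x = k} = card {x \<in> A. f x = n \<and> g x = k} + card {x \<in> B. f x = n \<and> g x = k}" for n k
  proof -
    have "{x \<in> A \<union> B. f x = n \<and> g x = k} = {x \<in> A. f x = n \<and> g x = k} \<union> {x \<in> B. f x = n \<and> g x = k}" by auto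
    moreover have "finite {x \<in> A. f x = n \<and> g x = k}" "finite {x \<in> B. f x = n \<and> g x = k}"
      by (rule finite_subset[OF _ assms(2)[of n]], auto) (rule finite_subset[OF _ assms(3)[of n]], auto)
    ultimately show ?thesis using assms(1) by (simp add: card_Un_disjoint disjoint_iff)
  qed
  then show ?thesis by (simp add: fps_eq_iff gf_nth)
qed

lemma gf_image:
  assumes "inj_on h A" "\<And>x. x \<in> A \<Longrightarrow> f (h x) = f' x" "\<And>x. x \<in> A \<Longrightarrow> g (h x) = g' x"
  shows "gf f g (h ` A) = gf f' g' A"
proof -
  have "card {y \<in> h ` A. f y = n \<and> g y = k} = card {x \<in> A. f' x = n \<and> g' x = k}" for n k
  proof -
    have "{y \<in> h ` A. f y = n \<and> g y = k} = h ` {x \<in> A. f' x = n \<and> g' x = k}" using assms by auto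
    then show ?thesis using assms(1) by (simp add: card_image inj_on_subset)
  qed
  then show ?thesis by (simp add: fps_eq_iff gf_nth)
qed

lemma gf_shift: "gf (\<lambda>x. f x + i) (\<lambda>x. g x + j) A = fps_const (fps_X ^ i) * fps_X ^ j * gf f g A"
proof -
  have "gf (\<lambda>x. f x + i) (\<lambda>x. g x + j) A $ k $ n = (fps_const (fps_X ^ i) * (fps_X ^ j * gf f g A)) $ k $ n" for k n
    by (cases "j \<le> k"; cases "i \<le> n")
      (auto simp: gf_nth fps_X_power_mult_nth intro!: arg_cong[of _ _ card])
  then show ?thesis by (simp add: fps_eq_iff mult.assoc)
qed

lemma gf_singleton: "gf f g {x} = fps_const (fps_X ^ f x) * fps_X ^ g x"
proof -
  have "{y \<in> {x}. f y = n \<and> g y = k} = (if n = f x \<and> k = g x then {x} else {})" for n k by auto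
  then have "gf f g {x} $ k $ n = (fps_const (fps_X ^ f x) * fps_X ^ g x) $ k $ n" for k n
    by (simp add: gf_nth fps_X_power_iff)
  then show ?thesis by (simp add: fps_eq_iff)
qed

lemma gf_times:
  assumes "\<And>n. finite {x \<in> A. f x = n}" "\<And>n. finite {y \<in> B. f' y = n}"
  shows "gf (\<lambda>(x, y). f x + f' y) (\<lambda>(x, y). g x + g' y) (A \<times> B) = gf f g A * gf f' g' B"
proof -
  have "of_nat (card {z \<in> A \<times> B. (case z of (x, y) \<Rightarrow> f x + f' y) = n \<and> (case z of (x, y) \<Rightarrow> g x + g' y) = k})
    = (gf f g A * gf f' g' B) $ k $ n" for n k
  proof -
    define P where "P = (\<lambda>i j. {x \<in> A. f x = i \<and> g x = j})"
    define Q where "Q = (\<lambda>i j. {y \<in> B. f' y = i \<and> g' y = j})"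
    have fin: "finite (P i j)" "finite (Q i j)" for i j
      unfolding P_def Q_def
      by (rule finite_subset[OF _ assms(1)[of i]], auto) (rule finite_subset[OF _ assms(2)[of i]], auto)
    have "{z \<in> A \<times> B. (case z of (x, y) \<Rightarrow> f x + f' y) = n \<and> (case z of (x, y) \<Rightarrow> g x + g' y) = k}
      = (\<Union>(j, i)\<in>{0..k} \<times> {0..n}. P i j \<times> Q (n - i) (k - j))"
      by (auto simp: P_def Q_def)
    also have "card \<dots> = (\<Sum>(j, i)\<in>{0..k} \<times> {0..n}. card (P i j \<times> Q (n - i) (k - j)))"
    proof -
      have "\<forall>z\<in>{0..k} \<times> {0..n}. finite (case z of (j, i) \<Rightarrow> P i j \<times> Q (n - i) (k - j))"
        using fin by auto
      moreover have "\<forall>z\<in>{0..k} \<times> {0..n}. \<forall>z'\<in>{0..k} \<times> {0..n}. z \<noteq> z' \<longrightarrow>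
        (case z of (j, i) \<Rightarrow> P i j \<times> Q (n - i) (k - j)) \<inter> (case z' of (j, i) \<Rightarrow> P i j \<times> Q (n - i) (k - j)) = {}"
        by (auto simp: P_def Q_def)
      ultimately show ?thesis by (subst card_UN_disjoint) (auto simp: split_def)
    qed
    also have "\<dots> = (\<Sum>j=0..k. \<Sum>i=0..n. card (P i j) * card (Q (n - i) (k - j)))"
      by (simp add: sum.cartesian_product card_cartesian_product)
    also have "of_nat \<dots> = (gf f g A * gf f' g' B) $ k $ n"
      by (simp add: fps_mult_nth fps_sum_nth gf_nth P_def Q_def)
    finally show ?thesis .
  qed
  then show ?thesis by (simp add: fps_eq_iff gf_nth)
qed

section \<open>The series B counts bargraphs\<close>

lemma bar_hp_pos: "0 < bar_hp b"
  by (induction b) auto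

lemma finite_bars_le: "finite {b. bar_hp b \<le> n}"
proof (induction n)
  case 0
  have "\<not> bar_hp b \<le> 0" for b using bar_hp_pos[of b] by linarith
  then have empty: "{b. bar_hp b \<le> 0} = {}" by blast
  show ?case unfolding empty by (rule finite.emptyI)
next
  case (Suc n)
  let ?X = "{b. bar_hp b \<le> n}"
  have "{b. bar_hp b \<le> Suc n} \<subseteq> {BLU} \<union> BL ` ?X \<union> BDU ` ?X \<union> BDLU ` ?X \<union> (\<lambda>(b, c). BDL b c) ` (?X \<times> ?X)"
  proof
    fix b assume "b \<in> {b. bar_hp b \<le> Suc n}"
    then show "b \<in> {BLU} \<union> BL ` ?X \<union> BDU ` ?X \<union> BDLU ` ?X \<union> (\<lambda>(b, c). BDL b c) ` (?X \<times> ?X)"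
      by (cases b) auto
  qed
  then show ?case by (rule finite_subset) (use Suc in auto)
qed

lemma finite_bars: "finite {b \<in> A. bar_hp b = n}"
  by (rule finite_subset[OF _ finite_bars_le[of n]]) auto

text \<open>One summand per constructor: its own contributions to \<open>bar_hp\<close> and
  \<open>bar_width\<close> give the monomial, its bar arguments the power of b.\<close>

lemma gf_bars_eq:
  defines "t \<equiv> fps_const fps_X" and "u \<equiv> fps_X" and "b \<equiv> gf bar_hp bar_width UNIV"
  shows "b = u * t ^ 2 + u * t * b + t * b + u * t ^ 2 * b + u * t * b ^ 2"
proof -
  let ?g = "gf bar_hp bar_width"
  let ?D = "(\<lambda>(b, c). BDL b c) ` (UNIV \<times> UNIV)"
  have tt: "fps_const (fps_X ^ i) = t ^ i" for i by (simp add: t_def fps_const_power)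
  have "(UNIV :: bar set) = {BLU} \<union> (range BL \<union> (range BDU \<union> (range BDLU \<union> ?D)))"
  proof (intro set_eqI iffI)
    fix b :: bar
    show "b \<in> {BLU} \<union> (range BL \<union> (range BDU \<union> (range BDLU \<union> ?D)))" by (cases b) auto
  qed simp
  then have "b = ?g ({BLU} \<union> (range BL \<union> (range BDU \<union> (range BDLU \<union> ?D))))" by (simp only: b_def)
  also have "\<dots> = ?g {BLU} + (?g (range BL) + (?g (range BDU) + (?g (range BDLU) + ?g ?D)))"
    by ((subst gf_Un[OF _ finite_bars finite_bars], force)+, rule refl)
  also have "?g {BLU} = t ^ 2 * u" by (simp add: gf_singleton tt u_def)
  also have "?g (range BL) = t * u * b"
    using gf_image[of BL UNIV bar_hp "\<lambda>b. bar_hp b + 1" bar_width "\<lambda>b. bar_width b + 1"]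
    unfolding gf_shift tt by (simp add: inj_on_def b_def u_def)
  also have "?g (range BDU) = t * b"
    using gf_image[of BDU UNIV bar_hp "\<lambda>b. bar_hp b + 1" bar_width "\<lambda>b. bar_width b + 0"]
    unfolding gf_shift tt by (simp add: inj_on_def b_def u_def)
  also have "?g (range BDLU) = t ^ 2 * u * b"
    using gf_image[of BDLU UNIV bar_hp "\<lambda>b. bar_hp b + 2" bar_width "\<lambda>b. bar_width b + 1"]
    unfolding gf_shift tt by (simp add: inj_on_def b_def u_def)
  also have "?g ?D = gf (\<lambda>z. (case z of (b, c) \<Rightarrow> bar_hp b + bar_hp c) + 1)
      (\<lambda>z. (case z of (b, c) \<Rightarrow> bar_width b + bar_width c) + 1) (UNIV \<times> UNIV)"
    by (rule gf_image) (auto simp: inj_on_def)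
  also have "\<dots> = t * u * (b * b)"
    unfolding gf_shift tt b_def by (subst gf_times) (simp_all add: finite_bars[of UNIV, simplified] u_def)
  finally show ?thesis by (simp add: power2_eq_square algebra_simps)
qed

lemma B_ser_eq_gf: "B_ser = gf bar_hp bar_width UNIV"
  by (rule B_ser_eqI) (rule gf_bars_eq)

section \<open>Codes counted by their last item\<close>

abbreviation "hp0 \<equiv> code_hp (0, 0)"
abbreviation "end_a is \<equiv> fst (code_end (0, 0) is)"
abbreviation "end_b is \<equiv> snd (code_end (0, 0) is)"

definition Codes :: "item list set" where
  "Codes = {is. code_ok (0, 0) is}"

lemma code_ok_snoc: "code_ok s (js @ [i]) \<longleftrightarrow> code_ok s js \<and> item_ok (code_end s js) i"
  by (induction js arbitrary: s) auto

lemma code_hp_snoc: "code_hp s (js @ [i]) = code_hp s js + item_hp (code_end s js) i"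
  by (induction js arbitrary: s) auto

lemma item_hp_pos: "0 < item_hp s i"
  by (cases s; cases i) auto

lemma finite_items: "finite {i. item_ok s i \<and> item_hp s i \<le> n}"
proof -
  obtain a b where s: "s = (a, b)" by fastforce
  have "{i. item_ok s i \<and> item_hp s i \<le> n} \<subseteq> Short ` {..<a} \<union> Over ` {..<b} \<union> {Ext} \<union> ExtBar ` {g. bar_hp g \<le> n}"
  proof
    fix i assume "i \<in> {i. item_ok s i \<and> item_hp s i \<le> n}"
    then show "i \<in> Short ` {..<a} \<union> Over ` {..<b} \<union> {Ext} \<union> ExtBar ` {g. bar_hp g \<le> n}"
      unfolding s by (cases i) auto
  qed
  then show ?thesis by (rule finite_subset) (simp add: finite_bars_le)
qed

text \<open>Removing the last item lowers the weight, and for a given state only finitely many items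
  have bounded weight.\<close>

lemma finite_Codes: "finite {is \<in> Codes. hp0 is = n}"
proof (induction n rule: less_induct)
  case (less n)
  have "{is \<in> Codes. hp0 is = n} \<subseteq> {[]} \<union>
    (\<Union>m\<in>{..<n}. \<Union>js\<in>{is \<in> Codes. hp0 is = m}. (\<lambda>i. js @ [i]) ` {i. item_ok (code_end (0, 0) js) i \<and> item_hp (code_end (0, 0) js) i \<le> n})"
  proof
    fix "is" assume ok: "is \<in> {is \<in> Codes. hp0 is = n}"
    show "is \<in> {[]} \<union> (\<Union>m\<in>{..<n}. \<Union>js\<in>{is \<in> Codes. hp0 is = m}. (\<lambda>i. js @ [i]) ` {i. item_ok (code_end (0, 0) js) i \<and> item_hp (code_end (0, 0) js) i \<le> n})"
    proof (cases "is" rule: rev_cases)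
      case (snoc js i)
      have "js \<in> Codes" "item_ok (code_end (0, 0) js) i" "hp0 js + item_hp (code_end (0, 0) js) i = n"
        using ok snoc by (auto simp: Codes_def code_ok_snoc code_hp_snoc)
      moreover from this have "hp0 js < n" "item_hp (code_end (0, 0) js) i \<le> n"
        using item_hp_pos[of "code_end (0, 0) js" i] by linarith+
      ultimately show ?thesis using snoc by blast
    qed simp
  qed
  then show ?case by (rule finite_subset) (use less finite_items in auto)
qed

lemma finite_codes: "finite (codes n a b)"
  by (rule finite_subset[OF _ finite_Codes[of n]]) (auto simp: codes_def Codes_def)

text \<open>
  Unlike \<open>R_gf\<close>, this includes the empty code, which contributes the constant term \<open>1\<close>.
\<close>

definition code_gf :: "rat fps fps fps" where
  "code_gf = Abs_fps (\<lambda>b. Abs_fps (\<lambda>a. Abs_fps (\<lambda>n. of_nat (card (codes n a b)))))"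

lemma code_gf_nth: "code_gf $ b $ a $ n = of_nat (card (codes n a b))"
  by (simp add: code_gf_def)

text \<open>Replacing w by ut charges every cell of the offset one unit of t and one of width: this
  is the cost of the left steps to the side of the box that precede leaving it.\<close>

lemma subst_ut_code_gf: "subst_ut code_gf = gf (\<lambda>is. hp0 is + end_b is) (\<lambda>is. end_a is + end_b is) Codes"
proof -
  have "subst_ut code_gf $ k $ n = of_nat (card {is \<in> Codes. hp0 is + end_b is = n \<and> end_a is + end_b is = k})" for k n
  proof -
    have "{is \<in> Codes. hp0 is + end_b is = n \<and> end_a is + end_b is = k}
      = (\<Union>b\<in>{b. b \<le> k \<and> b \<le> n}. codes (n - b) (k - b) b)"
      by (auto simp: codes_def Codes_def prod_eq_iff)
    also have "card \<dots> = (\<Sum>b\<in>{b. b \<le> k \<and> b \<le> n}. card (codes (n - b) (k - b) b))"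
      by (rule card_UN_disjoint) (auto simp: finite_codes, auto simp: codes_def)
    also have "\<dots> = (\<Sum>b\<le>k. if b \<le> n then card (codes (n - b) (k - b) b) else 0)"
      by (rule sum.mono_neutral_cong_left) auto
    finally show ?thesis
      by (simp add: subst_ut_nth fps_sum_nth fps_X_power_mult_nth code_gf_nth if_distrib not_less
          cong: if_cong) (auto intro!: sum.cong)
  qed
  then show ?thesis by (simp add: fps_eq_iff gf_nth)
qed

definition ext_items :: "item set" where
  "ext_items = insert Ext (range ExtBar)"

text \<open>For \<open>ext_items\<close> these are \<open>item_hp\<close> minus b + 1 and the new
  width minus a + b + 1. They do not depend on the state, so the codes ending in such an item are
  counted by a product.\<close>

fun ext_hp :: "item \<Rightarrow> nat" where
  "ext_hp (ExtBar g) = bar_hp g" | "ext_hp _ = 1"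

fun ext_width :: "item \<Rightarrow> nat" where
  "ext_width (ExtBar g) = bar_width g" | "ext_width _ = 0"

lemma gf_ext_items: "gf ext_hp ext_width ext_items = B_ser + fps_const fps_X"
proof -
  have "gf ext_hp ext_width ({Ext} \<union> range ExtBar) = gf ext_hp ext_width {Ext} + gf ext_hp ext_width (range ExtBar)"
  proof (rule gf_Un)
    show "finite {x \<in> range ExtBar. ext_hp x = n}" for n
      by (rule finite_subset[of _ "ExtBar ` {g. bar_hp g \<le> n}"]) (auto simp: finite_bars_le)
  qed auto
  also have "gf ext_hp ext_width (range ExtBar) = gf bar_hp bar_width UNIV"
    by (rule gf_image) (auto simp: inj_on_def)
  finally show ?thesis by (simp add: ext_items_def B_ser_eq_gf gf_singleton)
qed

lemma finite_ext_items: "finite {i \<in> ext_items. ext_hp i = n}"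
  by (rule finite_subset[of _ "insert Ext (ExtBar ` {g. bar_hp g \<le> n})"]) (auto simp: ext_items_def finite_bars_le)

definition ext_codes :: "item list set" where
  "ext_codes = {js @ [i] | js i. js \<in> Codes \<and> i \<in> ext_items}"

lemma gf_ext_codes:
  "gf hp0 end_a ext_codes = fps_const fps_X * fps_X * (subst_ut code_gf * (B_ser + fps_const fps_X))"
proof -
  have "ext_codes = (\<lambda>(js, i). js @ [i]) ` (Codes \<times> ext_items)"
    by (auto simp: ext_codes_def)
  also have "gf hp0 end_a \<dots> = gf (\<lambda>z. (case z of (js, i) \<Rightarrow> (hp0 js + end_b js) + ext_hp i) + 1)
     (\<lambda>z. (case z of (js, i) \<Rightarrow> (end_a js + end_b js) + ext_width i) + 1) (Codes \<times> ext_items)"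
  proof (rule gf_image)
    fix z assume "z \<in> Codes \<times> ext_items"
    then obtain js i a b where z: "z = (js, i)" "i \<in> ext_items" "code_end (0, 0) js = (a, b)" by fastforce
    show "hp0 (case z of (js, i) \<Rightarrow> js @ [i]) = (case z of (js, i) \<Rightarrow> (hp0 js + end_b js) + ext_hp i) + 1"
      "end_a (case z of (js, i) \<Rightarrow> js @ [i]) = (case z of (js, i) \<Rightarrow> (end_a js + end_b js) + ext_width i) + 1"
      using z(2) by (auto simp: z(1,3) code_hp_snoc ext_items_def)
  qed (auto simp: inj_on_def)
  also have "\<dots> = fps_const fps_X * fps_X * (subst_ut code_gf * (B_ser + fps_const fps_X))"
    unfolding gf_shift
  proof (subst gf_times)
    show "finite {is \<in> Codes. hp0 is + end_b is = n}" for n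
      by (rule finite_subset[of _ "\<Union>m\<le>n. {is \<in> Codes. hp0 is = m}"]) (auto simp: finite_Codes)
  qed (simp_all add: finite_ext_items gf_ext_items subst_ut_code_gf)
  finally show ?thesis .
qed

text \<open>A new row of a + 1 cells forces the item \<open>Short a\<close>, and
  \<open>Short\<close> preserves the width. The predecessor thus has width a + 1 + b, and its row
  has more than a cells exactly when its offset b' is at most b. The sum is a coefficient of
  \<open>quot_wu\<close>.\<close>

lemma card_short_codes:
  "card {js @ [Short i] | js i. js @ [Short i] \<in> codes (Suc n) (Suc a) b} = (\<Sum>b'\<le>b. card (codes n (a + 1 + b - b') b'))"
proof -
  have "{js @ [Short i] | js i. js @ [Short i] \<in> codes (Suc n) (Suc a) b}
    = (\<lambda>js. js @ [Short a]) ` (\<Union>b'\<in>{..b}. codes n (a + 1 + b - b') b')"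
  proof (intro set_eqI iffI)
    fix x assume "x \<in> {js @ [Short i] | js i. js @ [Short i] \<in> codes (Suc n) (Suc a) b}"
    then obtain js i where x: "x = js @ [Short i]" "js @ [Short i] \<in> codes (Suc n) (Suc a) b" by blast
    obtain a' b' where e: "code_end (0, 0) js = (a', b')" by fastforce
    have *: "code_ok (0, 0) js" "i < a'" "hp0 js = n" "i = a" "a' + b' - 1 - i = b"
      using x(2) by (auto simp: codes_def code_ok_snoc code_hp_snoc e)
    then have "b' \<le> b" "a' = a + 1 + b - b'" by linarith+
    then have "js \<in> codes n (a + 1 + b - b') b'" using * e by (simp add: codes_def)
    then show "x \<in> (\<lambda>js. js @ [Short a]) ` (\<Union>b'\<in>{..b}. codes n (a + 1 + b - b') b')"
      using \<open>b' \<le> b\<close> x *(4) by blast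
  next
    fix x assume "x \<in> (\<lambda>js. js @ [Short a]) ` (\<Union>b'\<in>{..b}. codes n (a + 1 + b - b') b')"
    then obtain js b' where x: "x = js @ [Short a]" "b' \<le> b" "js \<in> codes n (a + 1 + b - b') b'" by blast
    then have "js @ [Short a] \<in> codes (Suc n) (Suc a) b"
      by (auto simp: codes_def code_ok_snoc code_hp_snoc)
    then show "x \<in> {js @ [Short i] | js i. js @ [Short i] \<in> codes (Suc n) (Suc a) b}" using x by blast
  qed
  moreover have "card ((\<lambda>js. js @ [Short a]) ` (\<Union>b'\<in>{..b}. codes n (a + 1 + b - b') b'))
     = card (\<Union>b'\<in>{..b}. codes n (a + 1 + b - b') b')"
    by (rule card_image) (simp add: inj_on_def)
  moreover have "\<dots> = (\<Sum>b'\<le>b. card (codes n (a + 1 + b - b') b'))"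
    by (rule card_UN_disjoint) (auto simp: finite_codes, auto simp: codes_def)
  ultimately show ?thesis by simp
qed

text \<open>\<open>Over i\<close> moves i + 1 cells from the offset to the row at weight i + 2. With
  a factor t^2 u split off, t^i and the shifted indices remain, as in
  \<open>quot_wut\<close>.\<close>

lemma card_over_codes:
  "card {js @ [Over i] | js i. js @ [Over i] \<in> codes (Suc (Suc n)) (Suc a) b}
    = (\<Sum>i\<in>{i. i \<le> a \<and> i \<le> n}. card (codes (n - i) (a - i) (b + 1 + i)))"
proof -
  have "{js @ [Over i] | js i. js @ [Over i] \<in> codes (Suc (Suc n)) (Suc a) b}
    = (\<Union>i\<in>{i. i \<le> a \<and> i \<le> n}. (\<lambda>js. js @ [Over i]) ` codes (n - i) (a - i) (b + 1 + i))"
  proof (intro set_eqI iffI)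
    fix x assume "x \<in> {js @ [Over i] | js i. js @ [Over i] \<in> codes (Suc (Suc n)) (Suc a) b}"
    then obtain js i where x: "x = js @ [Over i]" "js @ [Over i] \<in> codes (Suc (Suc n)) (Suc a) b" by blast
    obtain a' b' where e: "code_end (0, 0) js = (a', b')" by fastforce
    have *: "code_ok (0, 0) js" "i < b'" "hp0 js + i = n" "a' + i = a" "b' - i - 1 = b"
      using x(2) by (auto simp: codes_def code_ok_snoc code_hp_snoc e)
    then have "i \<le> a" "i \<le> n" "hp0 js = n - i" "a' = a - i" "b' = b + 1 + i" by linarith+
    then have "js \<in> codes (n - i) (a - i) (b + 1 + i)" using * e by (simp add: codes_def)
    then show "x \<in> (\<Union>i\<in>{i. i \<le> a \<and> i \<le> n}. (\<lambda>js. js @ [Over i]) ` codes (n - i) (a - i) (b + 1 + i))"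
      using \<open>i \<le> a\<close> \<open>i \<le> n\<close> x by blast
  next
    fix x assume "x \<in> (\<Union>i\<in>{i. i \<le> a \<and> i \<le> n}. (\<lambda>js. js @ [Over i]) ` codes (n - i) (a - i) (b + 1 + i))"
    then obtain js i where x: "x = js @ [Over i]" "i \<le> a" "i \<le> n" "js \<in> codes (n - i) (a - i) (b + 1 + i)" by blast
    then have "js @ [Over i] \<in> codes (Suc (Suc n)) (Suc a) b"
      by (auto simp: codes_def code_ok_snoc code_hp_snoc)
    then show "x \<in> {js @ [Over i] | js i. js @ [Over i] \<in> codes (Suc (Suc n)) (Suc a) b}" using x by blast
  qed
  moreover have "card (\<Union>i\<in>{i. i \<le> a \<and> i \<le> n}. (\<lambda>js. js @ [Over i]) ` codes (n - i) (a - i) (b + 1 + i))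
     = (\<Sum>i\<in>{i. i \<le> a \<and> i \<le> n}. card ((\<lambda>js. js @ [Over i]) ` codes (n - i) (a - i) (b + 1 + i)))"
    by (rule card_UN_disjoint) (auto simp: finite_codes)
  moreover have "card ((\<lambda>js. js @ [Over i]) ` codes n' a' b') = card (codes n' a' b')" for i n' a' b'
    by (rule card_image) (simp add: inj_on_def)
  ultimately show ?thesis by simp
qed

lemma codes_cases:
  "codes n a b = (if n = 0 \<and> a = 0 \<and> b = 0 then {[]} else {}) \<union>
    ({js @ [Short i] | js i. js @ [Short i] \<in> codes n a b} \<union> ({js @ [Over i] | js i. js @ [Over i] \<in> codes n a b} \<union>
     (if b = 0 then {is \<in> ext_codes. hp0 is = n \<and> end_a is = a} else {})))" (is "_ = ?A \<union> (?B \<union> (?C \<union> ?D))")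
proof (intro set_eqI iffI)
  fix x assume x: "x \<in> codes n a b"
  show "x \<in> ?A \<union> (?B \<union> (?C \<union> ?D))"
  proof (cases x rule: rev_cases)
    case Nil
    then show ?thesis using x by (auto simp: codes_def)
  next
    case (snoc js i)
    obtain a' b' where e: "code_end (0, 0) js = (a', b')" by fastforce
    show ?thesis
    proof (cases "i \<in> ext_items")
      case True
      then have "x \<in> ext_codes" "b = 0" using x snoc e
        by (auto simp: ext_codes_def codes_def Codes_def code_ok_snoc ext_items_def)
      then show ?thesis using x by (simp add: codes_def)
    next
      case False
      then consider k where "i = Short k" | k where "i = Over k" by (cases i) (auto simp: ext_items_def)
      then show ?thesis using x snoc by cases auto
    qed
  qed
next
  fix x assume "x \<in> ?A \<union> (?B \<union> (?C \<union> ?D))"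
  moreover have "x \<in> codes n a b" if "x \<in> ext_codes" "hp0 x = n" "end_a x = a" "b = 0"
  proof -
    obtain js i where x: "x = js @ [i]" "js \<in> Codes" "i \<in> ext_items" using \<open>x \<in> ext_codes\<close> by (auto simp: ext_codes_def)
    obtain a' b' where e: "code_end (0, 0) js = (a', b')" by fastforce
    have "item_ok (a', b') i" "snd (item_next (a', b') i) = 0" using x(3) by (auto simp: ext_items_def)
    moreover have "code_end (0, 0) x = item_next (a', b') i" by (simp add: x e)
    ultimately have "code_end (0, 0) x = (a, b)" using \<open>end_a x = a\<close> \<open>b = 0\<close> by (metis prod.collapse)
    moreover have "code_ok (0, 0) x" using x \<open>item_ok (a', b') i\<close> e by (simp add: Codes_def code_ok_snoc)
    ultimately show ?thesis using \<open>hp0 x = n\<close> by (simp add: codes_def)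
  qed
  ultimately show "x \<in> codes n a b" by (auto simp: codes_def split: if_splits)
qed

lemma card_codes:
  "card (codes n a b) = (if n = 0 \<and> a = 0 \<and> b = 0 then 1 else 0) +
    (card {js @ [Short i] | js i. js @ [Short i] \<in> codes n a b} + (card {js @ [Over i] | js i. js @ [Over i] \<in> codes n a b} +
     (if b = 0 then card {is \<in> ext_codes. hp0 is = n \<and> end_a is = a} else 0)))" (is "_ = ?a + (card ?B + (card ?C + ?d))")
proof -
  let ?A = "if n = 0 \<and> a = 0 \<and> b = 0 then {[]} else {} :: item list set"
  let ?D = "if b = 0 then {is \<in> ext_codes. hp0 is = n \<and> end_a is = a} else {}"
  have eq: "codes n a b = ?A \<union> (?B \<union> (?C \<union> ?D))" by (rule codes_cases)
  have "finite (?A \<union> (?B \<union> (?C \<union> ?D)))" using finite_codes[of n a b] unfolding eq[symmetric] .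
  then have fin: "finite ?A" "finite ?B" "finite ?C" "finite ?D" unfolding finite_Un by blast+
  have "?C \<inter> ?D = {}" by (auto simp: ext_codes_def ext_items_def)
  moreover have "?B \<inter> (?C \<union> ?D) = {}" by (auto simp: ext_codes_def ext_items_def)
  moreover have "?A \<inter> (?B \<union> (?C \<union> ?D)) = {}" by (auto simp: ext_codes_def)
  ultimately have "card (?A \<union> (?B \<union> (?C \<union> ?D))) = card ?A + (card ?B + (card ?C + card ?D))"
    using fin by (simp only: card_Un_disjoint finite_Un)
  moreover have "card ?A = ?a" "card ?D = ?d" by simp_all
  ultimately show ?thesis using eq by (simp only:)
qed

lemma short_code_pos:
  assumes "js @ [Short i] \<in> codes n a b"
  shows "0 < n \<and> 0 < a"
proof -
  obtain a' b' where "code_end (0, 0) js = (a', b')" by fastforce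
  then show ?thesis using assms by (auto simp: codes_def code_hp_snoc)
qed

lemma over_code_pos:
  assumes "js @ [Over i] \<in> codes n a b"
  shows "2 \<le> n \<and> 0 < a"
proof -
  obtain a' b' where "code_end (0, 0) js = (a', b')" by fastforce
  then show ?thesis using assms by (auto simp: codes_def code_hp_snoc)
qed

lemma code_gf_eq: "code_gf = 1 + fe_linear code_gf"
proof -
  have "code_gf $ b $ a $ n = (1 + fe_linear code_gf) $ b $ a $ n" for n a b
  proof -
    have 1: "of_nat (card {js @ [Short i] | js i. js @ [Short i] \<in> codes n a b})
      = (fps_const fps_X * fps_X * quot_wu code_gf $ b) $ a $ n"
    proof (cases "n = 0 \<or> a = 0")
      case True
      then have "{js @ [Short i] | js i. js @ [Short i] \<in> codes n a b} = {}" using short_code_pos by fastforce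
      then show ?thesis using True by (cases a) (auto simp: mult.assoc)
    next
      case False
      then obtain n' a' where "n = Suc n'" "a = Suc a'" by (metis not0_implies_Suc)
      then show ?thesis
        by (simp add: card_short_codes mult.assoc quot_wu_def fps_sum_nth code_gf_nth add.commute)
    qed
    have 2: "of_nat (card {js @ [Over i] | js i. js @ [Over i] \<in> codes n a b})
      = (fps_const fps_X * fps_X * (fps_const fps_X * quot_wut code_gf $ b)) $ a $ n"
    proof (cases "n < 2 \<or> a = 0")
      case True
      then have "{js @ [Over i] | js i. js @ [Over i] \<in> codes n a b} = {}" using over_code_pos by fastforce
      then show ?thesis using True by (cases a; cases n) (auto simp: mult.assoc)
    next
      case False
      then obtain n' a' where na: "n = Suc (Suc n')" "a = Suc a'"
        by (metis less_2_cases_iff not0_implies_Suc One_nat_def)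
      have "(\<Sum>i\<in>{i. i \<le> a' \<and> i \<le> n'}. card (codes (n' - i) (a' - i) (b + 1 + i)))
        = (\<Sum>i\<le>a'. if i \<le> n' then card (codes (n' - i) (a' - i) (b + 1 + i)) else 0)"
        by (rule sum.mono_neutral_cong_left) auto
      then show ?thesis unfolding na card_over_codes
        by (simp add: mult.assoc quot_wut_def fps_sum_nth code_gf_nth fps_X_power_mult_nth)
          (auto simp: code_gf_nth intro!: sum.cong)
    qed
    have 3: "of_nat (card {is \<in> ext_codes. hp0 is = n \<and> end_a is = a})
      = (fps_const fps_X * fps_X * (subst_ut code_gf * (B_ser + fps_const fps_X))) $ a $ n"
      unfolding gf_ext_codes[symmetric] gf_nth ..
    show ?thesis
      unfolding code_gf_nth card_codes fps_add_nth fe_linear_nth of_nat_add 1 2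
      by (simp add: 3)
  qed
  then show ?thesis by (simp add: fps_eq_iff)
qed

lemma R_gf_eq: "R_gf = code_gf - 1"
proof -
  have "card (codes n a b - {[]}) = card (codes n a b) - (if n = 0 \<and> a = 0 \<and> b = 0 then 1 else 0)" for n a b
    by (simp add: codes_def card_Diff_singleton_if)
  moreover have "[] \<in> codes 0 0 0" by (simp add: codes_def)
  then have "card (codes 0 0 0) \<ge> 1"
    using finite_codes[of 0 0 0] by (metis One_nat_def Suc_leI card_gt_0_iff empty_iff)
  ultimately have "R_gf $ b $ a $ n = (code_gf - 1) $ b $ a $ n" for n a b
    by (simp add: R_gf_def code_gf_nth card_polygons_eq_card_codes of_nat_diff)
  then show ?thesis by (simp add: fps_eq_iff)
qed

text \<open>On the series 1 both difference quotients vanish and \<open>subst_ut\<close> gives 1, so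
  \<open>fe_linear\<close> maps 1 to the inhomogeneous term. Subtracting 1 from the fixed point
  equation of \<open>code_gf\<close> therefore gives the functional equation.\<close>

lemma functional_equation_R_gf: "functional_equation R_gf"
proof -
  have "quot_wu 1 = 0"
    by (auto simp: fps_eq_iff quot_wu_def fps_sum_nth intro!: sum.neutral)
  moreover have "quot_wut 1 = 0"
    by (auto simp: fps_eq_iff quot_wut_def fps_sum_nth intro!: sum.neutral)
  moreover have "subst_ut 1 $ m = 1 $ m" for m
  proof -
    have "subst_ut 1 $ m = (\<Sum>b\<le>m. if b = 0 then 1 $ m else 0)"
      unfolding subst_ut_nth by (intro sum.cong) auto
    then show ?thesis by simp
  qed
  then have "subst_ut 1 = 1" by (simp add: fps_eq_iff)
  ultimately have "fe_linear 1 = fps_const fps_X * fps_const (fps_const fps_X) * (fps_const B_ser + fps_const (fps_const fps_X))"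
    by (simp add: fe_linear_def Let_def)
  then show ?thesis
    unfolding functional_equation_iff R_gf_eq fe_linear_diff using code_gf_eq by (simp add: algebra_simps)
qed

theorem theorem3p3:
  shows "(\<exists>!F. functional_equation F) \<and> functional_equation R_gf \<and>
    (\<lambda>k. by_t (scale_w ((fps_X * q_ser ^ 2) ^ k) L_ser *
                (\<Prod>j<k. scale_w ((fps_X * q_ser ^ 2) ^ j) K_ser)))
      sums by_t (diag R_gf)"
  using functional_equation_R_gf functional_equation_unique diag_sums by blast

end
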